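(* Let $0<\epsilon<1$, let $n\ge3$ be an odd integer and $k:=\frac{n-3}{2}$. Let $f\in C_c^\infty(\mathbb{B})$, where $\mathbb{B}$ is the unit ball in $\mathbb{R}^n$, and let $g=\mathcal{R}f$. For each $(m,l)$ with $m\ge0$ and $1\le l\le d_{m,n}$ put $$h_{m,l}(t)=\frac{\omega_{2k+3}\,t^{2k+1}}{\omega_{2k+2}}\,g_{m,l}(t),\qquad \widetilde f_{m,l}(t)=\frac{f_{m,l}(t)}{t^m}.$$ Then, for each such $(m,l)$, $\widetilde f_{m,l}$ can be recovered from $h_{m,l}$ in the annular region $\mathbb{B}(\epsilon,1)$ by solving the linear ordinary differential equation $$\left[\frac{d}{dt}D^{m+2k}h_{m,l}\right](t)=\frac{(-1)^{m+k}k!\,2^{k}}{t^{2(m+k)}}\left[\mathcal{L}_{m+k}\left(t^{2(m+k)+1}\widetilde f_{m,l}\right)\right](1-t)$$ with initial conditions $\widetilde f_{m,l}^{(i)}(1-\epsilon')=0$ for $0\le i\le m+k-1$, where $\epsilon'>0$ is small enough that $1-\epsilon'>\epsilon$ and $f(x)=0$ whenever $|x|\ge1-\epsilon'$. That is, $\widetilde f_{m,l}$ satisfies this equation for all $t\in(0,1-\epsilon)$ together with these initial conditions, and its restriction to $(\epsilon,1)$ is the only $m+k$ times continuously differentiable function on $(\epsilon,1)$ that does so (with $h_{m,l}$ given).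
   Context: $\mathbb{B}$ is the open unit ball in $\mathbb{R}^n$, $\mathbb{B}(\epsilon,1)=\{x\in\mathbb{R}^n:\epsilon<|x|<1\}$, and $\omega_j$ denotes here the surface area of the unit sphere in $\mathbb{R}^j$. The spherical mean transform of $f$ (extended by zero to $\mathbb{R}^n$) is $$\mathcal{R}f(p,t)=\frac{1}{|\mathbb{S}^{n-1}|}\int_{\mathbb{S}^{n-1}}f(p+t\theta)\,dS(\theta),\qquad (p,t)\in\mathbb{S}^{n-1}\times(0,2),$$ where $|\mathbb{S}^{n-1}|$ is the surface area of the unit sphere and $dS$ the surface measure. For each $m\ge0$, $\{Y_{m,l}\}_{l=1}^{d_{m,n}}$ is an orthonormal basis (in $L^2(\mathbb{S}^{n-1},dS)$) of the spherical harmonics of degree $m$, where $d_{0,n}=1$ and $d_{m,n}=\frac{(2m+n-2)(n+m-3)!}{m!(n-2)!}$ for $m\ge1$ is the dimension of that space. The coefficients are $f_{m,l}(r)=\int_{\mathbb{S}^{n-1}}f(r\theta)\overline{Y_{m,l}(\theta)}\,dS(\theta)$ and $g_{m,l}(t)=\int_{\mathbb{S}^{n-1}}g(\theta,t)\overline{Y_{m,l}(\theta)}\,dS(\theta)$. For an integer $N\ge0$, $$\mathcal{L}_N=\sum_{l=0}^N\frac{(N+l)!}{(N-l)!\,l!\,2^l}(1-t)^{N-l}D^{N-l},\qquad D=\frac1t\frac{d}{dt},\quad D^0=\mathrm{id},$$ and $[\mathcal{L}_NF](s)$ denotes the value of the function $\mathcal{L}_NF$ at the point $s$ (so the coefficient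 becomes $(1-s)^{N-l}$). In the equation $\mathcal{L}_{m+k}$ is applied to the function $r\mapsto r^{2(m+k)+1}\widetilde f_{m,l}(r)$ and the result is evaluated at $r=1-t$. *)

theory Defs
  imports "HOL-Analysis.Analysis"
begin

text \<open>Differentiability classes on open sets: \<open>C_k_on k f S\<close> is meant for open \<open>S\<close> only, where
  all derivatives below are determined by \<open>f\<close> on \<open>S\<close>. It is also used with domain type \<open>real\<close>.\<close>

primrec C_k_on ::
  "nat \<Rightarrow> ('a::euclidean_space \<Rightarrow> 'b::real_normed_vector) \<Rightarrow> 'a set \<Rightarrow> bool" where
  "C_k_on 0 f S \<longleftrightarrow> continuous_on S f"
| "C_k_on (Suc k) f S \<longleftrightarrow>
     (\<forall>x\<in>S. f differentiable (at x)) \<and>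
     (\<forall>b\<in>Basis. C_k_on k (\<lambda>x. frechet_derivative f (at x) b) S)"

text \<open>Functions in \<open>C_c^\<infinity>(S)\<close> are identified with their extension by zero to the whole space.\<close>

definition smooth_compact_support ::
  "('a::euclidean_space \<Rightarrow> complex) \<Rightarrow> 'a set \<Rightarrow> bool" where
  "smooth_compact_support f S \<longleftrightarrow>
     (\<forall>k. C_k_on k f S) \<and>
     compact (closure {x. f x \<noteq> 0}) \<and> closure {x. f x \<noteq> 0} \<subseteq> S"

text \<open>The surface measure of the unit sphere: \<open>dS(A)\<close> is the dimension times the Lebesgue measure
  of the cone \<open>{x. 0 < norm x < 1 \<and> x / norm x \<in> A}\<close>, which is the normalization of \<open>dS\<close> in
  polar coordinates \<open>dx = r^(n-1) dr dS\<close>.\<close>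

definition sphere_measure :: "'a::euclidean_space measure" where
  "sphere_measure =
     scale_measure (of_nat DIM('a))
       (distr (restrict_space lborel (ball 0 1 - {0})) (restrict_space borel (sphere 0 1))
          (\<lambda>x. x /\<^sub>R norm x))"

text \<open>\<open>sphere_area j\<close> is the surface area \<open>2 \<pi>^(j/2) / \<Gamma>(j/2)\<close> of the unit sphere of
  \<open>j\<close>-dimensional space; here \<open>j\<close> is a number, not the dimension of a type. The lemma below
  relates it to the surface measure.\<close>

definition sphere_area :: "nat \<Rightarrow> real" where
  "sphere_area j = real j * unit_ball_vol (real j)"

lemma measure_sphere_measure:
  "measure (sphere_measure :: 'a::euclidean_space measure) (sphere 0 1) = sphere_area DIM('a)"
proof -
  let ?B = "ball 0 1 - {0} :: 'a set"
  let ?M = "restrict_space lborel ?B"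
  let ?N = "restrict_space borel (sphere 0 1) :: 'a measure"
  let ?g = "\<lambda>x::'a. x /\<^sub>R norm x"
  have g: "?g \<in> ?M \<rightarrow>\<^sub>M ?N"
    by (intro measurable_restrict_space2 measurable_restrict_space1)
       (auto simp: space_restrict_space)
  have "emeasure ?M (?g -` sphere 0 1 \<inter> space ?M) = emeasure ?M ?B"
    by (rule arg_cong[where f = "emeasure ?M"]) (auto simp: space_restrict_space)
  also have "\<dots> = emeasure lborel ?B"
    by (rule emeasure_restrict_space) auto
  also have "\<dots> = emeasure lborel (ball 0 1 :: 'a set)"
    by (rule emeasure_Diff_null_set) auto
  also have "\<dots> = ennreal (unit_ball_vol (real DIM('a)))"
    by (simp add: emeasure_ball)
  finally have eq: "emeasure (distr ?M ?N ?g) (sphere 0 1) = ennreal (unit_ball_vol (real DIM('a)))"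
    using g by (subst emeasure_distr) (auto simp: sets_restrict_space)
  show ?thesis
    unfolding sphere_measure_def sphere_area_def measure_def
    by (simp add: eq ennreal_of_nat_eq_real_of_nat enn2real_mult)
qed

definition spherical_mean ::
  "('a::euclidean_space \<Rightarrow> complex) \<Rightarrow> 'a \<Rightarrow> real \<Rightarrow> complex" where
  "spherical_mean f p t =
     (LINT \<theta>|sphere_measure. f (p + t *\<^sub>R \<theta>)) /
       of_real (measure (sphere_measure :: 'a measure) (sphere 0 1))"

definition laplacian ::
  "('a::euclidean_space \<Rightarrow> complex) \<Rightarrow> 'a \<Rightarrow> complex" where
  "laplacian p x =
     (\<Sum>b\<in>Basis. frechet_derivative (\<lambda>y. frechet_derivative p (at y) b) (at x) b)"

text \<open>Spherical harmonics are restrictions to the unit sphere of homogeneous harmonic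
  polynomials; the values of \<open>Y\<close> off the unit sphere are irrelevant throughout.\<close>

definition spherical_harmonic :: "nat \<Rightarrow> ('a::euclidean_space \<Rightarrow> complex) \<Rightarrow> bool" where
  "spherical_harmonic m Y \<longleftrightarrow>
     (\<exists>p. polynomial_function p \<and>
          (\<forall>c x. p (c *\<^sub>R x) = of_real c ^ m * p x) \<and>
          (\<forall>x. laplacian p x = 0) \<and>
          (\<forall>\<theta>\<in>sphere 0 1. Y \<theta> = p \<theta>))"

text \<open>For \<open>n \<ge> 3\<close> the division of naturals below is exact and the subtractions do not truncate.\<close>

definition harmonic_dim :: "nat \<Rightarrow> nat \<Rightarrow> nat" where
  "harmonic_dim m n =
     (if m = 0 then 1
      else (2 * m + n - 2) * fact (n + m - 3) div (fact m * fact (n - 2)))"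

definition spherical_harmonic_basis ::
  "nat \<Rightarrow> (nat \<Rightarrow> 'a::euclidean_space \<Rightarrow> complex) \<Rightarrow> bool" where
  "spherical_harmonic_basis m Y \<longleftrightarrow>
     (let L = {1..harmonic_dim m DIM('a)} in
       (\<forall>l\<in>L. spherical_harmonic m (Y l)) \<and>
       (\<forall>i\<in>L. \<forall>j\<in>L. (LINT \<theta>|sphere_measure. Y i \<theta> * cnj (Y j \<theta>)) = (if i = j then 1 else 0)) \<and>
       (\<forall>Z. spherical_harmonic m Z \<longrightarrow>
            (\<exists>c. \<forall>\<theta>\<in>sphere 0 1. Z \<theta> = (\<Sum>l\<in>L. c l * Y l \<theta>))))"

definition harmonic_coeff ::
  "('a::euclidean_space \<Rightarrow> complex) \<Rightarrow> ('a \<Rightarrow> complex) \<Rightarrow> complex" where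
  "harmonic_coeff Y F = (LINT \<theta>|sphere_measure. F \<theta> * cnj (Y \<theta>))"

definition d_dt :: "(real \<Rightarrow> complex) \<Rightarrow> real \<Rightarrow> complex" where
  "d_dt F t = vector_derivative F (at t)"

definition D_op :: "(real \<Rightarrow> complex) \<Rightarrow> real \<Rightarrow> complex" where
  "D_op F t = d_dt F t / of_real t"

definition L_op :: "nat \<Rightarrow> (real \<Rightarrow> complex) \<Rightarrow> real \<Rightarrow> complex" where
  "L_op N F s =
     (\<Sum>l=0..N. of_real (fact (N + l) / (fact (N - l) * fact l * 2 ^ l) * (1 - s) ^ (N - l)) *
               (D_op ^^ (N - l)) F s)"

text \<open>\<open>F\<close> is the unknown, on \<open>(\<epsilon>, 1)\<close>; \<open>h\<close> is the datum, on \<open>(0, 1 - \<epsilon>)\<close>. Derivatives are total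
  functions here, so this is to be combined with the differentiability of \<open>F\<close> and \<open>h\<close>.\<close>

definition solves_ivp ::
  "nat \<Rightarrow> nat \<Rightarrow> real \<Rightarrow> real \<Rightarrow> (real \<Rightarrow> complex) \<Rightarrow> (real \<Rightarrow> complex) \<Rightarrow> bool" where
  "solves_ivp m k \<epsilon> \<epsilon>' h F \<longleftrightarrow>
     (\<forall>t\<in>{0<..<1 - \<epsilon>}.
        d_dt ((D_op ^^ (m + 2 * k)) h) t =
        of_real ((- 1) ^ (m + k) * fact k * 2 ^ k / t ^ (2 * (m + k))) *
        L_op (m + k) (\<lambda>r. of_real (r ^ (2 * (m + k) + 1)) * F r) (1 - t)) \<and>
     (\<forall>i<m + k. (d_dt ^^ i) F (1 - \<epsilon>') = 0)"

end

theory Submission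
  imports Defs "HOL-Computational_Algebra.Formal_Laurent_Series"
begin

text \<open>By the Funk--Hecke formula (obtained from moments of harmonic polynomials on the sphere),
  \<open>h\<^sub>m\<^sub>,\<^sub>l(t)\<close> is an integral over \<open>r\<close> in \<open>(1 - t, 1)\<close> of \<open>r f\<^sub>m\<^sub>,\<^sub>l(r) / r^m\<close> against the \<open>m\<close>-th derivative of
  the \<open>m + k\<close>-th power of \<open>Q = (t^2 - (1 - r)^2) ((1 + r)^2 - t^2)\<close> in the variable \<open>t^2\<close>. The kernel
  vanishes at \<open>r = 1 - t\<close> together with its first derivatives, and \<open>D^(2(m+k)) Q^(m+k)\<close> is constant, so
  after \<open>m + 2k\<close> applications of \<open>D\<close> and one derivative only boundary terms at \<open>r = 1 - t\<close> remain.
  They agree with those of \<open>\<L>\<^sub>m\<^sub>+\<^sub>k\<close> because both are the same residue, by Lagrange inversion.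
  A solution of the homogeneous equation vanishing to order \<open>m + k\<close> at one point is zero by Gronwall's inequality for the
  first-order system satisfied by the functions \<open>D^q (r^(2(m+k)+1) F)\<close>.\<close>

section \<open>Polar coordinates\<close>

text \<open>The surface measure is an image of Lebesgue measure on the ball, so facts about the
  sphere are drawn from the ball through polar coordinates, and the moments come from a divergence
  identity with a radial cutoff. For the same reason the mean over a sphere centred at theta is
  first identified against test functions of t, where (t, omega) are polar coordinates about theta;
  continuity then gives the pointwise formula. The constant of the equation: with N = m + k,
  Rodrigues' factor \<open>fh_const k m\<close> times \<open>2 ^ N * fact N\<close> equals
  \<open>fact k * 2 ^ k\<close>. The powers of 4 cancel against 1 - s^2 = Q / (4 r^2), where s is
  the cosine between the two directions. The two residues agree because each sum over q equals, up
  to sign, one common Laurent series minus a series without polar part; this is the partial fraction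
  identity of Chaundy and Bullard. The equation degenerates only at r = 1, where the leading
  coefficient (1 - r)^N vanishes, so Gronwall's inequality is used on compact subintervals that stay
  away from 1.\<close>

lemma emeasure_cone_closed:
  fixes C :: "'a::euclidean_space set"
  assumes B: "B \<in> sets borel" and s: "0 \<le> s"
  shows "emeasure lborel {x::'a. x \<noteq> 0 \<and> norm x \<le> s \<and> x /\<^sub>R norm x \<in> B}
       = ennreal (s ^ DIM('a)) * emeasure lborel {x::'a. x \<noteq> 0 \<and> norm x < 1 \<and> x /\<^sub>R norm x \<in> B}"
proof -
  let ?C = "\<lambda>s. {x::'a. x \<noteq> 0 \<and> norm x \<le> s \<and> x /\<^sub>R norm x \<in> B}"
  let ?C1 = "{x::'a. x \<noteq> 0 \<and> norm x < 1 \<and> x /\<^sub>R norm x \<in> B}"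
  have [measurable]: "B \<in> sets borel" by fact
  have m: "?C s \<in> sets borel" for s by measurable
  have m1: "?C1 \<in> sets borel" by measurable
  \<comment> \<open>The two cones of radius 1 differ by part of the unit sphere, a null set. The
    other radii follow by dilation, with Jacobian \<open>s ^ DIM('a)\<close>.\<close>
  have "emeasure lborel (?C 1) = emeasure lborel ?C1"
  proof (rule emeasure_eq_AE)
    have "sphere (0::'a) 1 \<in> null_sets lborel"
      using negligible_sphere[of "0::'a" 1] by (simp add: negligible_iff_null_sets null_sets_completion_iff)
    then have "AE x in lborel. x \<notin> sphere (0::'a) 1" by (rule AE_not_in)
    then show "AE x in lborel. (x \<in> ?C 1) = (x \<in> ?C1)"
      by eventually_elim auto
  qed (use m m1 in auto)
  moreover have "emeasure lborel (?C s) = ennreal (s ^ DIM('a)) * emeasure lborel (?C 1)"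
  proof (cases "s = 0")
    case True then show ?thesis by (simp add: order_antisym_conv cong: conj_cong)
  next
    case False
    with s have s: "s > 0" by simp
    have "(\<lambda>x. s *\<^sub>R x + 0) ` ?C 1 = ?C s"
    proof (intro equalityI subsetI)
      fix x assume "x \<in> ?C s"
      then have "x /\<^sub>R s \<in> ?C 1" "x = s *\<^sub>R (x /\<^sub>R s) + 0" using s by (auto simp: field_simps)
      then show "x \<in> (\<lambda>x. s *\<^sub>R x + 0) ` ?C 1" by blast
    qed (use s in \<open>auto simp: field_simps mult_le_cancel_left\<close>)
    with emeasure_lebesgue_affine[of s 0 "?C 1"] m s show ?thesis
      by simp
  qed
  ultimately show ?thesis by simp
qed

lemma sets_sphere_measure [measurable_cong]:
  "sets (sphere_measure :: 'a::euclidean_space measure) = sets (restrict_space borel (sphere 0 1))"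
  by (simp add: sphere_measure_def)

lemma space_sphere_measure: "space (sphere_measure :: 'a::euclidean_space measure) = sphere 0 1"
  by (simp add: sphere_measure_def space_scale_measure space_restrict_space)

lemma finite_measure_sphere: "finite_measure (sphere_measure :: 'a::euclidean_space measure)"
proof
  let ?B = "ball 0 1 - {0} :: 'a set"
  let ?M = "restrict_space lborel ?B"
  let ?N = "restrict_space borel (sphere 0 1) :: 'a measure"
  let ?g = "\<lambda>x::'a. x /\<^sub>R norm x"
  have g: "?g \<in> ?M \<rightarrow>\<^sub>M ?N"
    by (intro measurable_restrict_space2 measurable_restrict_space1)
       (auto simp: space_restrict_space)
  have "emeasure (distr ?M ?N ?g) (space ?N) = emeasure ?M (?g -` space ?N \<inter> space ?M)"
    by (rule emeasure_distr[OF g sets.top])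
  also have "\<dots> \<le> emeasure ?M (space ?M)" by (rule emeasure_space)
  also have "\<dots> = emeasure lborel ?B"
    by (subst emeasure_restrict_space) (auto simp: space_restrict_space)
  also have "\<dots> < \<infinity>"
    by (rule le_less_trans[OF _ emeasure_lborel_ball_finite[of 0 1]]) (auto intro!: emeasure_mono)
  finally show "emeasure (sphere_measure :: 'a measure) (space sphere_measure) \<noteq> \<infinity>"
    by (auto simp: sphere_measure_def space_scale_measure ennreal_mult_eq_top_iff)
qed

lemma emeasure_sphere_measure:
  fixes B :: "'a::euclidean_space set"
  assumes "B \<in> sets sphere_measure"
  shows "emeasure sphere_measure B = of_nat DIM('a) * emeasure lborel {x::'a. x \<noteq> 0 \<and> norm x < 1 \<and> x /\<^sub>R norm x \<in> B}"
proof -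
  let ?B = "ball 0 1 - {0} :: 'a set"
  let ?M = "restrict_space lborel ?B"
  let ?N = "restrict_space borel (sphere 0 1) :: 'a measure"
  let ?g = "\<lambda>x::'a. x /\<^sub>R norm x"
  have g: "?g \<in> ?M \<rightarrow>\<^sub>M ?N"
    by (intro measurable_restrict_space2 measurable_restrict_space1)
       (auto simp: space_restrict_space)
  have "emeasure (distr ?M ?N ?g) B = emeasure ?M (?g -` B \<inter> space ?M)"
    using g assms by (subst emeasure_distr) (auto simp: sets_sphere_measure)
  also have "?g -` B \<inter> space ?M = {x::'a. x \<noteq> 0 \<and> norm x < 1 \<and> x /\<^sub>R norm x \<in> B}"
    by (auto simp: space_restrict_space)
  also have "emeasure ?M \<dots> = emeasure lborel \<dots>"
    by (rule emeasure_restrict_space) auto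
  finally show ?thesis by (simp add: sphere_measure_def)
qed

text \<open>The factor r^(n-1) dr of polar coordinates, cut to (0,1) to be finite. Its mass 1/n is
  compensated by the factor \<open>DIM('a)\<close> in \<open>sphere_measure\<close>.\<close>

definition radial_measure :: "nat \<Rightarrow> real measure" where
  "radial_measure n = density lborel (\<lambda>r. indicator {0<..<1} r * r ^ (n - 1))"

text \<open>Tails determine a finite measure on the line; the factor \<open>of_nat n\<close> brings
  them to the shape in which the volumes of truncated cones appear.\<close>

lemma emeasure_radial_measure:
  assumes "n > 0"
  shows "of_nat n * emeasure (radial_measure n) {a<..} = ennreal (if a < 0 then 1 else if a < 1 then 1 - a ^ n else 0)"
proof -
  have *: "emeasure (radial_measure n) {a<..} = ennreal ((1 - a ^ n) / n)" if "0 \<le> a" "a \<le> 1" for a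
  proof -
    have "emeasure (radial_measure n) {a<..} = (\<integral>\<^sup>+r. ennreal (r ^ (n - 1)) * indicator {a..1} r \<partial>lborel)"
      unfolding radial_measure_def
    proof (subst emeasure_density)
      have "AE r in lborel. r \<noteq> a \<and> r \<noteq> 0 \<and> r \<noteq> (1::real)" by (intro AE_conjI AE_lborel_singleton)
      then have "AE r in lborel. ennreal (indicator {0<..<1} r * r ^ (n - 1)) * indicator {a<..} r
        = ennreal (r ^ (n - 1)) * indicator {a..1} r"
        by eventually_elim (use that in \<open>auto simp: indicator_def\<close>)
      then show "(\<integral>\<^sup>+r. ennreal (indicator {0<..<1} r * r ^ (n - 1)) * indicator {a<..} r \<partial>lborel) 
        = (\<integral>\<^sup>+r. ennreal (r ^ (n - 1)) * indicator {a..1} r \<partial>lborel)"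
        by (rule nn_integral_cong_AE)
    qed auto
    also have "\<dots> = 1 ^ n / n - a ^ n / n"
      using that assms by (intro nn_integral_FTC_Icc)
        (auto intro!: derivative_eq_intros)
    finally show ?thesis by (simp add: diff_divide_distrib)
  qed
  consider "a < 0" | "0 \<le> a" "a \<le> 1" | "a > 1" by linarith
  then show ?thesis
  proof cases
    case 1
    have "emeasure (radial_measure n) {a<..} = emeasure (radial_measure n) {0<..}"
      using 1 by (auto simp: radial_measure_def emeasure_density indicator_def intro!: nn_integral_cong)
    with *[of 0] 1 assms show ?thesis
      by (simp add: ennreal_of_nat_eq_real_of_nat flip: ennreal_mult')
  next
    case 2 with * assms show ?thesis
      by (auto simp: ennreal_of_nat_eq_real_of_nat simp flip: ennreal_mult')
  next
    case 3
    have "emeasure (radial_measure n) {a<..} = (\<integral>\<^sup>+r. 0 \<partial>(lborel::real measure))"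
      unfolding radial_measure_def
    proof (subst emeasure_density)
      show "(\<integral>\<^sup>+r. ennreal (indicator {0<..<1} r * r ^ (n - 1)) * indicator {a<..} r \<partial>lborel) = (\<integral>\<^sup>+r. 0 \<partial>(lborel::real measure))"
        by (rule nn_integral_cong) (use 3 in \<open>auto simp: indicator_def\<close>)
    qed auto
    with 3 show ?thesis by simp
  qed
qed

text \<open>A product measure is determined by its values on rectangles. For fixed \<open>B\<close>
  both sides are finite measures in \<open>A\<close>, so comparing the tails \<open>{a<..}\<close>
  is enough, and there the claim is the scaling of cones.\<close>

lemma polar_measure:
  "radial_measure DIM('a) \<Otimes>\<^sub>M (sphere_measure :: 'a::euclidean_space measure)
   = distr (restrict_space lborel (ball 0 1 - {0})) (borel \<Otimes>\<^sub>M restrict_space borel (sphere 0 1)) (\<lambda>x::'a. (norm x, x /\<^sub>R norm x))"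
  (is "?R \<Otimes>\<^sub>M ?S = distr ?M ?N ?g")
proof (rule pair_measure_eqI)
  interpret S: finite_measure ?S by (rule finite_measure_sphere)
  show "sigma_finite_measure ?S" by unfold_locales
  have setsR: "sets ?R = sets borel" by (simp add: radial_measure_def)
  have spR: "space ?R = UNIV" by (simp add: radial_measure_def)
  have *: "emeasure ?R (space ?R) \<noteq> \<infinity>"
  proof -
    have "emeasure ?R (space ?R) = emeasure ?R {-1<..}"
      unfolding spR unfolding radial_measure_def
      by (auto simp: emeasure_density indicator_def intro!: nn_integral_cong)
    with emeasure_radial_measure[of "DIM('a)" "-1"] show ?thesis
      by (auto simp: ennreal_mult_eq_top_iff)
  qed
  then interpret R: finite_measure ?R by (rule finite_measureI)
  show "sigma_finite_measure ?R" by unfold_locales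
  show "sets (?R \<Otimes>\<^sub>M ?S) = sets (distr ?M ?N ?g)"
    by (simp add: sets_sphere_measure setsR cong: sets_pair_measure_cong)
  have g: "?g \<in> ?M \<rightarrow>\<^sub>M ?N"
    by (intro measurable_Pair measurable_restrict_space2 measurable_restrict_space1)
       (auto simp: space_restrict_space)
  fix A :: "real set" and B :: "'a set" assume A: "A \<in> sets ?R" and B: "B \<in> sets ?S"
  let ?h = "\<lambda>x::'a. norm x"
  let ?C = "{x::'a. x \<noteq> 0 \<and> norm x < 1 \<and> x /\<^sub>R norm x \<in> B}"
  have Bb [measurable]: "B \<in> sets borel" using B by (auto simp: sets_sphere_measure sets_restrict_space)
  have mC: "?C \<in> sets borel" by measurable
  have finC: "emeasure lborel ?C < \<infinity>"
    by (rule le_less_trans[OF _ emeasure_lborel_ball_finite[of 0 1]]) (auto intro!: emeasure_mono)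
  let ?P = "distr (restrict_space lborel ?C) borel ?h"
  let ?Q = "scale_measure (emeasure ?S B) ?R"
  have eP: "emeasure ?P X = emeasure lborel {x\<in>?C. norm x \<in> X}" if [measurable]: "X \<in> sets borel" for X
  proof -
    have "emeasure ?P X = emeasure (restrict_space lborel ?C) (?h -` X \<inter> ?C)"
      using mC by (subst emeasure_distr) (auto simp: space_restrict_space intro!: measurable_restrict_space1)
    also have "\<dots> = emeasure lborel (?h -` X \<inter> ?C)"
      using mC by (subst emeasure_restrict_space) auto
    also have "?h -` X \<inter> ?C = {x\<in>?C. norm x \<in> X}" by auto
    finally show ?thesis .
  qed
  have "?P = ?Q"
  proof (rule measure_eqI_lessThan)
    show "sets ?P = sets borel" "sets ?Q = sets borel" by (simp_all add: setsR)
    show "emeasure ?P {a<..} < \<infinity>" for a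
    proof -
      have "emeasure ?P {a<..} \<le> emeasure lborel ?C"
        by (subst eP) (auto intro!: emeasure_mono mC)
      with finC show ?thesis by simp
    qed
    fix a :: real
    have "emeasure lborel {x\<in>?C. norm x \<in> {a<..}} =
       ennreal (if a < 0 then 1 else if a < 1 then 1 - a ^ DIM('a) else 0) * emeasure lborel ?C"
    proof -
      consider "a < 0" | "0 \<le> a" "a < 1" | "a \<ge> 1" by linarith
      then show ?thesis
      proof cases
        case 1
        then have "{x\<in>?C. norm x \<in> {a<..}} = ?C" by (auto intro: less_le_trans)
        with 1 show ?thesis by simp
      next
        case 2
        let ?D = "{x::'a. x \<noteq> 0 \<and> norm x \<le> a \<and> x /\<^sub>R norm x \<in> B}"
        have "{x\<in>?C. norm x \<in> {a<..}} = ?C - ?D" using 2 by auto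
        moreover have mD: "?D \<in> sets borel" by measurable
        moreover have "?D \<subseteq> ?C" using 2 by auto
        moreover have "emeasure lborel ?D < \<infinity>" using emeasure_mono[OF \<open>?D \<subseteq> ?C\<close>, of lborel] finC mC
          by simp
        ultimately have "emeasure lborel {x\<in>?C. norm x \<in> {a<..}} = emeasure lborel ?C - emeasure lborel ?D"
          using mC by (simp add: emeasure_Diff)
        also have "\<dots> = ennreal 1 * emeasure lborel ?C - ennreal (a ^ DIM('a)) * emeasure lborel ?C"
          by (subst emeasure_cone_closed) (use 2 in auto)
        also have "\<dots> = ennreal (1 - a ^ DIM('a)) * emeasure lborel ?C"
        proof -
          obtain c where c: "emeasure lborel ?C = ennreal c" "c \<ge> 0"
            using finC by (cases "emeasure lborel ?C") auto
          have "c * a ^ DIM('a) \<le> c * 1" using c 2 by (intro mult_left_mono power_le_one) auto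
          then show ?thesis
            using 2 c by (simp add: ennreal_mult''[symmetric] ennreal_minus left_diff_distrib mult.commute power_le_one right_diff_distrib)
        qed
        finally show ?thesis using 2 by simp
      next
        case 3
        then have "{x\<in>?C. norm x \<in> {a<..}} = {}" by auto
        with 3 show ?thesis by (simp only:) simp
      qed
    qed
    then have "emeasure ?P {a<..} = (of_nat DIM('a) * emeasure ?R {a<..}) * emeasure lborel ?C"
      by (simp only: eP[of "{a<..}"] borel_open open_greaterThan emeasure_radial_measure[OF DIM_positive])
    then show "emeasure ?P {a<..} = emeasure ?Q {a<..}"
      by (simp only: emeasure_sphere_measure[OF B] emeasure_scale_measure mult_ac)
  qed
  then have "emeasure ?Q A = emeasure ?P A" by simp
  also have "\<dots> = emeasure lborel {x\<in>?C. norm x \<in> A}"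
    using A by (intro eP) (simp add: setsR)
  also have "{x\<in>?C. norm x \<in> A} = ?g -` (A \<times> B) \<inter> space ?M" by (auto simp: space_restrict_space)
  also have "emeasure lborel \<dots> = emeasure ?M \<dots>"
    by (subst emeasure_restrict_space) (auto simp: space_restrict_space)
  also have "\<dots> = emeasure (distr ?M ?N ?g) (A \<times> B)"
    using A B g by (subst emeasure_distr) (auto simp: setsR sets_sphere_measure)
  finally show "emeasure ?R A * emeasure ?S B = emeasure (distr ?M ?N ?g) (A \<times> B)"
    by (simp add: mult_ac)
qed

text \<open>The bound on the ball gives integrability over the finite product measure of
  \<open>polar_measure\<close>, and Fubini separates radius and direction.\<close>

lemma polar_ball:
  fixes \<phi> :: "'a::euclidean_space \<Rightarrow> 'b::{banach, second_countable_topology}"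
  assumes [measurable]: "\<phi> \<in> borel_measurable borel" and B: "\<And>x. x \<in> ball 0 1 \<Longrightarrow> norm (\<phi> x) \<le> B"
  shows "(LINT x:ball 0 1|lborel. \<phi> x)
       = (LINT r:{0<..<1}|lborel. r ^ (DIM('a) - 1) *\<^sub>R (LINT \<omega>|sphere_measure. \<phi> (r *\<^sub>R \<omega>)))"
proof -
  let ?R = "radial_measure DIM('a)" and ?S = "sphere_measure :: 'a measure"
  let ?M = "restrict_space lborel (ball 0 1 - {0::'a})"
  let ?g = "\<lambda>x::'a. (norm x, x /\<^sub>R norm x)"
  let ?N = "borel \<Otimes>\<^sub>M restrict_space borel (sphere (0::'a) 1)"
  interpret S: finite_measure ?S by (rule finite_measure_sphere)
  have g: "?g \<in> ?M \<rightarrow>\<^sub>M ?N"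
    by (intro measurable_Pair measurable_restrict_space2 measurable_restrict_space1)
       (auto simp: space_restrict_space)
  have setsR [measurable_cong]: "sets ?R = sets borel" by (simp add: radial_measure_def)
  have spR: "space ?R = UNIV" by (simp add: radial_measure_def)
  have "emeasure ?R (space ?R) \<noteq> \<infinity>"
  proof -
    have "emeasure ?R (space ?R) = emeasure ?R {-1<..}"
      unfolding spR unfolding radial_measure_def
      by (auto simp: emeasure_density indicator_def intro!: nn_integral_cong)
    with emeasure_radial_measure[of "DIM('a)" "-1"] show ?thesis
      by (auto simp: ennreal_mult_eq_top_iff)
  qed
  then interpret R: finite_measure ?R by (rule finite_measureI)
  interpret RS: pair_sigma_finite ?R ?S ..
  have mS: "(\<lambda>\<omega>. \<omega>) \<in> ?S \<rightarrow>\<^sub>M borel"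
    by (simp add: measurable_cong_sets[OF sets_sphere_measure refl] measurable_restrict_space1)
  have setsRS: "sets (?R \<Otimes>\<^sub>M ?S) = sets ?N"
    by (simp add: sets_sphere_measure setsR cong: sets_pair_measure_cong)
  \<comment> \<open>The cutoff to the ball makes the bound \<open>B\<close> valid everywhere; the
    origin, where the direction is meaningless, is a null set.\<close>
  define \<phi>' where "\<phi>' x = indicator (ball 0 1) x *\<^sub>R \<phi> x" for x
  have \<phi>': "\<phi>' \<in> borel_measurable borel" unfolding \<phi>'_def
    by (intro borel_measurable_scaleR borel_measurable_indicator assms(1)) auto
  have "(\<lambda>z. fst z *\<^sub>R snd z) \<in> ?N \<rightarrow>\<^sub>M (borel :: 'a measure)"
    by (intro borel_measurable_scaleR measurable_fst measurable_compose[OF measurable_snd]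
          measurable_restrict_space1 measurable_ident[unfolded id_def])
  from measurable_compose[OF this \<phi>']
  have m': "(\<lambda>(r,\<omega>). \<phi>' (r *\<^sub>R \<omega>)) \<in> borel_measurable ?N"
    by (simp add: split_beta)
  have B0: "B \<ge> 0" using B[of 0] norm_ge_zero[of "\<phi> 0"] by (simp del: norm_ge_zero)
  have fin: "integrable (?R \<Otimes>\<^sub>M ?S) (\<lambda>(r,\<omega>). \<phi>' (r *\<^sub>R \<omega>))"
  proof (rule finite_measure.integrable_const_bound[where B=B])
    show "finite_measure (?R \<Otimes>\<^sub>M ?S)" by (intro finite_measure_pair_measure R.finite_measure_axioms S.finite_measure_axioms)
    show "AE x in ?R \<Otimes>\<^sub>M ?S. norm (case x of (r, \<omega>) \<Rightarrow> \<phi>' (r *\<^sub>R \<omega>)) \<le> B"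
      using B B0 by (auto simp: \<phi>'_def indicator_def split: if_splits)
  qed (use m' in \<open>simp add: measurable_cong_sets[OF setsRS refl]\<close>)
  have "(LINT x:ball 0 1|lborel. \<phi> x) = (LINT x:ball 0 1 - {0}|lborel. \<phi>' x)"
    unfolding set_lebesgue_integral_def
  proof (rule integral_cong_AE)
    have "AE x in lborel. x \<noteq> (0::'a)" by (rule AE_lborel_singleton)
    then show "AE x in lborel. indicat_real (ball 0 1) x *\<^sub>R \<phi> x = indicat_real (ball 0 1 - {0}) x *\<^sub>R \<phi>' x"
      by eventually_elim (auto simp: \<phi>'_def indicator_def)
  qed (use assms(1) \<phi>' in \<open>auto intro!: borel_measurable_scaleR borel_measurable_indicator\<close>)
  also have "\<dots> = (LINT x|?M. \<phi>' x)"
    unfolding set_lebesgue_integral_def by (subst integral_restrict_space) auto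
  also have "\<dots> = (LINT x|?M. (\<lambda>(r,\<omega>). \<phi>' (r *\<^sub>R \<omega>)) (?g x))"
    by (rule Bochner_Integration.integral_cong) (auto simp: space_restrict_space)
  also have "\<dots> = (LINT z|(distr ?M ?N ?g). (\<lambda>(r,\<omega>). \<phi>' (r *\<^sub>R \<omega>)) z)"
    by (rule integral_distr[symmetric, OF g m'])
  also have "\<dots> = (LINT z|(?R \<Otimes>\<^sub>M ?S). (\<lambda>(r,\<omega>). \<phi>' (r *\<^sub>R \<omega>)) z)"
    by (simp add: polar_measure)
  also have "\<dots> = (LINT r|?R. LINT \<omega>|?S. \<phi>' (r *\<^sub>R \<omega>))"
    using RS.integral_fst[OF fin] by simp
  also have "\<dots> = (LINT r|lborel. (indicator {0<..<1} r * r ^ (DIM('a) - 1)) *\<^sub>R (LINT \<omega>|?S. \<phi>' (r *\<^sub>R \<omega>)))"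
    unfolding radial_measure_def
  proof (rule integral_density)
    have "(\<lambda>r. LINT \<omega>|?S. \<phi>' (r *\<^sub>R \<omega>)) \<in> borel_measurable ?R"
      by (rule S.borel_measurable_lebesgue_integral) (use m' in \<open>simp add: measurable_cong_sets[OF setsRS refl]\<close>)
    then show "(\<lambda>r. LINT \<omega>|?S. \<phi>' (r *\<^sub>R \<omega>)) \<in> borel_measurable lborel"
      by (simp add: measurable_cong_sets[OF setsR refl])
  qed (auto simp: indicator_def)
  also have "\<dots> = (LINT r:{0<..<1}|lborel. r ^ (DIM('a) - 1) *\<^sub>R (LINT \<omega>|?S. \<phi> (r *\<^sub>R \<omega>)))"
    unfolding set_lebesgue_integral_def
  proof (rule Bochner_Integration.integral_cong[OF refl])
    fix r :: real
    have "(LINT \<omega>|?S. \<phi>' (r *\<^sub>R \<omega>)) = (LINT \<omega>|?S. \<phi> (r *\<^sub>R \<omega>))" if "0 < r" "r < 1"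
      by (rule Bochner_Integration.integral_cong) (use that in \<open>auto simp: space_sphere_measure \<phi>'_def\<close>)
    then show "(indicator {0<..<1} r * r ^ (DIM('a) - 1)) *\<^sub>R (LINT \<omega>|?S. \<phi>' (r *\<^sub>R \<omega>)) = 
      indicator {0<..<1} r *\<^sub>R r ^ (DIM('a) - 1) *\<^sub>R (LINT \<omega>|?S. \<phi> (r *\<^sub>R \<omega>))"
      by (auto simp: indicator_def)
  qed
  finally show ?thesis .
qed

section \<open>Integration by parts on the sphere\<close>

lemma has_vector_derivative_iff_quotient:
  fixes f :: "real \<Rightarrow> 'b::real_normed_vector"
  shows "(f has_vector_derivative D) (at x) \<longleftrightarrow> ((\<lambda>h. (f (x + h) - f x) /\<^sub>R h) \<longlongrightarrow> D) (at 0)"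
proof -
  have "norm (f (x + h) - f x - h *\<^sub>R D) / norm h = norm ((f (x + h) - f x) /\<^sub>R h - D)" if "h \<noteq> 0" for h
  proof -
    have "f (x + h) - f x - h *\<^sub>R D = h *\<^sub>R ((f (x + h) - f x) /\<^sub>R h - D)"
      using that by (simp add: scaleR_right_diff_distrib)
    then show ?thesis using that by (simp only: norm_scaleR) simp
  qed
  then have "((\<lambda>h. norm (f (x + h) - f x - h *\<^sub>R D) / norm h) \<longlongrightarrow> 0) (at 0) \<longleftrightarrow>
    ((\<lambda>h. norm ((f (x + h) - f x) /\<^sub>R h - D)) \<longlongrightarrow> 0) (at 0)"
    by (intro filterlim_cong) (auto simp: eventually_at_filter)
  then show ?thesis
    by (simp add: has_vector_derivative_def has_derivative_at bounded_linear_scaleR_left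
        tendsto_norm_zero_iff LIM_zero_iff)
qed

lemma vector_derivative_mean_value:
  fixes f :: "real \<Rightarrow> 'b::real_normed_vector"
  assumes "\<And>t. t \<in> {a<..<b} \<Longrightarrow> (f has_vector_derivative f' t) (at t)"
    and "\<And>t. t \<in> {a<..<b} \<Longrightarrow> norm (f' t) \<le> B" and "x \<in> {a<..<b}" "y \<in> {a<..<b}"
  shows "norm (f x - f y) \<le> B * norm (x - y)"
proof (rule differentiable_bound[of "{a<..<b}" f "\<lambda>t h. h *\<^sub>R f' t"])
  show "(f has_derivative (\<lambda>h. h *\<^sub>R f' t)) (at t within {a<..<b})" if "t \<in> {a<..<b}" for t
    using assms(1)[OF that] by (simp add: has_vector_derivative_def has_derivative_at_withinI)
  show "onorm (\<lambda>h. h *\<^sub>R f' t) \<le> B" if "t \<in> {a<..<b}" for t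
    using assms(2)[OF that] by (intro onorm_le) (auto simp: mult.commute[of B] intro: mult_left_mono)
qed (use assms in auto)

text \<open>Dominated convergence along an arbitrary sequence of increments: by the mean value
  inequality every difference quotient is bounded by \<open>w\<close>.\<close>

lemma has_vector_derivative_integral:
  fixes F :: "real \<Rightarrow> 'x \<Rightarrow> 'b::{banach, second_countable_topology}"
  assumes t0: "t0 \<in> {a<..<b}"
    and int: "\<And>t. t \<in> {a<..<b} \<Longrightarrow> integrable M (F t)"
    and der: "\<And>t x. t \<in> {a<..<b} \<Longrightarrow> x \<in> space M \<Longrightarrow> ((\<lambda>t. F t x) has_vector_derivative F' t x) (at t)"
    and bound: "\<And>t x. t \<in> {a<..<b} \<Longrightarrow> x \<in> space M \<Longrightarrow> norm (F' t x) \<le> w x"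
    and w: "integrable M w"
    and meas: "F' t0 \<in> borel_measurable M"
  shows "((\<lambda>t. LINT x|M. F t x) has_vector_derivative (LINT x|M. F' t0 x)) (at t0)"
  unfolding has_vector_derivative_iff_quotient tendsto_at_iff_sequentially
proof (intro allI impI)
  fix X :: "nat \<Rightarrow> real" assume X: "\<forall>i. X i \<in> UNIV - {0}" "X \<longlonglongrightarrow> 0"
  let ?I = "\<lambda>t. LINT x|M. F t x"
  let ?q = "\<lambda>i x. (F (t0 + X i) x - F t0 x) /\<^sub>R X i"
  have "(\<lambda>i. t0 + X i) \<longlonglongrightarrow> t0 + 0" by (intro tendsto_intros X)
  then have "eventually (\<lambda>i. t0 + X i \<in> {a<..<b}) sequentially"
    using t0 by (intro topological_tendstoD) auto
  then obtain N where N: "\<And>i. i \<ge> N \<Longrightarrow> t0 + X i \<in> {a<..<b}"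
    by (auto simp: eventually_sequentially)
  have "(\<lambda>i. LINT x|M. ?q (i + N) x) \<longlonglongrightarrow> (LINT x|M. F' t0 x)"
  proof (rule integral_dominated_convergence)
    show "F' t0 \<in> borel_measurable M" "integrable M w" by fact+
    show "?q (i + N) \<in> borel_measurable M" for i
      using int[OF N[of "i + N"]] int[OF t0] by (intro borel_measurable_scaleR borel_measurable_diff) auto
    show "AE x in M. (\<lambda>i. ?q (i + N) x) \<longlonglongrightarrow> F' t0 x"
    proof (rule AE_I2)
      fix x assume "x \<in> space M"
      from der[OF t0 this] have "((\<lambda>h. (F (t0 + h) x - F t0 x) /\<^sub>R h) \<longlongrightarrow> F' t0 x) (at 0)"
        by (simp add: has_vector_derivative_iff_quotient)
      then have "(\<lambda>i. ?q i x) \<longlonglongrightarrow> F' t0 x"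
        using X unfolding tendsto_at_iff_sequentially by (auto simp: comp_def)
      then show "(\<lambda>i. ?q (i + N) x) \<longlonglongrightarrow> F' t0 x" by (rule LIMSEQ_ignore_initial_segment)
    qed
    show "AE x in M. norm (?q (i + N) x) \<le> w x" for i
    proof (rule AE_I2)
      fix x assume x: "x \<in> space M"
      have "norm (F (t0 + X (i + N)) x - F t0 x) \<le> w x * norm (t0 + X (i + N) - t0)"
        by (rule vector_derivative_mean_value[of a b _ "\<lambda>t. F' t x"]) (use x der bound t0 N[of "i + N"] in auto)
      moreover have "X (i + N) \<noteq> 0" using X by auto
      ultimately show "norm (?q (i + N) x) \<le> w x"
        by (simp add: divide_simps mult.commute)
    qed
  qed
  moreover have "(LINT x|M. ?q (i + N) x) = (?I (t0 + X (i + N)) - ?I t0) /\<^sub>R X (i + N)" for i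
    using int[OF N[of "i + N"]] int[OF t0] by (simp add: Bochner_Integration.integral_diff)
  ultimately have "(\<lambda>i. (?I (t0 + X (i + N)) - ?I t0) /\<^sub>R X (i + N)) \<longlonglongrightarrow> (LINT x|M. F' t0 x)" by (simp only:)
  then show "((\<lambda>h. (?I (t0 + h) - ?I t0) /\<^sub>R h) \<circ> X) \<longlonglongrightarrow> (LINT x|M. F' t0 x)"
    unfolding comp_def by (rule LIMSEQ_offset)
qed

lemma lborel_integral_translation:
  fixes f :: "'a::euclidean_space \<Rightarrow> 'b::{banach, second_countable_topology}"
  assumes [measurable]: "f \<in> borel_measurable borel"
  shows "(LINT x|lborel. f (x + v)) = (LINT x|lborel. f x)"
proof -
  have "(LINT x|lborel. f x) = (LINT x|distr lborel borel (\<lambda>x. v + x). f x)"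
    using lborel_affine[of 1 v] by (simp add: density_1)
  also have "\<dots> = (LINT x|lborel. f (x + v))"
    by (subst integral_distr) (auto simp: add.commute)
  finally show ?thesis ..
qed

text \<open>By translation invariance the integral of \<open>u (x + t *\<^sub>R b)\<close> over x is
  independent of t, while its derivative at t = 0 is the integral of \<open>u'\<close>.\<close>

lemma lborel_integral_derivative_zero:
  fixes u :: "'a::euclidean_space \<Rightarrow> 'b::{banach, second_countable_topology}"
  assumes der: "\<And>x. ((\<lambda>s. u (x + s *\<^sub>R b)) has_vector_derivative u' x) (at 0)"
    and u: "continuous_on UNIV u" and u': "continuous_on UNIV u'"
    and supp: "\<And>x. x \<notin> ball 0 1 \<Longrightarrow> u x = 0" "\<And>x. x \<notin> ball 0 1 \<Longrightarrow> u' x = 0"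
  shows "(LINT x|lborel. u' x) = 0"
proof -
  have "compact (u ` cball 0 1)" "compact (u' ` cball 0 1)"
    using u u' by (auto intro!: compact_continuous_image intro: continuous_on_subset)
  then obtain A B where A: "\<And>x. x \<in> cball 0 1 \<Longrightarrow> norm (u x) \<le> A" and B: "\<And>x. x \<in> cball 0 1 \<Longrightarrow> norm (u' x) \<le> B"
    by (metis compact_imp_bounded bounded_iff image_eqI)
  have [measurable]: "u \<in> borel_measurable borel" "u' \<in> borel_measurable borel"
    using u u' by (auto intro: borel_measurable_continuous_onI)
  \<comment> \<open>This ball contains the supports of all translates with |t| < 1, so a multiple of
    its indicator is a common integrable majorant.\<close>
  let ?K = "cball (0::'a) (1 + norm b)"
  have intK: "integrable lborel (\<lambda>x. indicator ?K x * c)" for c :: real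
    using emeasure_lborel_cball_finite[of "0::'a" "1 + norm b"] by (intro integrable_mult_left) auto
  have inK: "x \<in> ?K" if "x + t *\<^sub>R b \<in> ball 0 1" "\<bar>t\<bar> < 1" for x t
  proof -
    have "norm x \<le> norm (x + t *\<^sub>R b) + norm (t *\<^sub>R b)" by (metis add_diff_cancel_right' norm_triangle_ineq4)
    also have "norm (t *\<^sub>R b) \<le> norm b" using that by (simp add: mult_left_le_one_le)
    finally show ?thesis using that by auto
  qed
  have le: "norm (v (x + t *\<^sub>R b)) \<le> indicator ?K x * C"
    if "\<And>x. x \<in> cball 0 1 \<Longrightarrow> norm (v x) \<le> C" "\<And>x. x \<notin> ball 0 1 \<Longrightarrow> v x = 0" "\<bar>t\<bar> < 1" for v x t and C :: real
  proof (cases "x + t *\<^sub>R b \<in> ball 0 1")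
    case True with inK[OF True] that show ?thesis by auto
  next
    case False
    have "0 \<le> C" using that(1)[of 0] norm_ge_zero[of "v 0"] by (simp del: norm_ge_zero)
    with False that show ?thesis by (simp add: indicator_def)
  qed
  have "((\<lambda>t. LINT x|lborel. u (x + t *\<^sub>R b)) has_vector_derivative (LINT x|lborel. u' (x + 0 *\<^sub>R b))) (at 0)"
  proof (rule has_vector_derivative_integral[where a="-1" and b=1 and w="\<lambda>x. indicator ?K x * B"])
    show "integrable lborel (\<lambda>x. u (x + t *\<^sub>R b))" if "t \<in> {-1<..<1}" for t
      by (rule Bochner_Integration.integrable_bound[OF intK[of A]])
         (use le[of u A t] A supp that in \<open>auto intro!: order_trans[OF _ abs_ge_self]\<close>)
    show "norm (u' (x + t *\<^sub>R b)) \<le> indicator ?K x * B" if "t \<in> {-1<..<1}" for t x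
      using le[of u' B t] B supp that by auto
    show "((\<lambda>t. u (x + t *\<^sub>R b)) has_vector_derivative u' (x + t *\<^sub>R b)) (at t)" for x t
      using der[of "x + t *\<^sub>R b"]
      by (simp add: has_vector_derivative_iff_quotient algebra_simps)
  qed (use intK in auto)
  moreover have "((\<lambda>t. LINT x|lborel. u (x + t *\<^sub>R b)) has_vector_derivative 0) (at 0)"
    by (simp add: lborel_integral_translation)
  ultimately show ?thesis by (simp add: vector_derivative_unique_at)
qed

lemma has_bochner_integral_power_01:
  "has_bochner_integral lborel (\<lambda>r. indicator {0<..<1::real} r *\<^sub>R r ^ j) (1 / (real j + 1))"
proof -
  have "has_bochner_integral lborel (\<lambda>r. r ^ j * indicator {0..1::real} r) (1 ^ Suc j / Suc j - 0 ^ Suc j / Suc j)"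
    by (rule has_bochner_integral_FTC_Icc_nonneg)
       (auto intro!: derivative_eq_intros simp del: power_Suc of_nat_Suc)
  then have "has_bochner_integral lborel (\<lambda>r. r ^ j * indicator {0..1::real} r) (1 / (real j + 1))"
    by (simp add: add.commute)
  moreover have "AE r in lborel. r ^ j * indicator {0..1::real} r = indicator {0<..<1::real} r *\<^sub>R r ^ j"
  proof -
    have "AE r in lborel. r \<noteq> 0 \<and> r \<noteq> (1::real)" by (intro AE_conjI AE_lborel_singleton)
    then show ?thesis by eventually_elim (auto simp: indicator_def)
  qed
  ultimately show ?thesis by (subst (asm) has_bochner_integral_cong_AE) auto
qed

lemma integrable_sphere_measure:
  fixes q :: "'a::euclidean_space \<Rightarrow> 'b::{banach, second_countable_topology}"
  assumes "continuous_on (sphere 0 1) q"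
  shows "integrable sphere_measure q"
proof -
  interpret S: finite_measure "sphere_measure :: 'a measure" by (rule finite_measure_sphere)
  have "compact (q ` sphere 0 1)" by (intro compact_continuous_image assms) auto
  then obtain B where B: "\<And>x. x \<in> sphere 0 1 \<Longrightarrow> norm (q x) \<le> B"
    by (metis compact_imp_bounded bounded_iff image_eqI)
  show ?thesis
  proof (rule S.integrable_const_bound[where B=B])
    show "q \<in> borel_measurable sphere_measure"
      using borel_measurable_continuous_on_restrict[OF assms]
      by (simp add: measurable_cong_sets[OF sets_sphere_measure refl])
  qed (use B in \<open>auto simp: space_sphere_measure\<close>)
qed

text \<open>Squaring makes the positive part continuously differentiable across 0, so that it can
  serve as a cutoff at the unit sphere.\<close>

lemma DERIV_max_0_square: "((\<lambda>s::real. (max 0 s)\<^sup>2) has_real_derivative 2 * max 0 s) (at s)"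
proof -
  consider "s > 0" | "s < 0" | "s = 0" by linarith
  then show ?thesis
  proof cases
    case 1
    have "((\<lambda>s::real. s\<^sup>2) has_real_derivative 2 * s) (at s)" by (auto intro!: derivative_eq_intros)
    then have "((\<lambda>s::real. (max 0 s)\<^sup>2) has_real_derivative 2 * s) (at s)"
      by (rule has_field_derivative_transform_within_open[where S="{0<..}"]) (use 1 in auto)
    then show ?thesis using 1 by simp
  next
    case 2
    have "((\<lambda>s::real. 0) has_real_derivative 0) (at s)" by (auto intro!: derivative_eq_intros)
    then have "((\<lambda>s::real. (max 0 s)\<^sup>2) has_real_derivative 0) (at s)"
      by (rule has_field_derivative_transform_within_open[where S="{..<0}"]) (use 2 in auto)
    then show ?thesis using 2 by simp
  next
    case 3
    have "((\<lambda>h::real. (max 0 h)\<^sup>2 / h) \<longlongrightarrow> 0) (at 0)"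
    proof (rule Lim_null_comparison)
      show "\<forall>\<^sub>F h in at 0. norm ((max 0 h)\<^sup>2 / h) \<le> \<bar>h\<bar>"
        by (rule always_eventually) (auto simp: max_def power2_eq_square)
      show "((\<lambda>h::real. \<bar>h\<bar>) \<longlongrightarrow> 0) (at 0)" by (intro tendsto_eq_intros) auto
    qed
    then show ?thesis by (simp add: 3 DERIV_def)
  qed
qed

text \<open>The derivative of a cutoff times \<open>p\<close> has integral 0 over the ball. By
  homogeneity, polar coordinates turn its two terms into the two sphere integrals with explicit
  radial factors. In \<open>hom'\<close> a factor \<open>r\<close> stands in for the exponent
  \<open>d - 1\<close>, so that \<open>d = 0\<close> is covered as well.\<close>

lemma sphere_integration_by_parts:
  fixes p :: "'a::euclidean_space \<Rightarrow> complex"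
  assumes dim: "DIM('a) \<ge> 2"
    and der: "\<And>x. ((\<lambda>s. p (x + s *\<^sub>R b)) has_vector_derivative p' x) (at 0)"
    and p: "continuous_on UNIV p" and p': "continuous_on UNIV p'"
    and hom: "\<And>r x. r > 0 \<Longrightarrow> p (r *\<^sub>R x) = of_real (r ^ d) * p x"
    and hom': "\<And>r x. r > 0 \<Longrightarrow> of_real r * p' (r *\<^sub>R x) = of_real (r ^ d) * p' x"
  shows "(LINT \<omega>|sphere_measure. p' \<omega>) = of_nat (DIM('a) + d - 1) * (LINT \<omega>|sphere_measure. of_real (\<omega> \<bullet> b) * p \<omega>)"
proof -
  let ?S = "sphere_measure :: 'a measure"
  \<comment> \<open>A radial cutoff of class C^1, with \<open>w'\<close> its derivative along
    \<open>b\<close>. Along rays inside the ball both are polynomials in the radius, so the radial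
    integrals are elementary.\<close>
  define w where "w x = (max 0 (1 - x \<bullet> x))\<^sup>2" for x :: 'a
  define w' where "w' x = - 4 * max 0 (1 - x \<bullet> x) * (x \<bullet> b)" for x
  define u where "u x = of_real (w x) * p x" for x
  define u' where "u' x = of_real (w x) * p' x + of_real (w' x) * p x" for x
  have cw: "continuous_on UNIV w" "continuous_on UNIV w'" unfolding w_def w'_def by (intro continuous_intros)+
  have cu: "continuous_on UNIV u" "continuous_on UNIV u'" unfolding u_def u'_def by (intro continuous_intros cw p p')+
  have out: "x \<bullet> x \<ge> 1" if "x \<notin> ball 0 1" for x :: 'a
    using that by (simp add: dot_square_norm)
  have supp: "u x = 0" "u' x = 0" if "x \<notin> ball 0 1" for x
    using out[OF that] by (auto simp: u_def u'_def w_def w'_def)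
  have "((\<lambda>s. u (x + s *\<^sub>R b)) has_vector_derivative u' x) (at 0)" for x
  proof -
    let ?\<psi> = "\<lambda>s. 1 - (x + s *\<^sub>R b) \<bullet> (x + s *\<^sub>R b)"
    have "?\<psi> = (\<lambda>s. 1 - x \<bullet> x - 2 * s * (x \<bullet> b) - s * s * (b \<bullet> b))"
      by (auto simp: algebra_simps inner_commute)
    then have 1: "(?\<psi> has_real_derivative - 2 * (x \<bullet> b)) (at 0)"
      by (auto intro!: derivative_eq_intros)
    have "((\<lambda>s. (max 0 (?\<psi> s))\<^sup>2) has_real_derivative 2 * max 0 (?\<psi> 0) * (- 2 * (x \<bullet> b))) (at 0)"
      by (rule DERIV_chain2[OF DERIV_max_0_square 1])
    then have "((\<lambda>s. w (x + s *\<^sub>R b)) has_real_derivative w' x) (at 0)"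
      by (simp add: w_def w'_def mult.assoc)
    then have "((\<lambda>s. complex_of_real (w (x + s *\<^sub>R b))) has_vector_derivative of_real (w' x)) (at 0)"
      by (intro has_vector_derivative_of_real) (simp add: has_real_derivative_iff_has_vector_derivative)
    from has_vector_derivative_mult[OF this der[of x]] show ?thesis
      by (simp add: u_def u'_def add.commute)
  qed
  from lborel_integral_derivative_zero[OF this cu supp] have "(LINT x|lborel. u' x) = 0" by simp
  also have "(LINT x|lborel. u' x) = (LINT x:ball 0 1|lborel. u' x)"
    unfolding set_lebesgue_integral_def by (rule Bochner_Integration.integral_cong) (use supp in \<open>auto simp: indicator_def\<close>)
  also have "\<dots> = (LINT r:{0<..<1}|lborel. r ^ (DIM('a) - 1) *\<^sub>R (LINT \<omega>|?S. u' (r *\<^sub>R \<omega>)))"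
  proof -
    have "compact (u' ` cball 0 1)" using cu by (auto intro!: compact_continuous_image intro: continuous_on_subset)
    then obtain B where B: "\<And>x. x \<in> cball 0 1 \<Longrightarrow> norm (u' x) \<le> B"
      by (metis compact_imp_bounded bounded_iff image_eqI)
    show ?thesis by (rule polar_ball[where B=B]) (use cu B in \<open>auto intro: borel_measurable_continuous_onI\<close>)
  qed
  also have "\<dots> = (LINT r:{0<..<1}|lborel. of_real (r ^ (DIM('a) + d - 2) - 2 * r ^ (DIM('a) + d) + r ^ (DIM('a) + d + 2)) * (LINT \<omega>|?S. p' \<omega>)
      + of_real (- 4 * r ^ (DIM('a) + d) + 4 * r ^ (DIM('a) + d + 2)) * (LINT \<omega>|?S. of_real (\<omega> \<bullet> b) * p \<omega>))"
    unfolding set_lebesgue_integral_def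
  proof (rule Bochner_Integration.integral_cong[OF refl])
    fix r :: real
    \<comment> \<open>Writing the dimension as \<open>k + 2\<close> keeps truncated subtraction out
      of the exponents \<open>DIM('a) - 1\<close> and \<open>DIM('a) + d - 2\<close>.\<close>
    obtain k where k: "DIM('a) = k + 2" using dim by (metis add.commute le_Suc_ex)
    have "r ^ (DIM('a) - 1) *\<^sub>R (LINT \<omega>|?S. u' (r *\<^sub>R \<omega>)) = 
       of_real (r ^ (DIM('a) + d - 2) - 2 * r ^ (DIM('a) + d) + r ^ (DIM('a) + d + 2)) * (LINT \<omega>|?S. p' \<omega>)
      + of_real (- 4 * r ^ (DIM('a) + d) + 4 * r ^ (DIM('a) + d + 2)) * (LINT \<omega>|?S. of_real (\<omega> \<bullet> b) * p \<omega>)"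
      if r: "0 < r" "r < 1"
    proof -
      have "(LINT \<omega>|?S. u' (r *\<^sub>R \<omega>)) = (LINT \<omega>|?S. of_real ((1 - r\<^sup>2)\<^sup>2 * r ^ d / r) * p' \<omega> + of_real (- 4 * (1 - r\<^sup>2) * r ^ Suc d) * (of_real (\<omega> \<bullet> b) * p \<omega>))"
      proof (rule Bochner_Integration.integral_cong[OF refl])
        fix \<omega> :: 'a assume "\<omega> \<in> space ?S"
        then have "norm \<omega> = 1" by (simp add: space_sphere_measure)
        then have "r *\<^sub>R \<omega> \<bullet> r *\<^sub>R \<omega> = r\<^sup>2" by (simp add: dot_square_norm power2_eq_square)
        moreover have "r\<^sup>2 < 1" using r by (simp add: power_less_one_iff)
        ultimately have "w (r *\<^sub>R \<omega>) = (1 - r\<^sup>2)\<^sup>2" "w' (r *\<^sub>R \<omega>) = - 4 * (1 - r\<^sup>2) * (r * (\<omega> \<bullet> b))"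
          by (simp_all add: w_def w'_def)
        moreover have "p' (r *\<^sub>R \<omega>) = of_real (r ^ d / r) * p' \<omega>"
          using hom'[of r \<omega>] r by (simp add: field_simps)
        ultimately show "u' (r *\<^sub>R \<omega>) = of_real ((1 - r\<^sup>2)\<^sup>2 * r ^ d / r) * p' \<omega> + of_real (- 4 * (1 - r\<^sup>2) * r ^ Suc d) * (of_real (\<omega> \<bullet> b) * p \<omega>)"
          using hom[of r \<omega>] r by (simp add: u'_def)
      qed
      also have "\<dots> = of_real ((1 - r\<^sup>2)\<^sup>2 * r ^ d / r) * (LINT \<omega>|?S. p' \<omega>) + of_real (- 4 * (1 - r\<^sup>2) * r ^ Suc d) * (LINT \<omega>|?S. of_real (\<omega> \<bullet> b) * p \<omega>)"
      proof (subst Bochner_Integration.integral_add)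
        show "integrable ?S (\<lambda>\<omega>. of_real ((1 - r\<^sup>2)\<^sup>2 * r ^ d / r) * p' \<omega>)"
          "integrable ?S (\<lambda>\<omega>. of_real (- 4 * (1 - r\<^sup>2) * r ^ Suc d) * (of_real (\<omega> \<bullet> b) * p \<omega>))"
          by (intro integrable_sphere_measure continuous_intros continuous_on_subset[OF p] continuous_on_subset[OF p'] subset_UNIV)+
      qed (simp_all only: integral_mult_right_zero)
      finally have "r ^ (DIM('a) - 1) *\<^sub>R (LINT \<omega>|?S. u' (r *\<^sub>R \<omega>)) =
          of_real (r ^ (DIM('a) - 1) * ((1 - r\<^sup>2)\<^sup>2 * r ^ d / r)) * (LINT \<omega>|?S. p' \<omega>)
        + of_real (r ^ (DIM('a) - 1) * (- 4 * (1 - r\<^sup>2) * r ^ Suc d)) * (LINT \<omega>|?S. of_real (\<omega> \<bullet> b) * p \<omega>)"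
        by (simp only: scaleR_conv_of_real of_real_mult distrib_left mult.assoc)
      also have "r ^ (DIM('a) - 1) * ((1 - r\<^sup>2)\<^sup>2 * r ^ d / r) = r ^ (DIM('a) + d - 2) - 2 * r ^ (DIM('a) + d) + r ^ (DIM('a) + d + 2)"
        using r by (simp add: k field_simps power_add power2_eq_square)
      also have "r ^ (DIM('a) - 1) * (- 4 * (1 - r\<^sup>2) * r ^ Suc d) = - 4 * r ^ (DIM('a) + d) + 4 * r ^ (DIM('a) + d + 2)"
        using r by (simp add: k field_simps power_add power2_eq_square)
      finally show ?thesis .
    qed
    then show "indicator {0<..<1} r *\<^sub>R r ^ (DIM('a) - 1) *\<^sub>R (LINT \<omega>|?S. u' (r *\<^sub>R \<omega>)) =
      indicator {0<..<1} r *\<^sub>R (of_real (r ^ (DIM('a) + d - 2) - 2 * r ^ (DIM('a) + d) + r ^ (DIM('a) + d + 2)) * (LINT \<omega>|?S. p' \<omega>)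
      + of_real (- 4 * r ^ (DIM('a) + d) + 4 * r ^ (DIM('a) + d + 2)) * (LINT \<omega>|?S. of_real (\<omega> \<bullet> b) * p \<omega>))"
      by (auto simp: indicator_def)
  qed
  also have "\<dots> = of_real (1 / (real (DIM('a) + d - 2) + 1) - 2 * (1 / (real (DIM('a) + d) + 1)) + 1 / (real (DIM('a) + d + 2) + 1)) * (LINT \<omega>|?S. p' \<omega>)
     + of_real (- 4 * (1 / (real (DIM('a) + d) + 1)) + 4 * (1 / (real (DIM('a) + d + 2) + 1))) * (LINT \<omega>|?S. of_real (\<omega> \<bullet> b) * p \<omega>)"
  proof -
    note * = has_bochner_integral_power_01
    have 1: "has_bochner_integral lborel (\<lambda>r. indicator {0<..<1::real} r *\<^sub>R r ^ i - 2 * (indicator {0<..<1::real} r *\<^sub>R r ^ j) + indicator {0<..<1::real} r *\<^sub>R r ^ l)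
      (1 / (real i + 1) - 2 * (1 / (real j + 1)) + 1 / (real l + 1))" for i j l
      by (intro has_bochner_integral_add has_bochner_integral_diff has_bochner_integral_mult_right *)
    have 2: "has_bochner_integral lborel (\<lambda>r. - 4 * (indicator {0<..<1::real} r *\<^sub>R r ^ j) + 4 * (indicator {0<..<1::real} r *\<^sub>R r ^ l))
      (- 4 * (1 / (real j + 1)) + 4 * (1 / (real l + 1)))" for j l
      by (intro has_bochner_integral_add has_bochner_integral_mult_right *)
    show ?thesis
      unfolding set_lebesgue_integral_def
      using has_bochner_integral_add[OF
        has_bochner_integral_mult_left[OF has_bochner_integral_of_real[OF 1[of "DIM('a) + d - 2" "DIM('a) + d" "DIM('a) + d + 2"]]]
        has_bochner_integral_mult_left[OF has_bochner_integral_of_real[OF 2[of "DIM('a) + d" "DIM('a) + d + 2"]]],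
        of "LINT \<omega>|?S. p' \<omega>" "LINT \<omega>|?S. of_real (\<omega> \<bullet> b) * p \<omega>", THEN has_bochner_integral_integral_eq]
      by (subst (asm) Bochner_Integration.integral_cong[OF refl]) (auto simp: algebra_simps scaleR_conv_of_real)
  qed
  finally have eq: "0 = \<dots>" by simp
  define M where "M = real (DIM('a) + d - 1)"
  have M: "M > 0" "real (DIM('a) + d - 2) + 1 = M" "real (DIM('a) + d) + 1 = M + 2" "real (DIM('a) + d + 2) + 1 = M + 4"
    using dim by (auto simp: M_def of_nat_diff)
  \<comment> \<open>\<open>C\<close> is the value of the first radial integral, and the second is
    \<open>- (M * C)\<close>; their quotient produces the factor
    \<open>DIM('a) + d - 1\<close>.\<close>
  define C where "C = 8 / (M * (M + 2) * (M + 4))"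
  have "1 / M - 2 * (1 / (M + 2)) + 1 / (M + 4) = C"
    "- 4 * (1 / (M + 2)) + 4 * (1 / (M + 4)) = - (M * C)"
    using \<open>M > 0\<close> by (simp_all add: C_def divide_simps) (simp_all add: algebra_simps)
  with eq M have "0 = of_real C * (LINT \<omega>|?S. p' \<omega>) + of_real (- (M * C)) * (LINT \<omega>|?S. of_real (\<omega> \<bullet> b) * p \<omega>)"
    by (simp only:)
  then have "0 = complex_of_real C * ((LINT \<omega>|?S. p' \<omega>) - of_real M * (LINT \<omega>|?S. of_real (\<omega> \<bullet> b) * p \<omega>))"
    by (simp add: right_diff_distrib mult_ac)
  moreover have "C \<noteq> 0" using \<open>M > 0\<close> by (simp add: C_def)
  ultimately show ?thesis by (simp add: M_def)
qed

section \<open>Moments of harmonic polynomials\<close>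

abbreviation dir_deriv :: "'a::real_normed_vector \<Rightarrow> ('a \<Rightarrow> 'b::real_normed_vector) \<Rightarrow> 'a \<Rightarrow> 'b" where
  "dir_deriv v p x \<equiv> frechet_derivative p (at x) v"

lemma frechet_derivative_worksI: "f differentiable net \<Longrightarrow> (f has_derivative (\<lambda>v. frechet_derivative f net v)) net"
  by (simp flip: frechet_derivative_works)

lemma dir_deriv_eqI: "(p has_derivative p') (at x) \<Longrightarrow> dir_deriv v p x = p' v"
  by (metis frechet_derivative_at)

lemma dir_deriv_vector_derivative:
  assumes "p differentiable (at x)"
  shows "((\<lambda>s::real. p (x + s *\<^sub>R v)) has_vector_derivative dir_deriv v p x) (at 0)"
proof -
  have p: "(p has_derivative (\<lambda>v. dir_deriv v p x)) (at x)"
    using assms by (rule frechet_derivative_worksI)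
  have "((\<lambda>s::real. x + s *\<^sub>R v) has_derivative (\<lambda>s. s *\<^sub>R v)) (at 0)"
    by (auto intro!: derivative_eq_intros)
  from has_derivative_compose[OF this] p
  have "((\<lambda>s. p (x + s *\<^sub>R v)) has_derivative (\<lambda>s. dir_deriv (s *\<^sub>R v) p x)) (at 0)" by simp
  then show ?thesis
    using linear_scale[OF linear_frechet_derivative[OF assms]] by (simp add: has_vector_derivative_def)
qed

lemma dir_deriv_add:
  assumes "p differentiable (at x)" "q differentiable (at x)"
  shows "dir_deriv v (\<lambda>x. p x + q x) x = dir_deriv v p x + dir_deriv v q x"
  by (rule dir_deriv_eqI) (intro has_derivative_add frechet_derivative_worksI assms)

lemma dir_deriv_mult:
  fixes p q :: "'a::real_normed_vector \<Rightarrow> 'b::real_normed_algebra"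
  assumes "p differentiable (at x)" "q differentiable (at x)"
  shows "dir_deriv v (\<lambda>x. p x * q x) x = p x * dir_deriv v q x + dir_deriv v p x * q x"
  by (rule dir_deriv_eqI) (intro has_derivative_mult frechet_derivative_worksI assms)

lemma dir_deriv_sum_basis:
  fixes p :: "'a::euclidean_space \<Rightarrow> 'b::real_normed_vector"
  assumes "p differentiable (at x)"
  shows "dir_deriv v p x = (\<Sum>b\<in>Basis. (v \<bullet> b) *\<^sub>R dir_deriv b p x)"
proof -
  note lin = linear_frechet_derivative[OF assms]
  have "dir_deriv v p x = dir_deriv (\<Sum>b\<in>Basis. (v \<bullet> b) *\<^sub>R b) p x" by (simp add: euclidean_representation)
  then show ?thesis by (simp add: linear_sum[OF lin] linear_scale[OF lin])
qed

lemma real_polynomial_dir_deriv: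
  fixes p :: "'a::euclidean_space \<Rightarrow> real"
  assumes "real_polynomial_function p"
  shows "real_polynomial_function (\<lambda>x. dir_deriv v p x)"
  using assms
proof (induction p)
  case (linear f)
  have "(\<lambda>x. dir_deriv v f x) = (\<lambda>x. f v)"
    using dir_deriv_eqI[OF bounded_linear_imp_has_derivative[OF linear]] by auto
  then show ?case by auto
next
  case (const c) then show ?case by (simp add: frechet_derivative_const real_polynomial_function.intros)
next
  case (add f g)
  have "(\<lambda>x. dir_deriv v (\<lambda>x. f x + g x) x) = (\<lambda>x. dir_deriv v f x + dir_deriv v g x)"
    using add.hyps by (auto intro!: dir_deriv_add differentiable_at_real_polynomial_function)
  with add.IH show ?case by auto
next
  case (mult f g)
  have "(\<lambda>x. dir_deriv v (\<lambda>x. f x * g x) x) = (\<lambda>x. f x * dir_deriv v g x + dir_deriv v f x * g x)"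
    using mult.hyps by (auto intro!: dir_deriv_mult differentiable_at_real_polynomial_function)
  with mult show ?case by auto
qed

text \<open>Symmetry of the mixed derivatives passes from linear functions and constants through
  sums and products, along the generation of polynomials.\<close>

lemma real_polynomial_dir_deriv_commute:
  fixes p :: "'a::euclidean_space \<Rightarrow> real"
  assumes "real_polynomial_function p"
  shows "dir_deriv v (dir_deriv w p) x = dir_deriv w (dir_deriv v p) x"
  using assms
proof (induction p arbitrary: x)
  case (linear f)
  have "(\<lambda>x. dir_deriv v f x) = (\<lambda>x. f v)" for v
    using dir_deriv_eqI[OF bounded_linear_imp_has_derivative[OF linear]] by auto
  then show ?case by (simp add: frechet_derivative_const)
next
  case (const c) then show ?case by (simp add: frechet_derivative_const)
next
  case (add f g)
  note d = differentiable_at_real_polynomial_function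
  have "(\<lambda>x. dir_deriv v (\<lambda>x. f x + g x) x) = (\<lambda>x. dir_deriv v f x + dir_deriv v g x)" for v
    using add.hyps by (auto intro!: dir_deriv_add d)
  then show ?case
    using add by (simp add: dir_deriv_add d real_polynomial_dir_deriv)
next
  case (mult f g)
  note d = differentiable_at_real_polynomial_function
  have "(\<lambda>x. dir_deriv v (\<lambda>x. f x * g x) x) = (\<lambda>x. f x * dir_deriv v g x + dir_deriv v f x * g x)" for v
    using mult.hyps by (auto intro!: dir_deriv_mult d)
  then show ?case
    using mult by (simp add: dir_deriv_add dir_deriv_mult d real_polynomial_dir_deriv
        real_polynomial_function.intros)
qed

lemma complex_polynomial_functionI:
  assumes "real_polynomial_function P" "real_polynomial_function Q"
  shows "polynomial_function (\<lambda>x. Complex (P x) (Q x))"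
  unfolding polynomial_function_iff_Basis_inner using assms by (auto simp: Basis_complex_def inner_complex_def)

lemma complex_polynomial_functionD:
  assumes "polynomial_function (p :: 'a::euclidean_space \<Rightarrow> complex)"
  shows "real_polynomial_function (\<lambda>x. Re (p x))" "real_polynomial_function (\<lambda>x. Im (p x))"
  using assms bounded_linear_Re bounded_linear_Im unfolding polynomial_function_def comp_def by blast+

lemma dir_deriv_complex:
  fixes p :: "'a::euclidean_space \<Rightarrow> complex"
  assumes "polynomial_function p"
  shows "dir_deriv v p x = Complex (dir_deriv v (\<lambda>x. Re (p x)) x) (dir_deriv v (\<lambda>x. Im (p x)) x)"
proof -
  have p: "(p has_derivative (\<lambda>v. dir_deriv v p x)) (at x)"
    using assms by (intro frechet_derivative_worksI differentiable_at_polynomial_function)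
  show ?thesis
    using dir_deriv_eqI[OF bounded_linear.has_derivative[OF bounded_linear_Re p], of v]
      dir_deriv_eqI[OF bounded_linear.has_derivative[OF bounded_linear_Im p], of v]
    by (simp add: complex_eq_iff)
qed

lemma polynomial_dir_deriv:
  fixes p :: "'a::euclidean_space \<Rightarrow> complex"
  assumes "polynomial_function p"
  shows "polynomial_function (\<lambda>x. dir_deriv v p x)"
  using complex_polynomial_functionI[OF complex_polynomial_functionD[OF assms, THEN real_polynomial_dir_deriv]]
  by (simp add: dir_deriv_complex[OF assms])

lemma polynomial_dir_deriv_commute:
  fixes p :: "'a::euclidean_space \<Rightarrow> complex"
  assumes "polynomial_function p"
  shows "dir_deriv v (dir_deriv w p) x = dir_deriv w (dir_deriv v p) x"
  using complex_polynomial_functionD[OF assms, THEN real_polynomial_dir_deriv_commute, where v=v and w=w and x=x]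
  unfolding dir_deriv_complex[OF polynomial_dir_deriv[OF assms]] by (simp add: dir_deriv_complex[OF assms])

text \<open>The polynomial that witnesses \<open>spherical_harmonic\<close>; unlike \<open>Y\<close>
  it can be differentiated off the sphere.\<close>

definition harmonic_polynomial :: "nat \<Rightarrow> ('a::euclidean_space \<Rightarrow> complex) \<Rightarrow> bool" where
  "harmonic_polynomial m p \<longleftrightarrow> polynomial_function p \<and> (\<forall>c x. p (c *\<^sub>R x) = of_real c ^ m * p x) \<and> (\<forall>x. laplacian p x = 0)"

lemma harmonic_polynomial_differentiable:
  "harmonic_polynomial m p \<Longrightarrow> p differentiable (at x)"
  by (auto simp: harmonic_polynomial_def intro: differentiable_at_polynomial_function)

lemma harmonic_polynomial_continuous:
  "harmonic_polynomial m p \<Longrightarrow> continuous_on S p"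
  by (auto simp: harmonic_polynomial_def intro: continuous_on_polymonial_function)

text \<open>The coefficients integrate against the conjugate of a spherical harmonic, and this keeps
  it within the same degree.\<close>

lemma harmonic_polynomial_cnj:
  assumes "harmonic_polynomial m p"
  shows "harmonic_polynomial m (\<lambda>x. cnj (p x))"
proof -
  have p: "polynomial_function p" using assms by (simp add: harmonic_polynomial_def)
  have [simp]: "dir_deriv b (\<lambda>x. cnj (q x)) x = cnj (dir_deriv b q x)" if "polynomial_function q" for q :: "'a \<Rightarrow> complex" and x b
    by (intro dir_deriv_eqI bounded_linear.has_derivative[OF bounded_linear_cnj] frechet_derivative_worksI
        differentiable_at_polynomial_function that)
  have "polynomial_function (\<lambda>x. cnj (p x))"
    using polynomial_function_bounded_linear[OF bounded_linear_cnj] polynomial_function_compose[OF p, of cnj]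
    by (simp add: comp_def)
  moreover have "laplacian (\<lambda>x. cnj (p x)) x = cnj (laplacian p x)" for x
    using p by (simp add: laplacian_def polynomial_dir_deriv)
  ultimately show ?thesis using assms by (simp add: harmonic_polynomial_def)
qed

text \<open>Euler's identity: differentiate p((1 + s) x) = (1 + s)^m p(x) at s = 0.\<close>

lemma harmonic_polynomial_euler:
  fixes p :: "'a::euclidean_space \<Rightarrow> complex"
  assumes "harmonic_polynomial m p"
  shows "dir_deriv x p x = of_nat m * p x"
proof -
  have "((\<lambda>s::real. p (x + s *\<^sub>R x)) has_vector_derivative dir_deriv x p x) (at 0)"
    by (rule dir_deriv_vector_derivative[OF harmonic_polynomial_differentiable[OF assms]])
  moreover have "p (x + s *\<^sub>R x) = of_real ((1 + s) ^ m) * p x" for s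
    using assms[unfolded harmonic_polynomial_def] by (metis of_real_power scaleR_add_left scaleR_one)
  moreover have "((\<lambda>s::real. of_real ((1 + s) ^ m) * p x) has_vector_derivative of_real (real m) * p x) (at 0)"
    by (intro has_vector_derivative_mult_left has_vector_derivative_of_real)
       (auto intro!: derivative_eq_intros simp flip: has_real_derivative_iff_has_vector_derivative)
  ultimately show ?thesis by (simp add: vector_derivative_unique_at)
qed

text \<open>The chain rule for x -> p(c x). The factor \<open>c\<close> on the left stands in for
  the exponent m - 1 and gives the form \<open>hom'\<close> of the integration by parts, also for m
  = 0.\<close>

lemma harmonic_polynomial_dir_deriv_scale:
  assumes "harmonic_polynomial m p"
  shows "of_real c * dir_deriv v p (c *\<^sub>R x) = of_real (c ^ m) * dir_deriv v p x"
proof -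
  note d = harmonic_polynomial_differentiable[OF assms]
  have "((\<lambda>x. p (c *\<^sub>R x)) has_derivative (\<lambda>v. dir_deriv (c *\<^sub>R v) p (c *\<^sub>R x))) (at x)"
    by (rule has_derivative_compose[OF _ frechet_derivative_worksI[OF d]]) (auto intro!: derivative_eq_intros)
  moreover have "(\<lambda>x. p (c *\<^sub>R x)) = (\<lambda>x. of_real (c ^ m) * p x)"
    using assms by (simp add: harmonic_polynomial_def)
  moreover have "((\<lambda>x. of_real (c ^ m) * p x) has_derivative (\<lambda>v. of_real (c ^ m) * dir_deriv v p x)) (at x)"
    by (intro has_derivative_mult_right frechet_derivative_worksI d)
  ultimately have "dir_deriv (c *\<^sub>R v) p (c *\<^sub>R x) = of_real (c ^ m) * dir_deriv v p x"
    by (metis dir_deriv_eqI)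
  then show ?thesis
    by (simp add: linear_scale[OF linear_frechet_derivative[OF d]] scaleR_conv_of_real)
qed

text \<open>The Laplacian commutes with directional derivatives of polynomials. Homogeneity results
  from cancelling one factor \<open>c\<close> in the scaling law, which leaves \<open>c = 0\<close>
  to continuity.\<close>

lemma harmonic_polynomial_dir_deriv:
  assumes "harmonic_polynomial (Suc m) p"
  shows "harmonic_polynomial m (dir_deriv v p)"
proof -
  have p: "polynomial_function p" using assms by (simp add: harmonic_polynomial_def)
  note pd = polynomial_dir_deriv[OF p]
  have hom: "dir_deriv v p (c *\<^sub>R x) = of_real c ^ m * dir_deriv v p x" for c x
  proof -
    have *: "dir_deriv v p (c *\<^sub>R x) = of_real c ^ m * dir_deriv v p x" if "c \<noteq> 0" for c
      using harmonic_polynomial_dir_deriv_scale[OF assms, where c=c and v=v and x=x] that by (simp add: mult.assoc)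
    have cont: "continuous_on UNIV (\<lambda>c. dir_deriv v p (c *\<^sub>R x))"
      by (rule continuous_on_compose2[OF continuous_on_polymonial_function[OF pd, of UNIV]]) (auto intro!: continuous_intros)
    have "((\<lambda>c. dir_deriv v p (c *\<^sub>R x)) \<longlongrightarrow> dir_deriv v p (0 *\<^sub>R x)) (at 0)"
      using cont unfolding continuous_on_def by (rule bspec) simp
    moreover have "((\<lambda>c. of_real c ^ m * dir_deriv v p x) \<longlongrightarrow> of_real 0 ^ m * dir_deriv v p x) (at 0)"
      by (intro tendsto_intros)
    then have "((\<lambda>c. dir_deriv v p (c *\<^sub>R x)) \<longlongrightarrow> of_real 0 ^ m * dir_deriv v p x) (at 0)"
      by (rule Lim_transform_eventually) (auto simp: eventually_at_filter *)
    ultimately have "dir_deriv v p (0 *\<^sub>R x) = of_real 0 ^ m * dir_deriv v p x"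
      by (rule tendsto_unique[rotated]) auto
    then show ?thesis using *[of c] by (cases "c = 0") auto
  qed
  moreover have "laplacian (dir_deriv v p) x = 0" for x
  proof -
    have *: "dir_deriv b (dir_deriv b (dir_deriv v p)) x = dir_deriv v (dir_deriv b (dir_deriv b p)) x" for b
    proof -
      have "dir_deriv b (dir_deriv v p) = dir_deriv v (dir_deriv b p)"
        by (rule ext) (rule polynomial_dir_deriv_commute[OF p])
      then show ?thesis
        by (simp add: polynomial_dir_deriv_commute[OF polynomial_dir_deriv[OF p]])
    qed
    have "((\<lambda>x. \<Sum>b\<in>Basis. dir_deriv b (dir_deriv b p) x) has_derivative
       (\<lambda>v. \<Sum>b\<in>Basis. dir_deriv v (dir_deriv b (dir_deriv b p)) x)) (at x)"
      by (intro has_derivative_sum frechet_derivative_worksI differentiable_at_polynomial_function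
          polynomial_dir_deriv p)
    from dir_deriv_eqI[OF this, of v] have "laplacian (dir_deriv v p) x = dir_deriv v (laplacian p) x"
      unfolding laplacian_def by (simp add: * laplacian_def[abs_def])
    also have "laplacian p = (\<lambda>x. 0)" using assms by (auto simp: harmonic_polynomial_def)
    finally show ?thesis by (simp add: frechet_derivative_const)
  qed
  ultimately show ?thesis using pd by (simp add: harmonic_polynomial_def)
qed

lemma harmonic_polynomial_0_const:
  assumes "harmonic_polynomial 0 p" shows "p x = p y"
proof -
  have "p (0 *\<^sub>R z) = p z" for z using assms unfolding harmonic_polynomial_def by (metis mult_1 power_0)
  from this[of x] this[of y] show ?thesis by simp
qed

section \<open>Moments of harmonic polynomials against powers of a linear form\<close>

definition sphere_moment :: "'a::euclidean_space \<Rightarrow> nat \<Rightarrow> ('a \<Rightarrow> complex) \<Rightarrow> complex" where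
  "sphere_moment \<theta> j p = (LINT \<omega>|sphere_measure. of_real ((\<omega> \<bullet> \<theta>) ^ j) * p \<omega>)"

text \<open>Integration by parts in direction \<open>\<theta>\<close> for the function (x . theta)^j
  p(x), homogeneous of degree j + m. For \<open>j = 0\<close> the truncated index
  \<open>j - 1\<close> is multiplied by 0.\<close>

lemma sphere_moment_rec:
  fixes p :: "'a::euclidean_space \<Rightarrow> complex"
  assumes dim: "DIM('a) \<ge> 2" and p: "harmonic_polynomial m p" and \<theta>: "norm \<theta> = 1"
  shows "of_nat (DIM('a) + j + m - 1) * sphere_moment \<theta> (Suc j) p
       = of_nat j * sphere_moment \<theta> (j - 1) p + sphere_moment \<theta> j (dir_deriv \<theta> p)"
proof -
  let ?S = "sphere_measure :: 'a measure"
  let ?q = "\<lambda>x. of_real ((x \<bullet> \<theta>) ^ j) * p x"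
  let ?q' = "\<lambda>x. of_real (real j * (x \<bullet> \<theta>) ^ (j - 1)) * p x + of_real ((x \<bullet> \<theta>) ^ j) * dir_deriv \<theta> p x"
  have pp: "polynomial_function p" using p by (simp add: harmonic_polynomial_def)
  note cp = continuous_on_polymonial_function[OF pp] and cp' = continuous_on_polymonial_function[OF polynomial_dir_deriv[OF pp]]
  have \<theta>1: "\<theta> \<bullet> \<theta> = 1" using \<theta> by (simp add: dot_square_norm)
  have "(LINT \<omega>|?S. ?q' \<omega>) = of_nat (DIM('a) + (j + m) - 1) * (LINT \<omega>|?S. of_real (\<omega> \<bullet> \<theta>) * ?q \<omega>)"
  proof (rule sphere_integration_by_parts[OF dim])
    fix x
    have "((\<lambda>s. (x + s *\<^sub>R \<theta>) \<bullet> \<theta>) has_real_derivative 1) (at 0)"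
      using \<theta>1 by (auto intro!: derivative_eq_intros simp: inner_add_left)
    from DERIV_power[OF this, of j]
    have "((\<lambda>s. ((x + s *\<^sub>R \<theta>) \<bullet> \<theta>) ^ j) has_real_derivative real j * (x \<bullet> \<theta>) ^ (j - 1)) (at 0)"
      by (simp add: mult.commute)
    then have "((\<lambda>s. complex_of_real (((x + s *\<^sub>R \<theta>) \<bullet> \<theta>) ^ j)) has_vector_derivative of_real (real j * (x \<bullet> \<theta>) ^ (j - 1))) (at 0)"
      by (intro has_vector_derivative_of_real) (simp add: has_real_derivative_iff_has_vector_derivative)
    from has_vector_derivative_mult[OF this dir_deriv_vector_derivative[OF harmonic_polynomial_differentiable[OF p], of x \<theta>]]
    show "((\<lambda>s. ?q (x + s *\<^sub>R \<theta>)) has_vector_derivative ?q' x) (at 0)"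
      by (simp add: add.commute)
  next
    fix r :: real and x assume "r > 0"
    show "?q (r *\<^sub>R x) = of_real (r ^ (j + m)) * ?q x"
      using p by (simp add: harmonic_polynomial_def power_mult_distrib power_add)
    have "of_real r * (of_real (real j * (r * (x \<bullet> \<theta>)) ^ (j - 1)) * p (r *\<^sub>R x)) =
       of_real (r ^ (j + m)) * (of_real (real j * (x \<bullet> \<theta>) ^ (j - 1)) * p x)"
      using p by (cases j) (simp_all add: harmonic_polynomial_def power_mult_distrib power_add)
    moreover have "of_real r * (of_real ((r * (x \<bullet> \<theta>)) ^ j) * dir_deriv \<theta> p (r *\<^sub>R x)) =
      of_real (r ^ (j + m)) * (of_real ((x \<bullet> \<theta>) ^ j) * dir_deriv \<theta> p x)"
      using harmonic_polynomial_dir_deriv_scale[OF p, where c=r and v=\<theta> and x=x]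
      by (simp add: power_mult_distrib power_add mult_ac)
    ultimately show "of_real r * ?q' (r *\<^sub>R x) = of_real (r ^ (j + m)) * ?q' x"
      by (simp only: distrib_left inner_scaleR_left)
  qed (intro continuous_intros cp cp')+
  also have "(LINT \<omega>|?S. of_real (\<omega> \<bullet> \<theta>) * ?q \<omega>) = sphere_moment \<theta> (Suc j) p"
    by (simp add: sphere_moment_def mult.assoc)
  also have "(LINT \<omega>|?S. ?q' \<omega>) = (LINT \<omega>|?S. of_nat j * (of_real ((\<omega> \<bullet> \<theta>) ^ (j - 1)) * p \<omega>) + of_real ((\<omega> \<bullet> \<theta>) ^ j) * dir_deriv \<theta> p \<omega>)"
    by (simp add: mult.assoc)
  also have "\<dots> = of_nat j * sphere_moment \<theta> (j - 1) p + sphere_moment \<theta> j (dir_deriv \<theta> p)"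
    unfolding sphere_moment_def
  proof (subst Bochner_Integration.integral_add)
    show "integrable ?S (\<lambda>\<omega>. of_nat j * (of_real ((\<omega> \<bullet> \<theta>) ^ (j - 1)) * p \<omega>))"
         "integrable ?S (\<lambda>\<omega>. of_real ((\<omega> \<bullet> \<theta>) ^ j) * dir_deriv \<theta> p \<omega>)"
      by (intro integrable_sphere_measure continuous_intros cp cp')+
  qed simp
  finally show ?thesis by (simp add: add.assoc)
qed

text \<open>Euler's identity writes a multiple of \<open>p\<close> as the sum of the coordinates
  times the partial derivatives. Integration by parts, applied to each partial derivative, makes of
  this the integral of the Laplacian.\<close>

lemma sphere_moment_0:
  fixes p :: "'a::euclidean_space \<Rightarrow> complex"
  assumes dim: "DIM('a) \<ge> 2" and p: "harmonic_polynomial (Suc m) p"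
  shows "sphere_moment \<theta> 0 p = 0"
proof -
  let ?S = "sphere_measure :: 'a measure"
  have pp: "polynomial_function p" using p by (simp add: harmonic_polynomial_def)
  note cp' = continuous_on_polymonial_function[OF polynomial_dir_deriv[OF pp]]
   and cp'' = continuous_on_polymonial_function[OF polynomial_dir_deriv[OF polynomial_dir_deriv[OF pp]]]
  have *: "(LINT \<omega>|?S. dir_deriv b (dir_deriv b p) \<omega>) = of_nat (DIM('a) + m - 1) * (LINT \<omega>|?S. of_real (\<omega> \<bullet> b) * dir_deriv b p \<omega>)" for b
  proof -
    note hb = harmonic_polynomial_dir_deriv[OF p, of b]
    show ?thesis
      by (rule sphere_integration_by_parts[OF dim])
         (use hb harmonic_polynomial_dir_deriv_scale[OF hb] in
          \<open>auto intro!: dir_deriv_vector_derivative harmonic_polynomial_differentiable[OF hb] cp' cp'' simp: harmonic_polynomial_def\<close>)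
  qed
  have "of_nat (Suc m) * sphere_moment \<theta> 0 p = (LINT \<omega>|?S. of_nat (Suc m) * p \<omega>)"
    by (simp add: sphere_moment_def)
  also have "\<dots> = (LINT \<omega>|?S. (\<Sum>b\<in>Basis. of_real (\<omega> \<bullet> b) * dir_deriv b p \<omega>))"
  proof (rule Bochner_Integration.integral_cong[OF refl])
    fix \<omega> :: 'a
    show "of_nat (Suc m) * p \<omega> = (\<Sum>b\<in>Basis. of_real (\<omega> \<bullet> b) * dir_deriv b p \<omega>)"
      using harmonic_polynomial_euler[OF p, of \<omega>]
        dir_deriv_sum_basis[OF harmonic_polynomial_differentiable[OF p], where v=\<omega> and x=\<omega>]
      by (simp only: scaleR_conv_of_real)
  qed
  also have "\<dots> = (\<Sum>b\<in>Basis. (LINT \<omega>|?S. of_real (\<omega> \<bullet> b) * dir_deriv b p \<omega>))"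
    by (intro Bochner_Integration.integral_sum integrable_sphere_measure continuous_intros cp')
  finally have "of_nat (DIM('a) + m - 1) * (of_nat (Suc m) * sphere_moment \<theta> 0 p) = 
     (\<Sum>b\<in>Basis. (LINT \<omega>|?S. dir_deriv b (dir_deriv b p) \<omega>))"
    by (simp only: * sum_distrib_left)
  also have "\<dots> = (LINT \<omega>|?S. (\<Sum>b\<in>Basis. dir_deriv b (dir_deriv b p) \<omega>))"
    by (intro Bochner_Integration.integral_sum[symmetric] integrable_sphere_measure cp'')
  also have "\<dots> = (LINT \<omega>|?S. 0)"
    using p by (simp add: harmonic_polynomial_def laplacian_def)
  finally have "of_nat (DIM('a) + m - 1) * (of_nat (Suc m) * sphere_moment \<theta> 0 p) = 0" by simp
  moreover have "DIM('a) + m - 1 \<noteq> 0" using dim by simp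
  ultimately show ?thesis by (metis Suc_neq_Zero mult_eq_0_iff of_nat_eq_0_iff)
qed

text \<open>The recurrence stays within the family: the derivative along \<open>\<theta>\<close> is
  harmonic of degree m - 1 and takes the value m p(theta) at \<open>\<theta>\<close> by Euler's
  identity. Hence the induction on \<open>j\<close> runs over all degrees at once.\<close>

lemma sphere_moment_eqI:
  fixes p :: "'a::euclidean_space \<Rightarrow> complex" and mm :: "nat \<Rightarrow> nat \<Rightarrow> real"
  assumes dim: "DIM('a) \<ge> 2" and \<theta>: "norm \<theta> = 1"
    and m00: "mm 0 0 = sphere_area DIM('a)" and m0: "\<And>m. mm 0 (Suc m) = 0"
    and rec: "\<And>j m. real (DIM('a) + j + m - 1) * mm (Suc j) m = real j * mm (j - 1) m + real m * mm j (m - 1)"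
    and p: "harmonic_polynomial m p"
  shows "sphere_moment \<theta> j p = of_real (mm j m) * p \<theta>"
  using p
proof (induction j arbitrary: m p rule: less_induct)
  case (less j)
  show ?case
  proof (cases j)
    case 0
    show ?thesis
    proof (cases m)
      case (Suc m')
      with sphere_moment_0[OF dim] less.prems 0 m0 show ?thesis by auto
    next
      case m: 0
      have "sphere_moment \<theta> 0 p = (LINT \<omega>|(sphere_measure :: 'a measure). p \<theta>)"
        unfolding sphere_moment_def using less.prems harmonic_polynomial_0_const m by (intro Bochner_Integration.integral_cong) auto
      then show ?thesis
        using 0 m m00 measure_sphere_measure[where 'a='a] by (simp add: space_sphere_measure scaleR_conv_of_real)
    qed
  next
    case (Suc i)
    have a: "of_nat i * sphere_moment \<theta> (i - 1) p = of_real (real i * mm (i - 1) m) * p \<theta>"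
    proof (cases i)
      case (Suc i')
      with \<open>j = Suc i\<close> have "i - 1 < j" by simp
      from less.IH[OF this less.prems] show ?thesis by simp
    qed simp
    have b: "sphere_moment \<theta> i (dir_deriv \<theta> p) = of_real (real m * mm i (m - 1)) * p \<theta>"
    \<comment> \<open>In degree 0 the polynomial is constant and its derivative vanishes, in
      accordance with the factor \<open>real m\<close>.\<close>
    proof (cases m)
      case 0
      then have "p = (\<lambda>_. p 0)" using harmonic_polynomial_0_const less.prems by blast
      then have "dir_deriv \<theta> p = (\<lambda>_. 0)" by (metis frechet_derivative_const)
      then show ?thesis using 0 by (simp add: sphere_moment_def)
    next
      case (Suc m')
      with less.prems have "harmonic_polynomial m' (dir_deriv \<theta> p)" by (auto intro: harmonic_polynomial_dir_deriv)
      from less.IH[OF _ this] have "sphere_moment \<theta> i (dir_deriv \<theta> p) = of_real (mm i m') * dir_deriv \<theta> p \<theta>"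
        using \<open>j = Suc i\<close> by simp
      then show ?thesis using harmonic_polynomial_euler[OF less.prems, of \<theta>] Suc by (simp add: mult_ac)
    qed
    have "of_nat (DIM('a) + i + m - 1) * sphere_moment \<theta> j p = of_real (real i * mm (i - 1) m + real m * mm i (m - 1)) * p \<theta>"
      unfolding \<open>j = Suc i\<close> sphere_moment_rec[OF dim less.prems \<theta>] a b by (simp add: distrib_right)
    also have "\<dots> = of_nat (DIM('a) + i + m - 1) * (of_real (mm j m) * p \<theta>)"
      unfolding rec[symmetric] by (simp add: Suc)
    finally have "of_nat (DIM('a) + i + m - 1) * (sphere_moment \<theta> j p - of_real (mm j m) * p \<theta>) = 0"
      by (simp only: right_diff_distrib diff_self)
    moreover have "DIM('a) + i + m - 1 \<noteq> 0" using dim by simp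
    ultimately show ?thesis by (metis eq_iff_diff_eq_0 mult_eq_0_iff of_nat_eq_0_iff)
  qed
qed

section \<open>The Funk--Hecke formula\<close>

definition poly_int :: "real poly \<Rightarrow> real" where
  "poly_int q = integral {-1..1} (poly q)"

lemma poly_integrable: "poly q integrable_on {-1..1::real}"
  by (intro integrable_continuous_real continuous_intros)

lemma poly_int_add: "poly_int (p + q) = poly_int p + poly_int q"
proof -
  have "poly (p + q) = (\<lambda>x. poly p x + poly q x)" by auto
  then show ?thesis
    using integral_add[OF poly_integrable[of p] poly_integrable[of q]] by (simp add: poly_int_def)
qed

lemma poly_int_smult: "poly_int (smult c p) = c * poly_int p"
proof -
  have "poly (smult c p) = (\<lambda>x. c * poly p x)" by auto
  then show ?thesis by (simp add: poly_int_def)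
qed

lemma poly_int_minus: "poly_int (- p) = - poly_int p"
  using poly_int_smult[of "-1" p] by simp

lemma poly_int_diff: "poly_int (p - q) = poly_int p - poly_int q"
  using poly_int_add[of p "-q"] by (simp add: poly_int_minus)

lemma poly_int_0 [simp]: "poly_int 0 = 0"
  using poly_int_smult[of 0 0] by simp

lemma poly_int_pderiv: "poly_int (pderiv p) = poly p 1 - poly p (-1)"
proof -
  have "(poly (pderiv p) has_integral poly p 1 - poly p (-1)) {-1..1}"
    by (rule fundamental_theorem_of_calculus)
       (auto simp flip: has_real_derivative_iff_has_vector_derivative intro: poly_DERIV DERIV_subset)
  then show ?thesis by (simp add: poly_int_def integral_unique)
qed

abbreviation poly_W :: "real poly" where "poly_W \<equiv> [:1, 0, -1:]"

text \<open>Each derivative costs at most one factor 1 - x^2, so that boundary terms at -1 and 1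
  vanish as long as a factor is left.\<close>

lemma poly_W_dvd_pderiv: "poly_W ^ Suc a dvd p \<Longrightarrow> poly_W ^ a dvd pderiv p"
proof (elim dvdE)
  fix q assume p: "p = poly_W ^ Suc a * q"
  have "pderiv p = poly_W ^ a * (poly_W * pderiv q + smult (of_nat (Suc a)) (pderiv poly_W) * q)"
    unfolding p pderiv_mult pderiv_power_Suc by (simp add: algebra_simps del: power_Suc) (simp add: algebra_simps)
  then show "poly_W ^ a dvd pderiv p" by (metis dvd_triv_left)
qed

lemma poly_W_dvd_pderiv_funpow: "i + a \<le> N \<Longrightarrow> poly_W ^ a dvd (pderiv ^^ i) (poly_W ^ N)"
  by (induction i arbitrary: a) (auto intro!: poly_W_dvd_pderiv le_imp_power_dvd simp del: power_Suc)

lemma poly_int_by_parts: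
  assumes "m \<le> N"
  shows "poly_int (q * (pderiv ^^ m) (poly_W ^ N)) = (-1) ^ m * poly_int ((pderiv ^^ m) q * poly_W ^ N)"
  using assms
proof (induction m arbitrary: q)
  case (Suc m)
  let ?R = "(pderiv ^^ m) (poly_W ^ N)"
  have "poly_W ^ 1 dvd ?R" by (rule poly_W_dvd_pderiv_funpow) (use Suc in auto)
  then have "poly ?R 1 = 0" "poly ?R (-1) = 0" by (auto elim!: dvdE)
  then have "poly_int (pderiv (q * ?R)) = 0" by (simp only: poly_int_pderiv) simp
  then have "poly_int (q * pderiv ?R) = - poly_int (pderiv q * ?R)"
    by (simp add: pderiv_mult poly_int_add mult.commute)
  with Suc.IH[of "pderiv q"] Suc.prems show ?case
    by (simp flip: funpow_Suc_right add: funpow_swap1)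
qed simp

text \<open>For even \<open>a\<close> this is Euler's Beta function at ((a + 1) / 2, N + 1); for odd
  \<open>a\<close> it vanishes by symmetry.\<close>

definition beta_W :: "nat \<Rightarrow> nat \<Rightarrow> real" where
  "beta_W a N = poly_int (monom 1 a * poly_W ^ N)"

text \<open>The polynomial x^a (1 - x^2)^(N+1) vanishes at both ends, so its derivative has integral
  0.\<close>

lemma beta_W_pderiv_rec: "real a * beta_W (a - 1) (Suc N) = 2 * real (Suc N) * beta_W (Suc a) N"
proof -
  have "poly_int (pderiv (monom 1 a * poly_W ^ Suc N)) = 0"
    by (simp only: poly_int_pderiv) simp
  also have "pderiv (monom 1 a * poly_W ^ Suc N) = smult (of_nat a) (monom 1 (a - 1) * poly_W ^ Suc N) - smult (2 * real (Suc N)) (monom 1 (Suc a) * poly_W ^ N)"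
  proof -
    have W: "pderiv poly_W = monom (-2) 1" by (simp add: pderiv_pCons monom_altdef)
    show ?thesis
      unfolding pderiv_mult pderiv_power_Suc pderiv_monom W
      by (simp add: poly_eq_poly_eq_iff[symmetric] fun_eq_iff poly_monom algebra_simps del: power_Suc)
         (simp add: algebra_simps)
  qed
  finally show ?thesis by (simp add: poly_int_diff poly_int_smult beta_W_def)
qed

lemma beta_W_split: "beta_W a (Suc N) = beta_W a N - beta_W (a + 2) N"
proof -
  have "monom 1 a * poly_W ^ Suc N = monom 1 a * poly_W ^ N - monom 1 (a + 2) * poly_W ^ N"
    by (simp add: poly_eq_poly_eq_iff[symmetric] fun_eq_iff poly_monom algebra_simps power2_eq_square)
  then show ?thesis by (simp only: beta_W_def poly_int_diff)
qed

lemma beta_W_rec_a: "real (a + 1) * beta_W a N = real (2 * N + a + 3) * beta_W (a + 2) N"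
  using beta_W_pderiv_rec[of "Suc a" N] by (simp add: beta_W_split algebra_simps)

lemma beta_W_rec_N: "real (2 * N + a + 3) * beta_W a (Suc N) = real (2 * N + 2) * beta_W a N"
proof -
  have *: "beta_W (a + 2) N = beta_W a N - beta_W a (Suc N)" by (simp add: beta_W_split)
  show ?thesis using beta_W_rec_a[of a N, unfolded *] by (simp add: algebra_simps)
qed

lemma beta_W_1: "beta_W 1 N = 0"
  using beta_W_pderiv_rec[of 0 N] by simp

text \<open>Classically this is the slicing of a sphere by parallel hyperplanes. Here both sides
  obey the same recurrence in \<open>k\<close>; for the areas it comes from the functional equation
  of the Gamma function.\<close>

lemma sphere_area_ratio: "sphere_area (2 * k + 3) = sphere_area (2 * k + 2) * beta_W 0 k"
proof (induction k)
  case 0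
  have 3: "unit_ball_vol (real 3) = 4 / 3 * pi" and 2: "unit_ball_vol (real 2) = pi"
    using unit_ball_vol_odd[of 1] unit_ball_vol_even[of 1] by (simp_all add: fact_numeral)
  have "beta_W 0 0 = poly_int (pderiv [:0, 1:])" by (simp add: beta_W_def pderiv_pCons one_pCons)
  also have "\<dots> = 2" by (simp only: poly_int_pderiv) simp
  finally show ?case using 2 3 by (simp add: sphere_area_def)
next
  case (Suc k)
  have rec: "unit_ball_vol (real (j + 2)) = 2 * pi / real (j + 2) * unit_ball_vol (real j)" for j
  proof -
    have "Gamma (real j / 2 + 2) = (real j / 2 + 1) * Gamma (real j / 2 + 1)"
    proof -
      have "real j / 2 + 1 \<notin> \<int>\<^sub>\<le>\<^sub>0" using nonpos_Ints_nonpos[of "real j / 2 + 1"] by auto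
      from Gamma_plus1[OF this] show ?thesis by (simp add: add.commute)
    qed
    moreover have "pi powr (real j / 2 + 1) = pi powr (real j / 2) * pi" by (simp add: powr_add)
    moreover have "real (j + 2) / 2 = real j / 2 + 1" "real j / 2 + 1 + 1 = real j / 2 + 2" "real (j + 2) = 2 * (real j / 2 + 1)"
      by simp_all
    ultimately have "unit_ball_vol (real (j + 2)) = pi powr (real j / 2) * pi / ((real j / 2 + 1) * Gamma (real j / 2 + 1))"
      unfolding unit_ball_vol_def by (simp only:)
    moreover have "2 * pi / real (j + 2) = pi / (real j / 2 + 1)" by (simp add: divide_simps)
    ultimately show ?thesis by (simp only: unit_ball_vol_def times_divide_times_eq mult_ac)
  qed
  have rec': "sphere_area (j + 2) = 2 * pi / real j * sphere_area j" if "j > 0" for j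
    using rec[of j] that by (simp add: sphere_area_def)
  have "real (2 * k + 3) * beta_W 0 (Suc k) = real (2 * k + 2) * beta_W 0 k"
    using beta_W_rec_N[of k 0] by simp
  then have "beta_W 0 (Suc k) = real (2 * k + 2) / real (2 * k + 3) * beta_W 0 k" by (simp add: field_simps)
  moreover have "2 * Suc k + 3 = (2 * k + 3) + 2" "2 * Suc k + 2 = (2 * k + 2) + 2" by simp_all
  moreover have "real (2 * k + 2) > 0" by simp
  ultimately show ?case using rec'[of "2 * k + 3"] rec'[of "2 * k + 2"] Suc.IH by (simp del: of_nat_add of_nat_mult)
qed

text \<open>The factor in Rodrigues' formula: near x = 1 the m-th derivative of (1 - x^2)^(m+k)
  behaves like (-1)^m 2^m (m+k)! / k! times (1 - x^2)^k.\<close>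

definition fh_const :: "nat \<Rightarrow> nat \<Rightarrow> real" where
  "fh_const k m = fact k / (2 ^ m * fact (m + k))"

text \<open>The Gegenbauer polynomial of degree \<open>m\<close>, normalized to be 1 at 1, times \<open>(1 - x^2)^k\<close>, by
  Rodrigues' formula.\<close>

definition fh_kernel :: "nat \<Rightarrow> nat \<Rightarrow> real poly" where
  "fh_kernel k m = smult ((-1) ^ m * fh_const k m) ((pderiv ^^ m) (poly_W ^ (m + k)))"

lemma pderiv_funpow_monom:
  "(pderiv ^^ m) (monom 1 j :: real poly) = (if m \<le> j then monom (fact j / fact (j - m)) (j - m) else 0)"
proof (induction m)
  case (Suc m)
  show ?case
  proof (cases "Suc m \<le> j")
    case True
    then obtain a where a: "j = Suc (m + a)" using less_iff_Suc_add by (auto simp: Suc_le_eq)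
    have "real (Suc a) * (fact j / fact (Suc a)) = fact j / fact a"
      unfolding fact_Suc[of a] by (simp del: of_nat_Suc)
    with Suc show ?thesis by (simp add: a pderiv_monom mult.commute del: of_nat_Suc fact_Suc)
  next
    case False
    then show ?thesis using Suc by (auto simp: pderiv_monom not_le less_Suc_eq)
  qed
qed simp

text \<open>The moment of x^j against the kernel after \<open>m\<close> integrations by parts, which
  turn x^j into j!/(j-m)! x^(j-m), or into 0 if m > j.\<close>

definition fh_moment :: "nat \<Rightarrow> nat \<Rightarrow> nat \<Rightarrow> real" where
  "fh_moment k j m = (if m \<le> j then fh_const k m * (fact j / fact (j - m)) * beta_W (j - m) (m + k) else 0)"

lemma poly_int_monom_fh_kernel: "poly_int (monom 1 j * fh_kernel k m) = fh_moment k j m"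
  by (simp add: fh_kernel_def poly_int_smult poly_int_by_parts fh_moment_def pderiv_funpow_monom beta_W_def
      smult_monom[of "fact j / fact (j - m)" 1, simplified, symmetric] poly_int_smult flip: power_mult_distrib)

lemma fh_const_rec: "fh_const k m = 2 * real (Suc m + k) * fh_const k (Suc m)"
proof -
  have "fact (Suc m + k) = real (Suc m + k) * fact (m + k)" by simp
  then show ?thesis unfolding fh_const_def by (simp del: of_nat_Suc of_nat_add add_Suc fact_Suc)
qed

text \<open>The recurrence of \<open>sphere_moment_rec\<close> in dimension 2k + 3. It degenerates
  at the edge: for m > j + 1 all terms vanish, for m = j + 1 two remain, and for m = j each term is
  zero or an odd moment.\<close>

lemma fh_moment_rec:
  "real (2 * k + 3 + j + m - 1) * fh_moment k (Suc j) m = real j * fh_moment k (j - 1) m + real m * fh_moment k j (m - 1)"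
proof -
  consider "m \<ge> j + 2" | "m = Suc j" | "m = j" | a where "j = m + Suc a"
    by (metis add_Suc_right le_Suc_ex less_Suc_eq_le linorder_le_less_linear nat_arith.rule0 not_less_eq_eq
        add_2_eq_Suc' le_antisym less_eq_Suc_le less_iff_Suc_add)
  then show ?thesis
  proof cases
    case 1 then show ?thesis by (auto simp: fh_moment_def)
  next
    case 2
    have "real (2 * k + 2 * j + 3) * beta_W 0 (Suc j + k) = real (2 * k + 2 * j + 2) * beta_W 0 (j + k)"
      using beta_W_rec_N[of "j + k" 0] by (simp add: algebra_simps)
    moreover have "fh_const k j = 2 * real (Suc j + k) * fh_const k (Suc j)" by (rule fh_const_rec)
    moreover have "real (2 * k + 3 + j + m - 1) = real (2 * k + 2 * j + 3)" using 2 by simp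
    ultimately show ?thesis using 2 by (simp add: fh_moment_def field_simps)
  next
    case 3
    have b: "beta_W (Suc 0) N = 0" for N using beta_W_1 by simp
    then show ?thesis using 3 by (cases j) (simp_all add: fh_moment_def Suc_diff_le)
  next
    case (4 a)
    have A: "real (a + 1) * beta_W a (m + k) = real (2 * (m + k) + a + 3) * beta_W (a + 2) (m + k)"
      by (rule beta_W_rec_a)
    have L: "fh_moment k (Suc j) m = fh_const k m * (fact (Suc j) / fact (a + 2)) * beta_W (a + 2) (m + k)"
      and R: "fh_moment k (j - 1) m = fh_const k m * (fact (j - 1) / fact a) * beta_W a (m + k)"
      using 4 by (simp_all add: fh_moment_def numeral_2_eq_2)
    have f: "fact (Suc j) = real (j + 1) * real j * fact (j - 1)" "fact (a + 2) = real (a + 2) * real (a + 1) * fact a"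
      using 4 by (simp_all add: numeral_2_eq_2 algebra_simps)
    \<comment> \<open>\<open>x\<close> and \<open>b\<close> collect the common factors of the three
      terms; what remains is the identity j + 1 = (a + 2) + m.\<close>
    define x where "x = fh_const k m * fact (j - 1) * real j / (real (a + 2) * real (a + 1) * fact a)"
    define b where "b = beta_W (a + 2) (m + k)"
    have A: "real (a + 1) * beta_W a (m + k) = real (2 * (m + k) + a + 3) * b" using A by (simp add: b_def)
    have 1: "real m * fh_moment k j (m - 1) = real m * (x * (real (2 * (m + k) + a + 3) * b))"
    proof (cases m)
      case (Suc m')
      have B: "real (2 * (m + k)) * beta_W (a + 2) (m' + k) = real (2 * (m + k) + a + 3) * b"
        using beta_W_rec_N[of "m' + k" "a + 2"] by (simp add: Suc b_def algebra_simps)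
      have c: "fh_const k m' = real (2 * (m + k)) * fh_const k m" using fh_const_rec[of k m'] by (simp add: Suc)
      have M: "fh_moment k j (m - 1) = fh_const k m' * (fact j / fact (a + 2)) * beta_W (a + 2) (m' + k)"
        using 4 by (simp add: fh_moment_def Suc numeral_2_eq_2)
      have fj: "fact j = real j * fact (j - 1)" using 4 by (simp add: fact_reduce)
      have "fh_moment k j (m - 1) = x * (real (2 * (m + k)) * beta_W (a + 2) (m' + k))"
        unfolding M c fj f x_def by simp
      then show ?thesis unfolding B by simp
    qed simp
    have "real j * fh_moment k (j - 1) m = x * (real (a + 2) * (real (a + 1) * beta_W a (m + k)))"
      unfolding R x_def by simp
    then have 2: "real j * fh_moment k (j - 1) m = x * (real (a + 2) * (real (2 * (m + k) + a + 3) * b))" unfolding A .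
    have 3: "fh_moment k (Suc j) m = x * (real (j + 1) * b)"
      unfolding L f x_def b_def by simp
    have *: "real (2 * k + 3 + j + m - 1) = real (2 * (m + k) + a + 3)" "real (j + 1) = real (a + 2) + real m"
      using 4 by simp_all
    show ?thesis unfolding 1 2 3 * by (simp add: algebra_simps)
  qed
qed

lemma sphere_moment_fh:
  fixes p :: "'a::euclidean_space \<Rightarrow> complex"
  assumes dim: "DIM('a) = 2 * k + 3" and \<theta>: "norm \<theta> = 1" and p: "harmonic_polynomial m p"
  shows "sphere_moment \<theta> j p = of_real (sphere_area (2 * k + 2) * fh_moment k j m) * p \<theta>"
proof (rule sphere_moment_eqI[OF _ \<theta> _ _ _ p, where mm="\<lambda>j m. sphere_area (2 * k + 2) * fh_moment k j m"])
  show "sphere_area (2 * k + 2) * fh_moment k 0 0 = sphere_area DIM('a)"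
    unfolding dim sphere_area_ratio by (simp add: fh_moment_def fh_const_def)
  show "real (DIM('a) + j + m - 1) * (sphere_area (2 * k + 2) * fh_moment k (Suc j) m) =
     real j * (sphere_area (2 * k + 2) * fh_moment k (j - 1) m) + real m * (sphere_area (2 * k + 2) * fh_moment k j (m - 1))" for j m
    using fh_moment_rec[of k j m] unfolding dim by (metis distrib_left mult.left_commute)
qed (use dim in \<open>auto simp: fh_moment_def\<close>)

lemma funk_hecke_poly:
  fixes p :: "'a::euclidean_space \<Rightarrow> complex"
  assumes dim: "DIM('a) = 2 * k + 3" and \<theta>: "norm \<theta> = 1" and p: "harmonic_polynomial m p"
  shows "(LINT \<omega>|sphere_measure. of_real (poly q (\<omega> \<bullet> \<theta>)) * p \<omega>)
       = of_real (sphere_area (2 * k + 2) * poly_int (q * fh_kernel k m)) * p \<theta>"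
proof -
  let ?S = "sphere_measure :: 'a measure"
  note cp = harmonic_polynomial_continuous[OF p]
  have "(LINT \<omega>|?S. of_real (poly q (\<omega> \<bullet> \<theta>)) * p \<omega>) = (LINT \<omega>|?S. (\<Sum>j\<le>degree q. of_real (coeff q j) * (of_real ((\<omega> \<bullet> \<theta>) ^ j) * p \<omega>)))"
    by (simp only: poly_altdef of_real_sum of_real_mult sum_distrib_right mult.assoc)
  also have "\<dots> = (\<Sum>j\<le>degree q. (LINT \<omega>|?S. of_real (coeff q j) * (of_real ((\<omega> \<bullet> \<theta>) ^ j) * p \<omega>)))"
    by (intro Bochner_Integration.integral_sum integrable_sphere_measure continuous_intros cp)
  also have "\<dots> = (\<Sum>j\<le>degree q. of_real (coeff q j) * sphere_moment \<theta> j p)"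
    by (simp add: sphere_moment_def)
  also have "\<dots> = of_real (sphere_area (2 * k + 2) * (\<Sum>j\<le>degree q. coeff q j * poly_int (monom 1 j * fh_kernel k m))) * p \<theta>"
    unfolding sphere_moment_fh[OF dim \<theta> p] poly_int_monom_fh_kernel
    by (simp only: of_real_mult of_real_sum sum_distrib_left sum_distrib_right) (simp only: mult_ac)
  also have "(\<Sum>j\<le>degree q. coeff q j * poly_int (monom 1 j * fh_kernel k m)) = poly_int (q * fh_kernel k m)"
  proof -
    have sum: "poly_int (\<Sum>j\<in>A. f j) = (\<Sum>j\<in>A. poly_int (f j))" if "finite A" for A :: "nat set" and f
      using that by (induction A) (auto simp: poly_int_add)
    have "q * fh_kernel k m = (\<Sum>j\<le>degree q. smult (coeff q j) (monom 1 j * fh_kernel k m))"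
    proof -
      have "q * fh_kernel k m = (\<Sum>j\<le>degree q. monom (coeff q j) j) * fh_kernel k m"
        by (rule arg_cong[where f="\<lambda>q. q * fh_kernel k m"]) (rule poly_as_sum_of_monoms[symmetric])
      also have "\<dots> = (\<Sum>j\<le>degree q. monom (coeff q j) j * fh_kernel k m)" by (rule sum_distrib_right)
      also have "\<dots> = (\<Sum>j\<le>degree q. smult (coeff q j) (monom 1 j * fh_kernel k m))"
        by (rule sum.cong[OF refl]) (metis mult.right_neutral mult_smult_left smult_monom)
      finally show ?thesis .
    qed
    then have "poly_int (q * fh_kernel k m) = poly_int (\<Sum>j\<le>degree q. smult (coeff q j) (monom 1 j * fh_kernel k m))"
      by (rule arg_cong)
    also have "\<dots> = (\<Sum>j\<le>degree q. coeff q j * poly_int (monom 1 j * fh_kernel k m))"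
      by (simp only: sum[OF finite_atMost] poly_int_smult)
    finally show ?thesis by (rule sym)
  qed
  finally show ?thesis .
qed

section \<open>From polynomials to continuous zonal functions\<close>

lemma diff_add_diff_cancel: "(a - b) + (b - c) = a - (c :: 'a::ab_group_add)"
  by simp

lemma le_0_if_le_eps:
  fixes x C :: real
  assumes "\<And>e. e > 0 \<Longrightarrow> x \<le> e * C" and "C \<ge> 0"
  shows "x \<le> 0"
proof (rule field_le_epsilon)
  fix d :: real assume d: "d > 0"
  have "x \<le> d / (C + 1) * C" using d assms by (intro assms) auto
  also have "\<dots> \<le> d" using d assms(2) by (simp add: field_simps)
  finally show "x \<le> 0 + d" by simp
qed

lemma integral_mult_close:
  fixes F G K :: "real \<Rightarrow> real"
  assumes F: "continuous_on {a..b} F" and G: "continuous_on {a..b} G" and K: "continuous_on {a..b} K"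
    and close: "\<And>s. s \<in> {a..b} \<Longrightarrow> \<bar>F s - G s\<bar> \<le> e"
  shows "\<bar>integral {a..b} (\<lambda>s. F s * K s) - integral {a..b} (\<lambda>s. G s * K s)\<bar> \<le> e * integral {a..b} (\<lambda>s. \<bar>K s\<bar>)"
proof -
  have int: "(\<lambda>s. F s * K s) integrable_on {a..b}" "(\<lambda>s. G s * K s) integrable_on {a..b}"
    by (rule integrable_continuous_real, rule continuous_on_mult[OF F K],
        rule integrable_continuous_real, rule continuous_on_mult[OF G K])
  have "norm (integral {a..b} (\<lambda>s. F s * K s - G s * K s)) \<le> integral {a..b} (\<lambda>s. e * \<bar>K s\<bar>)"
  proof (rule Henstock_Kurzweil_Integration.integral_norm_bound_integral)
    show "(\<lambda>s. F s * K s - G s * K s) integrable_on {a..b}"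
      by (rule Henstock_Kurzweil_Integration.integrable_diff[OF int])
    show "(\<lambda>s. e * \<bar>K s\<bar>) integrable_on {a..b}"
      by (rule integrable_continuous_real) (intro continuous_intros K)
    fix s assume "s \<in> {a..b}"
    from mult_right_mono[OF close[OF this] abs_ge_zero[of "K s"]]
    show "norm (F s * K s - G s * K s) \<le> e * \<bar>K s\<bar>"
      by (simp add: left_diff_distrib flip: abs_mult)
  qed
  then show ?thesis by (simp add: Henstock_Kurzweil_Integration.integral_diff[OF int])
qed

text \<open>Both sides are Lipschitz in \<open>F\<close> for the uniform norm, with constants
  \<open>?A\<close> and \<open>?B\<close>, so that the Weierstrass approximation theorem extends the
  polynomial case.\<close>

theorem funk_hecke:
  fixes p :: "'a::euclidean_space \<Rightarrow> complex"
  assumes dim: "DIM('a) = 2 * k + 3" and \<theta>: "norm \<theta> = 1" and p: "harmonic_polynomial m p"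
    and F: "continuous_on {-1..1} F"
  shows "(LINT \<omega>|sphere_measure. of_real (F (\<omega> \<bullet> \<theta>)) * p \<omega>)
       = of_real (sphere_area (2 * k + 2) * integral {-1..1} (\<lambda>s. F s * poly (fh_kernel k m) s)) * p \<theta>"
    (is "?L = ?R")
proof -
  let ?S = "sphere_measure :: 'a measure" and ?K = "poly (fh_kernel k m)"
  let ?A = "LINT \<omega>|?S. norm (p \<omega>)"
  let ?B = "\<bar>sphere_area (2 * k + 2)\<bar> * integral {-1..1} (\<lambda>s. \<bar>?K s\<bar>) * norm (p \<theta>)"
  note cp = harmonic_polynomial_continuous[OF p]
  have cpoly: "continuous_on {-1..1} (poly r)" for r :: "real poly"
    by (auto intro: continuous_at_imp_continuous_on poly_isCont)
  have in1: "\<omega> \<bullet> \<theta> \<in> {-1..1}" if "\<omega> \<in> sphere 0 1" for \<omega>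
    using that Cauchy_Schwarz_ineq2[of \<omega> \<theta>] \<theta> by (auto simp: abs_le_iff)
  have cF: "continuous_on (sphere 0 1) (\<lambda>\<omega>. F (\<omega> \<bullet> \<theta>))"
    by (rule continuous_on_compose2[OF F]) (use in1 in \<open>auto intro!: continuous_intros\<close>)
  have "0 \<le> integral {-1..1} (\<lambda>s. \<bar>?K s\<bar>)"
    by (rule Henstock_Kurzweil_Integration.integral_nonneg)
       (auto intro!: integrable_continuous_real continuous_on_rabs cpoly)
  then have AB: "0 \<le> ?A" "0 \<le> ?B" by simp_all
  have "norm (?L - ?R) \<le> e * (?A + ?B)" if e: "e > 0" for e
  proof -
    obtain g where g: "polynomial_function g" "\<And>s. s \<in> {-1..1} \<Longrightarrow> norm (F s - g s) < e"
      using Stone_Weierstrass_polynomial_function[OF compact_Icc F e] by blast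
    from g(1) obtain a n where ga: "g = (\<lambda>x. \<Sum>i\<le>n. a i * x ^ i)"
      by (auto simp flip: real_polynomial_function_eq simp: real_polynomial_function_iff_sum)
    define q where "q = (\<Sum>i\<le>n. monom (a i) i)"
    have q: "poly q = g" by (auto simp: q_def ga poly_sum poly_monom)
    have close: "\<bar>F s - poly q s\<bar> \<le> e" if "s \<in> {-1..1}" for s using g(2)[OF that] by (simp add: q)
    let ?Lq = "LINT \<omega>|?S. of_real (poly q (\<omega> \<bullet> \<theta>)) * p \<omega>"
    let ?Rq = "of_real (sphere_area (2 * k + 2) * integral {-1..1} (\<lambda>s. poly q s * ?K s)) * p \<theta>"
    have "?L - ?Lq = (LINT \<omega>|?S. of_real (F (\<omega> \<bullet> \<theta>) - poly q (\<omega> \<bullet> \<theta>)) * p \<omega>)"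
    proof (subst Bochner_Integration.integral_diff[symmetric])
      show "integrable ?S (\<lambda>\<omega>. of_real (F (\<omega> \<bullet> \<theta>)) * p \<omega>)" "integrable ?S (\<lambda>\<omega>. of_real (poly q (\<omega> \<bullet> \<theta>)) * p \<omega>)"
        by (intro integrable_sphere_measure continuous_intros cp cF)+
    qed (simp add: algebra_simps)
    also have "norm \<dots> \<le> (LINT \<omega>|?S. e * norm (p \<omega>))"
    proof (rule Bochner_Integration.integral_norm_bound_integral)
      show "integrable ?S (\<lambda>\<omega>. of_real (F (\<omega> \<bullet> \<theta>) - poly q (\<omega> \<bullet> \<theta>)) * p \<omega>)" "integrable ?S (\<lambda>\<omega>. e * norm (p \<omega>))"
        by (intro integrable_sphere_measure continuous_intros cp cF)+
      fix \<omega> :: 'a assume "\<omega> \<in> space ?S"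
      then show "norm (of_real (F (\<omega> \<bullet> \<theta>) - poly q (\<omega> \<bullet> \<theta>)) * p \<omega>) \<le> e * norm (p \<omega>)"
        using close[OF in1, of \<omega>] unfolding norm_mult norm_of_real space_sphere_measure by (auto intro!: mult_right_mono)
    qed
    finally have 1: "norm (?L - ?Lq) \<le> e * ?A" by simp
    have i: "\<bar>integral {-1..1} (\<lambda>s. F s * ?K s) - integral {-1..1} (\<lambda>s. poly q s * ?K s)\<bar> \<le> e * integral {-1..1} (\<lambda>s. \<bar>?K s\<bar>)"
      by (rule integral_mult_close[OF F cpoly cpoly close])
    have 2: "norm (?Rq - ?R) \<le> e * ?B"
    proof -
      have *: "norm (of_real (S * x) * P - of_real (S * y) * P :: complex) \<le> e * (\<bar>S\<bar> * I * norm P)"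
        if "\<bar>y - x\<bar> \<le> e * I" for S x y I :: real and P
      proof -
        have "of_real (S * x) * P - of_real (S * y) * P = of_real (S * (x - y)) * P"
          by (simp add: algebra_simps)
        also have "norm \<dots> = \<bar>S\<bar> * \<bar>y - x\<bar> * norm P"
          unfolding norm_mult norm_of_real abs_mult by (simp add: abs_minus_commute)
        also have "\<dots> \<le> \<bar>S\<bar> * (e * I) * norm P"
          by (intro mult_right_mono mult_left_mono that) auto
        finally show ?thesis by (simp add: mult_ac)
      qed
      show ?thesis by (rule *[OF i])
    qed
    have "poly_int (q * fh_kernel k m) = integral {-1..1} (\<lambda>s. poly q s * ?K s)"
      unfolding poly_int_def by (rule arg_cong[where f="integral {-1..1}"]) auto
    then have "?Lq = ?Rq" using funk_hecke_poly[OF dim \<theta> p, of q] by (simp only:)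
    from norm_triangle_le[OF add_mono[OF 1 2]] have "norm ((?L - ?Lq) + (?Rq - ?R)) \<le> e * (?A + ?B)"
      unfolding distrib_left .
    moreover have "(?L - ?Lq) + (?Rq - ?R) = ?L - ?R" unfolding \<open>?Lq = ?Rq\<close> by (rule diff_add_diff_cancel)
    ultimately show ?thesis by (simp only:)
  qed
  from le_0_if_le_eps[OF this] AB have "norm (?L - ?R) \<le> 0" by (meson add_nonneg_nonneg)
  then show ?thesis by (simp only: norm_le_zero_iff right_minus_eq)
qed

section \<open>Spherical means\<close>

text \<open>The bound is asked of all points of the types, which is the reason for the cutoffs by
  indicators in the applications.\<close>

lemma finite_measure_integral_swap:
  fixes f :: "'x \<Rightarrow> 'y \<Rightarrow> 'b::{banach, second_countable_topology}"
  assumes "finite_measure M1" "finite_measure M2"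
    and f: "case_prod f \<in> borel_measurable (M1 \<Otimes>\<^sub>M M2)" and B: "\<And>x y. norm (f x y) \<le> B"
  shows "(LINT x|M1. LINT y|M2. f x y) = (LINT y|M2. LINT x|M1. f x y)"
proof -
  interpret M1: finite_measure M1 by fact
  interpret M2: finite_measure M2 by fact
  interpret pair_sigma_finite M1 M2 ..
  have "integrable (M1 \<Otimes>\<^sub>M M2) (case_prod f)"
    by (rule finite_measure.integrable_const_bound[OF _ _ f, where B=B])
       (auto intro: finite_measure_pair_measure assms B)
  from Fubini_integral[OF this] show ?thesis by simp
qed

lemma continuous_on_lebesgue_integral:
  fixes g :: "real \<Rightarrow> 'x \<Rightarrow> 'b::{banach, second_countable_topology}"
  assumes "finite_measure M" and "\<And>t. g t \<in> borel_measurable M"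
    and "\<And>x. x \<in> space M \<Longrightarrow> continuous_on UNIV (\<lambda>t. g t x)" and B: "\<And>t x. norm (g t x) \<le> B"
  shows "continuous_on UNIV (\<lambda>t. LINT x|M. g t x)"
  unfolding continuous_on_sequentially
proof (intro allI ballI impI)
  interpret finite_measure M by fact
  fix X :: "nat \<Rightarrow> real" and t assume X: "(\<forall>n. X n \<in> UNIV) \<and> X \<longlonglongrightarrow> t"
  show "((\<lambda>t. LINT x|M. g t x) \<circ> X) \<longlonglongrightarrow> (LINT x|M. g t x)"
    unfolding comp_def
  proof (rule integral_dominated_convergence[where w="\<lambda>_. B"])
    show "AE x in M. (\<lambda>i. g (X i) x) \<longlonglongrightarrow> g t x"
    proof (rule AE_I2)
      fix x assume "x \<in> space M"
      from assms(3)[OF this] X show "(\<lambda>i. g (X i) x) \<longlonglongrightarrow> g t x"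
        unfolding continuous_on_sequentially comp_def by blast
    qed
  qed (use assms in auto)
qed

text \<open>The fundamental lemma of the calculus of variations: where \<open>w\<close> keeps its
  sign, the integral against a tent function cannot vanish.\<close>

lemma continuous_zero_if_weak_zero:
  fixes w :: "real \<Rightarrow> real"
  assumes w: "continuous_on {0<..<1} w"
    and weak: "\<And>\<eta> a b. continuous_on UNIV \<eta> \<Longrightarrow> 0 < a \<Longrightarrow> b < 1 \<Longrightarrow> (\<And>t. t \<notin> {a..b} \<Longrightarrow> \<eta> t = 0) \<Longrightarrow>
        (LINT t:{0<..<1}|lborel. \<eta> t * w t) = 0"
    and t0: "t0 \<in> {0<..<1}"
  shows "w t0 = 0"
proof (rule ccontr)
  assume "w t0 \<noteq> 0"
  define s where "s = sgn (w t0)"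
  have pos: "s * w t0 > 0" using \<open>w t0 \<noteq> 0\<close> by (cases "w t0 > 0") (auto simp: s_def sgn_if)
  have cs: "continuous_on {0<..<1} (\<lambda>t. s * w t)" by (rule continuous_on_mult_left[OF w])
  have "\<exists>\<delta>>0. \<forall>t\<in>{0<..<1}. dist t t0 < \<delta> \<longrightarrow> dist (s * w t) (s * w t0) < s * w t0"
    using cs t0 pos unfolding continuous_on_iff by blast
  then obtain \<delta> where \<delta>: "\<delta> > 0" "\<And>t. t \<in> {0<..<1} \<Longrightarrow> dist t t0 < \<delta> \<Longrightarrow> dist (s * w t) (s * w t0) < s * w t0" by blast
  \<comment> \<open>This radius keeps the tent inside (0,1) and inside the neighbourhood on which
    \<open>s * w t\<close> is positive.\<close>
  define d where "d = min (\<delta> / 2) (min (t0 / 2) ((1 - t0) / 2))"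
  have d: "d > 0" "d < \<delta>" "t0 - d > 0" "t0 + d < 1" using \<delta> t0 by (auto simp: d_def min_def field_simps)
  define \<eta> where "\<eta> t = max 0 (d - \<bar>t - t0\<bar>)" for t
  have c\<eta>: "continuous_on A \<eta>" for A unfolding \<eta>_def by (intro continuous_intros)
  have \<eta>0: "\<eta> t = 0" if "t \<notin> {t0 - d..t0 + d}" for t using that d by (auto simp: \<eta>_def)
  have "(LINT t:{0<..<1}|lborel. \<eta> t * w t) = 0"
    by (rule weak[OF c\<eta> d(3,4) \<eta>0])
  also have "(LINT t:{0<..<1}|lborel. \<eta> t * w t) = (LINT t:{t0 - d..t0 + d}|lborel. \<eta> t * w t)"
    unfolding set_lebesgue_integral_def
    by (rule Bochner_Integration.integral_cong) (use d \<eta>0 in \<open>auto simp: indicator_def\<close>)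
  also have "\<dots> = integral {t0 - d..t0 + d} (\<lambda>t. \<eta> t * w t)"
    by (rule set_borel_integral_eq_integral, rule borel_integrable_atLeastAtMost', rule continuous_on_mult[OF c\<eta>],
        rule continuous_on_subset[OF w]) (use d in auto)
  finally have "integral {t0 - d..t0 + d} (\<lambda>t. \<eta> t * (s * w t)) = 0"
    by (simp add: mult.left_commute)
  moreover have "continuous_on {t0 - d..t0 + d} (\<lambda>t. \<eta> t * (s * w t))"
    by (rule continuous_on_mult[OF c\<eta>], rule continuous_on_subset[OF cs]) (use d in auto)
  moreover have "0 \<le> \<eta> t * (s * w t)" if "t \<in> {t0 - d..t0 + d}" for t
  proof -
    have "dist (s * w t) (s * w t0) < s * w t0" by (rule \<delta>(2)) (use that d in \<open>auto simp: dist_real_def\<close>)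
    then have "0 \<le> s * w t" unfolding dist_real_def by linarith
    then show ?thesis by (rule mult_nonneg_nonneg[rotated]) (simp add: \<eta>_def)
  qed
  ultimately have "\<eta> t0 * (s * w t0) = 0"
    using integral_eq_0_iff[of "t0 - d" "t0 + d" "\<lambda>t. \<eta> t * (s * w t)"] d by auto
  with pos d show False by (auto simp: \<eta>_def)
qed

text \<open>The law of cosines: \<open>t\<close> is the distance between a unit vector and a point
  of norm \<open>r\<close>, and \<open>s\<close> is the cosine of the angle between them, so t dt =
  - r ds.\<close>

lemma zonal_substitution:
  fixes \<eta> :: "real \<Rightarrow> real"
  assumes \<eta>: "continuous_on UNIV \<eta>" and r: "0 < r" "r < 1"
  shows "integral {-1..1} (\<lambda>s. \<eta> (sqrt (1 + r\<^sup>2 - 2 * r * s)) * poly K s)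
       = integral {1 - r..1 + r} (\<lambda>t. t / r * (\<eta> t * poly K ((1 + r\<^sup>2 - t\<^sup>2) / (2 * r))))"
proof -
  define F where "F s = \<eta> (sqrt (1 + r\<^sup>2 - 2 * r * s)) * poly K s" for s
  \<comment> \<open>Minus the cosine, so that \<open>g\<close> increases with \<open>t\<close> and
    the limits of integration keep their order.\<close>
  define g where "g t = - ((1 + r\<^sup>2 - t\<^sup>2) / (2 * r))" for t
  have poly: "continuous_on A (poly K)" for A
    by (auto intro: continuous_at_imp_continuous_on poly_isCont)
  have cF: "continuous_on UNIV F"
    unfolding F_def
    by (rule continuous_on_mult, rule continuous_on_compose2[OF \<eta>]) (auto intro!: continuous_intros poly)
  have g_ends: "g (1 - r) = -1" "g (1 + r) = 1"
    using r by (simp_all add: g_def power2_eq_square field_simps)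
  have mono: "g x \<le> g y" if "0 \<le> x" "x \<le> y" for x y
    using that r by (auto simp: g_def divide_simps intro: power_mono)
  have sub: "((\<lambda>t. (t / r) *\<^sub>R F (- g t)) has_integral integral {g (1 - r)..g (1 + r)} (\<lambda>s. F (- s))) {1 - r..1 + r}"
  proof (rule has_integral_substitution[where c="-1" and d=1])
    have "g x \<in> {-1..1}" if "x \<in> {1 - r..1 + r}" for x
      using that mono[of "1 - r" x] mono[of x "1 + r"] g_ends r by auto
    then show "g ` {1 - r..1 + r} \<subseteq> {-1..1}" by blast
    show "continuous_on {-1..1} (\<lambda>s. F (- s))"
      by (rule continuous_on_compose2[OF cF]) (auto intro!: continuous_intros)
    show "(g has_real_derivative t / r) (at t within {1 - r..1 + r})" for t
      unfolding g_def using r by (auto intro!: derivative_eq_intros simp: field_simps)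
  qed (use r g_ends in auto)
  have "integral {-1..1} F = integral {g (1 - r)..g (1 + r)} (\<lambda>s. F (- s))"
    using Henstock_Kurzweil_Integration.integral_reflect_real[of 1 "-1" F] by (simp add: g_ends)
  also have "\<dots> = integral {1 - r..1 + r} (\<lambda>t. (t / r) *\<^sub>R F (- g t))"
    by (rule integral_unique[OF sub, symmetric])
  also have "\<dots> = integral {1 - r..1 + r} (\<lambda>t. t / r * (\<eta> t * poly K ((1 + r\<^sup>2 - t\<^sup>2) / (2 * r))))"
  proof (rule integral_cong)
    fix t assume "t \<in> {1 - r..1 + r}"
    then have "t \<ge> 0" using r by auto
    have "1 + r\<^sup>2 - 2 * r * (- g t) = t\<^sup>2" using r by (simp add: g_def)
    then have "sqrt (1 + r\<^sup>2 - 2 * r * (- g t)) = t" using \<open>t \<ge> 0\<close> by simp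
    then show "(t / r) *\<^sub>R F (- g t) = t / r * (\<eta> t * poly K ((1 + r\<^sup>2 - t\<^sup>2) / (2 * r)))"
      unfolding F_def by (simp only:) (simp add: g_def)
  qed
  finally show ?thesis unfolding F_def .
qed

text \<open>This definition and the next two put the domains of integration on full Borel spaces as
  finite measures, where joint measurability on products is easily derived.\<close>

definition unit_interval_measure :: "real measure" where
  "unit_interval_measure = density lborel (indicator {0<..<1})"

definition unit_ball_measure :: "'a::euclidean_space measure" where
  "unit_ball_measure = density lborel (indicator (ball 0 1))"

definition sphere_borel :: "'a::euclidean_space measure" where
  "sphere_borel = distr sphere_measure borel (\<lambda>x. x)"

lemma sets_aux [measurable_cong, simp]:
  "sets unit_interval_measure = sets borel" "sets unit_ball_measure = sets borel" "sets sphere_borel = sets borel"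
  by (simp_all add: unit_interval_measure_def unit_ball_measure_def sphere_borel_def)

lemma id_measurable_sphere: "(\<lambda>x. x) \<in> sphere_measure \<rightarrow>\<^sub>M borel"
  by (simp add: measurable_cong_sets[OF sets_sphere_measure refl] measurable_restrict_space1)

lemma finite_measures_aux:
  "finite_measure unit_interval_measure" "finite_measure (unit_ball_measure :: 'a::euclidean_space measure)"
  "finite_measure (sphere_borel :: 'a measure)"
proof -
  show "finite_measure unit_interval_measure"
    by (rule finite_measureI) (simp add: unit_interval_measure_def emeasure_density nn_integral_indicator)
  show "finite_measure (unit_ball_measure :: 'a measure)"
  proof (rule finite_measureI)
    have "emeasure (unit_ball_measure :: 'a measure) UNIV = (\<integral>\<^sup>+x. indicator (ball 0 1) x \<partial>(lborel :: 'a measure))"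
      unfolding unit_ball_measure_def by (subst emeasure_density) (auto intro!: borel_measurable_indicator)
    also have "\<dots> = emeasure lborel (ball (0::'a) 1)" by (rule nn_integral_indicator) auto
    finally show "emeasure (unit_ball_measure :: 'a measure) (space unit_ball_measure) \<noteq> \<infinity>"
      using emeasure_lborel_ball_finite[of "0::'a" 1] by (simp add: unit_ball_measure_def)
  qed
  show "finite_measure (sphere_borel :: 'a measure)"
    unfolding sphere_borel_def by (intro finite_measure.finite_measure_distr finite_measure_sphere id_measurable_sphere)
qed

lemma integral_unit_interval_measure:
  fixes f :: "real \<Rightarrow> 'b::{banach, second_countable_topology}"
  assumes "f \<in> borel_measurable borel"
  shows "(LINT t|unit_interval_measure. f t) = (LINT t:{0<..<1}|lborel. f t)"
proof -
  have eq: "unit_interval_measure = density lborel (\<lambda>t. ennreal (indicator {0<..<1} t))"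
    by (simp add: unit_interval_measure_def ennreal_indicator)
  show ?thesis unfolding eq set_lebesgue_integral_def
    by (rule integral_density) (use assms in \<open>auto intro!: borel_measurable_indicator\<close>)
qed

lemma integral_unit_ball_measure:
  fixes f :: "'a::euclidean_space \<Rightarrow> 'b::{banach, second_countable_topology}"
  assumes "f \<in> borel_measurable borel"
  shows "(LINT t|unit_ball_measure. f t) = (LINT t:ball 0 1|lborel. f t)"
proof -
  have eq: "(unit_ball_measure :: 'a measure) = density lborel (\<lambda>t. ennreal (indicator (ball 0 1) t))"
    by (simp add: unit_ball_measure_def ennreal_indicator)
  show ?thesis unfolding eq set_lebesgue_integral_def
    by (rule integral_density) (use assms in \<open>auto intro!: borel_measurable_indicator\<close>)
qed

lemma integral_sphere_borel:
  fixes f :: "'a::euclidean_space \<Rightarrow> 'b::{banach, second_countable_topology}"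
  assumes "f \<in> borel_measurable borel"
  shows "(LINT t|sphere_borel. f t) = (LINT t|sphere_measure. f t)"
  unfolding sphere_borel_def by (rule integral_distr[OF id_measurable_sphere assms])

lemma continuous_bounded_support:
  fixes f :: "'a::euclidean_space \<Rightarrow> 'b::real_normed_vector"
  assumes "continuous_on UNIV f" "\<And>x. x \<notin> cball 0 c \<Longrightarrow> f x = 0"
  obtains B where "\<And>x. norm (f x) \<le> B" "B \<ge> 0"
proof -
  have "compact (f ` cball 0 c)" using assms(1) by (auto intro!: compact_continuous_image intro: continuous_on_subset)
  then obtain B where "\<And>x. x \<in> cball 0 c \<Longrightarrow> norm (f x) \<le> B" by (metis compact_imp_bounded bounded_iff image_eqI)
  then have "norm (f x) \<le> max 0 B" for x using assms(2)[of x] by (cases "x \<in> cball 0 c") (auto simp: le_max_iff_disj)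
  then show ?thesis using that[of "max 0 B"] by auto
qed

text \<open>With t^(2k+2) included, (t, omega) are polar coordinates about theta, and the left side
  becomes a volume integral of \<open>\<eta>\<close> at the distance to theta, times
  \<open>f\<close> and \<open>q\<close>. After an exchange of integrals and polar coordinates about
  0, the theta-integral is zonal, and Funk--Hecke together with the law of cosines brings
  \<open>t\<close> back. The support of \<open>\<eta>\<close> below 1 keeps the shifted variable in
  the unit ball.\<close>

lemma spherical_mean_weak:
  fixes f q :: "'a::euclidean_space \<Rightarrow> complex" and \<eta> :: "real \<Rightarrow> real"
  assumes dim: "DIM('a) = 2 * k + 3" and q: "harmonic_polynomial m q"
    and f: "continuous_on UNIV f" "\<And>x. norm x \<ge> 1 \<Longrightarrow> f x = 0"
    and \<eta>: "continuous_on UNIV \<eta>" "0 < a" "b < 1" "\<And>t. t \<notin> {a..b} \<Longrightarrow> \<eta> t = 0"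
  shows "(LINT t:{0<..<1}|lborel. of_real (\<eta> t) * (of_real (t ^ (2 * k + 2)) * (LINT \<theta>|sphere_measure. (LINT \<omega>|sphere_measure. f (\<theta> + t *\<^sub>R \<omega>)) * q \<theta>)))
    = (LINT t:{0<..<1}|lborel. of_real (\<eta> t) * (of_real (sphere_area (2 * k + 2) * t) *
        (LINT r:{1 - t..1}|lborel. of_real (r ^ (2 * k + 1) * poly (fh_kernel k m) ((1 + r\<^sup>2 - t\<^sup>2) / (2 * r))) * (LINT \<omega>|sphere_measure. f (r *\<^sub>R \<omega>) * q \<omega>))))"
proof -
  let ?S = "sphere_borel :: 'a measure" and ?U = unit_interval_measure and ?V = "unit_ball_measure :: 'a measure"
  let ?K = "poly (fh_kernel k m)" and ?A = "sphere_area (2 * k + 2)"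
  define n1 where "n1 = 2 * k + 2"
  have n1: "DIM('a) - 1 = n1" using dim by (simp add: n1_def)
  interpret S: finite_measure ?S by (rule finite_measures_aux)
  interpret U: finite_measure ?U by (rule finite_measures_aux)
  interpret V: finite_measure ?V by (rule finite_measures_aux)
  have cq: "continuous_on X q" for X by (rule harmonic_polynomial_continuous[OF q])
  have [measurable]: "f \<in> borel_measurable borel" "q \<in> borel_measurable borel" "\<eta> \<in> borel_measurable borel"
    using f \<eta> cq by (auto intro: borel_measurable_continuous_onI)
  obtain Bf where Bf: "\<And>x. norm (f x) \<le> Bf" "Bf \<ge> 0"
    by (rule continuous_bounded_support[OF f(1), where c=1]) (use f(2) in auto)
  have out: "\<eta> t = 0" if "t \<notin> cball 0 1" for t
  proof (rule \<eta>(4))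
    show "t \<notin> {a..b}" using that \<eta>(2,3) by (auto simp: dist_real_def abs_le_iff)
  qed
  obtain Bc where Bc: "\<And>t. norm (\<eta> t) \<le> Bc" "Bc \<ge> 0"
    by (rule continuous_bounded_support[OF \<eta>(1) out], assumption, rule that)
  have Bc': "\<bar>\<eta> t\<bar> \<le> Bc" for t using Bc(1)[of t] by simp
  have out1: "\<eta> t = 0" if "t \<ge> 1" for t
    by (rule \<eta>(4)) (use that \<eta>(3) in auto)
  \<comment> \<open>Off the sphere \<open>q\<close> is unbounded in general; cutting it off gives
    the global bound \<open>Bq\<close>.\<close>
  define q' where "q' x = indicator (sphere 0 1) x * q x" for x
  have [measurable]: "q' \<in> borel_measurable borel" unfolding q'_def[abs_def]
    by (rule borel_measurable_times[OF borel_measurable_indicator[OF borel_closed[OF closed_sphere]] borel_measurable_continuous_onI[OF cq]])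
  have "compact (q ` sphere 0 1)" by (intro compact_continuous_image cq) auto
  then obtain Bq0 where "\<And>x. x \<in> sphere 0 1 \<Longrightarrow> norm (q x) \<le> Bq0" by (metis compact_imp_bounded bounded_iff image_eqI)
  then obtain Bq where Bq: "\<And>x. norm (q' x) \<le> Bq" "Bq \<ge> 0"
    by (intro that[of "max 0 Bq0"]) (auto simp: q'_def indicator_def le_max_iff_disj)
  have Sq: "(LINT \<theta>|sphere_measure. h \<theta> * q \<theta>) = (LINT \<theta>|?S. h \<theta> * q' \<theta>)" if [measurable]: "h \<in> borel_measurable borel" for h :: "'a \<Rightarrow> complex"
  proof -
    have "(LINT \<theta>|?S. h \<theta> * q' \<theta>) = (LINT \<theta>|sphere_measure. h \<theta> * q' \<theta>)" by (rule integral_sphere_borel) measurable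
    also have "\<dots> = (LINT \<theta>|sphere_measure. h \<theta> * q \<theta>)"
      by (rule Bochner_Integration.integral_cong) (auto simp: space_sphere_measure q'_def)
    finally show ?thesis ..
  qed
  define I where "I t \<theta> = (LINT \<omega>|?S. f (\<theta> + t *\<^sub>R \<omega>))" for t \<theta>
  have mI [measurable]: "(\<lambda>z. I (fst z) (snd z)) \<in> borel_measurable (borel \<Otimes>\<^sub>M borel)"
    unfolding I_def by (rule S.borel_measurable_lebesgue_integral) measurable
  have mIt [measurable]: "(\<lambda>\<theta>. I t \<theta>) \<in> borel_measurable borel" for t
    unfolding I_def by (rule S.borel_measurable_lebesgue_integral) measurable
  define CS where "CS = measure ?S (space ?S)"
  have BI: "norm (I t \<theta>) \<le> Bf * CS" for t \<theta>
  proof -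
    have "norm (I t \<theta>) \<le> (LINT \<omega>|?S. norm (f (\<theta> + t *\<^sub>R \<omega>)))" unfolding I_def by (rule integral_norm_bound)
    also have "\<dots> \<le> (LINT \<omega>|?S. Bf)"
      by (rule integral_mono) (auto intro!: S.integrable_const_bound[where B=Bf] Bf)
    finally show ?thesis by (simp add: CS_def mult_ac)
  qed
  have CS: "CS \<ge> 0" by (simp add: CS_def)
  have tb: "norm (of_real (\<eta> t * t ^ j) :: complex) \<le> Bc" for t j
  proof (cases "t \<in> {a..b}")
    case True
    then have "\<bar>t\<bar> ^ j \<le> 1" using \<eta> by (intro power_le_one) auto
    then have "\<bar>\<eta> t\<bar> * \<bar>t\<bar> ^ j \<le> Bc * 1" using Bc by (intro mult_mono) auto
    then show ?thesis by (simp add: norm_mult norm_power abs_mult power_abs)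
  qed (use \<eta> Bc in auto)
  have "(LINT t:{0<..<1}|lborel. of_real (\<eta> t) * (of_real (t ^ (2 * k + 2)) * (LINT \<theta>|sphere_measure. (LINT \<omega>|sphere_measure. f (\<theta> + t *\<^sub>R \<omega>)) * q \<theta>)))
     = (LINT t|?U. (LINT \<theta>|?S. of_real (\<eta> t * t ^ n1) * I t \<theta> * q' \<theta>))"
  proof (subst integral_unit_interval_measure)
    show "(\<lambda>t. LINT \<theta>|?S. of_real (\<eta> t * t ^ n1) * I t \<theta> * q' \<theta>) \<in> borel_measurable borel"
      by (rule S.borel_measurable_lebesgue_integral) (simp add: split_beta, measurable)
    have "(LINT \<theta>|sphere_measure. (LINT \<omega>|sphere_measure. f (\<theta> + t *\<^sub>R \<omega>)) * q \<theta>) = (LINT \<theta>|?S. I t \<theta> * q' \<theta>)" for t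
    proof -
      have "(LINT \<omega>|sphere_measure. f (\<theta> + t *\<^sub>R \<omega>)) = I t \<theta>" for \<theta>
        unfolding I_def by (rule integral_sphere_borel[symmetric]) measurable
      then show ?thesis using Sq[of "I t"] by simp
    qed
    then show "(LINT t:{0<..<1}|lborel. of_real (\<eta> t) * (of_real (t ^ (2 * k + 2)) * (LINT \<theta>|sphere_measure. (LINT \<omega>|sphere_measure. f (\<theta> + t *\<^sub>R \<omega>)) * q \<theta>)))
      = (LINT t:{0<..<1}|lborel. (LINT \<theta>|?S. of_real (\<eta> t * t ^ n1) * I t \<theta> * q' \<theta>))"
      by (simp add: mult.assoc n1_def)
  qed
  also have "\<dots> = (LINT \<theta>|?S. LINT t|?U. of_real (\<eta> t * t ^ n1) * I t \<theta> * q' \<theta>)"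
  proof (rule finite_measure_integral_swap[where B="Bc * (Bf * CS) * Bq"])
    show "(\<lambda>(t, \<theta>). of_real (\<eta> t * t ^ n1) * I t \<theta> * q' \<theta>) \<in> borel_measurable (?U \<Otimes>\<^sub>M ?S)"
      unfolding split_beta by measurable
    show "norm (of_real (\<eta> t * t ^ n1) * I t \<theta> * q' \<theta>) \<le> Bc * (Bf * CS) * Bq" for t \<theta>
      unfolding norm_mult using tb[of t n1, unfolded norm_mult] Bc Bf CS Bq BI by (intro mult_mono) (auto simp: norm_mult)
  qed (rule finite_measures_aux)+
  also have "\<dots> = (LINT \<theta>|?S. LINT x|?V. of_real (\<eta> (norm (x - \<theta>))) * f x * q' \<theta>)"
  proof (rule Bochner_Integration.integral_cong[OF refl])
    fix \<theta> :: 'a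
    have "(LINT t|?U. of_real (\<eta> t * t ^ n1) * I t \<theta>) = (LINT t:{0<..<1}|lborel. of_real (\<eta> t * t ^ n1) * I t \<theta>)"
      by (rule integral_unit_interval_measure) (simp add: I_def, measurable)
    also have "\<dots> = (LINT t:{0<..<1}|lborel. t ^ (DIM('a) - 1) *\<^sub>R (LINT \<omega>|sphere_measure. of_real (\<eta> (norm (t *\<^sub>R \<omega>))) * f (\<theta> + t *\<^sub>R \<omega>)))"
      unfolding set_lebesgue_integral_def
    proof (rule Bochner_Integration.integral_cong[OF refl])
      fix t :: real
      have "of_real (\<eta> t * t ^ n1) * I t \<theta> = t ^ (DIM('a) - 1) *\<^sub>R (LINT \<omega>|sphere_measure. of_real (\<eta> (norm (t *\<^sub>R \<omega>))) * f (\<theta> + t *\<^sub>R \<omega>))" if "0 < t"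
      proof -
        have Ieq: "I t \<theta> = (LINT \<omega>|sphere_measure. f (\<theta> + t *\<^sub>R \<omega>))" unfolding I_def by (rule integral_sphere_borel) measurable
        have "(LINT \<omega>|sphere_measure. of_real (\<eta> (norm (t *\<^sub>R \<omega>))) * f (\<theta> + t *\<^sub>R \<omega>)) = (LINT \<omega>|sphere_measure. of_real (\<eta> t) * f (\<theta> + t *\<^sub>R \<omega>))"
          by (rule Bochner_Integration.integral_cong) (use that in \<open>auto simp: space_sphere_measure\<close>)
        also have "\<dots> = of_real (\<eta> t) * I t \<theta>" unfolding Ieq by (rule integral_mult_right_zero)
        finally show ?thesis unfolding n1 scaleR_conv_of_real of_real_mult by (simp only: mult_ac)
      qed
      then show "indicator {0<..<1} t *\<^sub>R (of_real (\<eta> t * t ^ n1) * I t \<theta>) = indicator {0<..<1} t *\<^sub>R t ^ (DIM('a) - 1) *\<^sub>R (LINT \<omega>|sphere_measure. of_real (\<eta> (norm (t *\<^sub>R \<omega>))) * f (\<theta> + t *\<^sub>R \<omega>))"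
        by (auto simp: indicator_def)
    qed
    \<comment> \<open>The power \<open>t ^ (DIM('a) - 1)\<close> is the Jacobian for
      \<open>y = t *\<^sub>R \<omega>\<close>, the displacement from
      \<open>\<theta>\<close>.\<close>
    also have "\<dots> = (LINT y:ball 0 1|lborel. of_real (\<eta> (norm y)) * f (\<theta> + y))"
      by (rule polar_ball[symmetric, where B="Bc * Bf"])
         (measurable, use Bc' Bf Bc in \<open>auto simp: norm_mult intro!: mult_mono\<close>)
    also have "\<dots> = (LINT y|lborel. of_real (\<eta> (norm y)) * f (\<theta> + y))"
      unfolding set_lebesgue_integral_def
      by (rule Bochner_Integration.integral_cong) (use \<eta> in \<open>auto simp: indicator_def\<close>)
    also have "\<dots> = (LINT x|lborel. of_real (\<eta> (norm (x - \<theta>))) * f x)"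
      using lborel_integral_translation[of "\<lambda>x. of_real (\<eta> (norm (x - \<theta>))) * f x" \<theta>] by (simp add: add.commute)
    also have "\<dots> = (LINT x:ball 0 1|lborel. of_real (\<eta> (norm (x - \<theta>))) * f x)"
      unfolding set_lebesgue_integral_def
      by (rule Bochner_Integration.integral_cong) (use f in \<open>auto simp: indicator_def\<close>)
    also have "\<dots> = (LINT x|?V. of_real (\<eta> (norm (x - \<theta>))) * f x)"
      by (rule integral_unit_ball_measure[symmetric]) measurable
    finally show "(LINT t|?U. of_real (\<eta> t * t ^ n1) * I t \<theta> * q' \<theta>) = (LINT x|?V. of_real (\<eta> (norm (x - \<theta>))) * f x * q' \<theta>)"
      by (simp only: integral_mult_left_zero)
  qed
  also have "\<dots> = (LINT x|?V. LINT \<theta>|?S. of_real (\<eta> (norm (x - \<theta>))) * f x * q' \<theta>)"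
  proof (rule finite_measure_integral_swap[where B="Bc * Bf * Bq"])
    show "(\<lambda>(\<theta>, x). of_real (\<eta> (norm (x - \<theta>))) * f x * q' \<theta>) \<in> borel_measurable (?S \<Otimes>\<^sub>M ?V)"
      unfolding split_beta by measurable
    show "norm (of_real (\<eta> (norm (x - \<theta>))) * f x * q' \<theta>) \<le> Bc * Bf * Bq" for x \<theta>
      unfolding norm_mult norm_of_real using Bc' Bc Bf Bq by (intro mult_mono) auto
  qed (rule finite_measures_aux)+
  also have "\<dots> = (LINT x:ball 0 1|lborel. LINT \<theta>|?S. of_real (\<eta> (norm (x - \<theta>))) * f x * q' \<theta>)"
    by (rule integral_unit_ball_measure, rule S.borel_measurable_lebesgue_integral) (simp add: split_beta, measurable)
  also have "\<dots> = (LINT r:{0<..<1}|lborel. r ^ (DIM('a) - 1) *\<^sub>R (LINT \<omega>|sphere_measure. (LINT \<theta>|?S. of_real (\<eta> (norm (r *\<^sub>R \<omega> - \<theta>))) * f (r *\<^sub>R \<omega>) * q' \<theta>)))"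
  proof (rule polar_ball[where B="Bc * Bf * Bq * CS"])
    show "(\<lambda>x. LINT \<theta>|?S. of_real (\<eta> (norm (x - \<theta>))) * f x * q' \<theta>) \<in> borel_measurable borel"
      by (rule S.borel_measurable_lebesgue_integral) (simp add: split_beta, measurable)
    show "norm (LINT \<theta>|?S. of_real (\<eta> (norm (x - \<theta>))) * f x * q' \<theta>) \<le> Bc * Bf * Bq * CS" for x
    proof -
      have *: "norm (of_real (\<eta> (norm (x - \<theta>))) * f x * q' \<theta>) \<le> Bc * Bf * Bq" for \<theta>
        unfolding norm_mult norm_of_real using Bc' Bc Bf Bq by (intro mult_mono) auto
      have "norm (LINT \<theta>|?S. of_real (\<eta> (norm (x - \<theta>))) * f x * q' \<theta>) \<le> (LINT \<theta>|?S. norm (of_real (\<eta> (norm (x - \<theta>))) * f x * q' \<theta>))"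
        by (rule integral_norm_bound)
      also have "\<dots> \<le> (LINT \<theta>|?S. Bc * Bf * Bq)"
        by (rule integral_mono) (use * in \<open>auto intro!: S.integrable_const_bound[where B="Bc * Bf * Bq"]\<close>)
      finally show ?thesis by (simp add: CS_def mult_ac)
    qed
  qed
  also have "\<dots> = (LINT r:{0<..<1}|lborel. LINT t|?U. of_real (indicator {1 - t..1} r * (\<eta> t * t) * (?A * (r ^ (2 * k + 1) * ?K ((1 + r\<^sup>2 - t\<^sup>2) / (2 * r))))) * (LINT \<omega>|sphere_measure. f (r *\<^sub>R \<omega>) * q \<omega>))"
    unfolding set_lebesgue_integral_def
  proof (rule Bochner_Integration.integral_cong[OF refl])
    fix r :: real
    let ?\<phi> = "LINT \<omega>|sphere_measure. f (r *\<^sub>R \<omega>) * q \<omega>"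
    have "r ^ (DIM('a) - 1) *\<^sub>R (LINT \<omega>|sphere_measure. (LINT \<theta>|?S. of_real (\<eta> (norm (r *\<^sub>R \<omega> - \<theta>))) * f (r *\<^sub>R \<omega>) * q' \<theta>)) =
      (LINT t|?U. of_real (indicator {1 - t..1} r * (\<eta> t * t) * (?A * (r ^ (2 * k + 1) * ?K ((1 + r\<^sup>2 - t\<^sup>2) / (2 * r))))) * ?\<phi>)" if r: "0 < r" "r < 1"
    proof -
      define lam0 where "lam0 = integral {-1..1} (\<lambda>s. \<eta> (sqrt (1 + r\<^sup>2 - 2 * r * s)) * ?K s)"
      \<comment> \<open>For fixed \<open>\<omega>\<close> the distance to \<open>\<theta>\<close>
        depends on their inner product alone, so Funk--Hecke evaluates the
        \<open>\<theta>\<close>-integral as a multiple of \<open>q \<omega>\<close>.\<close>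
      have inner: "(LINT \<theta>|?S. of_real (\<eta> (norm (r *\<^sub>R \<omega> - \<theta>))) * f (r *\<^sub>R \<omega>) * q' \<theta>) = of_real (?A * lam0) * (f (r *\<^sub>R \<omega>) * q \<omega>)"
        if w: "\<omega> \<in> sphere 0 1" for \<omega>
      proof -
        have nw: "norm \<omega> = 1" using w by simp
        have "(LINT \<theta>|?S. of_real (\<eta> (norm (r *\<^sub>R \<omega> - \<theta>))) * f (r *\<^sub>R \<omega>) * q' \<theta>) = (LINT \<theta>|sphere_measure. of_real (\<eta> (norm (r *\<^sub>R \<omega> - \<theta>))) * f (r *\<^sub>R \<omega>) * q \<theta>)"
          by (rule Sq[symmetric]) measurable
        also have "\<dots> = (LINT \<theta>|sphere_measure. f (r *\<^sub>R \<omega>) * (of_real (\<eta> (sqrt (1 + r\<^sup>2 - 2 * r * (\<theta> \<bullet> \<omega>)))) * q \<theta>))"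
        proof (rule Bochner_Integration.integral_cong[OF refl])
          fix \<theta> :: 'a assume "\<theta> \<in> space sphere_measure"
          then have "norm \<theta> = 1" by (simp add: space_sphere_measure)
          then have "(norm (r *\<^sub>R \<omega> - \<theta>))\<^sup>2 = 1 + r\<^sup>2 - 2 * r * (\<theta> \<bullet> \<omega>)"
            using nw dot_norm_neg[of "r *\<^sub>R \<omega>" \<theta>] by (simp add: inner_commute power_mult_distrib field_simps)
          then have "norm (r *\<^sub>R \<omega> - \<theta>) = sqrt (1 + r\<^sup>2 - 2 * r * (\<theta> \<bullet> \<omega>))" by (metis norm_ge_zero real_sqrt_abs abs_of_nonneg)
          then show "of_real (\<eta> (norm (r *\<^sub>R \<omega> - \<theta>))) * f (r *\<^sub>R \<omega>) * q \<theta> = f (r *\<^sub>R \<omega>) * (of_real (\<eta> (sqrt (1 + r\<^sup>2 - 2 * r * (\<theta> \<bullet> \<omega>)))) * q \<theta>)"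
            by (simp only: mult_ac)
        qed
        also have "\<dots> = f (r *\<^sub>R \<omega>) * (LINT \<theta>|sphere_measure. of_real (\<eta> (sqrt (1 + r\<^sup>2 - 2 * r * (\<theta> \<bullet> \<omega>)))) * q \<theta>)"
          by (rule integral_mult_right_zero)
        also have "(LINT \<theta>|sphere_measure. of_real (\<eta> (sqrt (1 + r\<^sup>2 - 2 * r * (\<theta> \<bullet> \<omega>)))) * q \<theta>) = of_real (?A * lam0) * q \<omega>"
          unfolding lam0_def
        proof (rule funk_hecke[OF dim nw q])
          show "continuous_on {-1..1} (\<lambda>s. \<eta> (sqrt (1 + r\<^sup>2 - 2 * r * s)))"
            by (rule continuous_on_compose2[OF \<eta>(1)]) (auto intro!: continuous_intros)
        qed
        finally show ?thesis by (simp only: mult_ac)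
      qed
      \<comment> \<open>The factor \<open>t / r\<close> of the substitution lowers the power of
        \<open>r\<close> by one. Of the interval \<open>{1 - r..1 + r}\<close> only the part in
        (0,1) meets the support of \<open>\<eta>\<close>, and there the condition reads
        \<open>1 - t \<le> r\<close>.\<close>
      have lam: "r ^ n1 * lam0 = (LINT t|?U. indicator {1 - t..1} r * (\<eta> t * t) * (r ^ (2 * k + 1) * ?K ((1 + r\<^sup>2 - t\<^sup>2) / (2 * r))))"
      proof -
        let ?h = "\<lambda>t. t / r * (\<eta> t * ?K ((1 + r\<^sup>2 - t\<^sup>2) / (2 * r)))"
        have ch: "continuous_on X ?h" for X
          by (intro continuous_on_mult continuous_on_divide continuous_on_subset[OF \<eta>(1)] continuous_on_poly
               continuous_on_diff continuous_on_power continuous_on_id continuous_on_const continuous_on_add subset_UNIV) (use r in auto)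
        have "lam0 = integral {1 - r..1 + r} ?h" unfolding lam0_def by (rule zonal_substitution[OF \<eta>(1) r])
        also have "\<dots> = (LINT t:{1 - r..1 + r}|lborel. ?h t)"
          by (rule set_borel_integral_eq_integral(2)[symmetric, OF borel_integrable_atLeastAtMost'[OF ch]])
        also have "\<dots> = (LINT t:{0<..<1}|lborel. indicator {1 - t..1} r * ?h t)"
          unfolding set_lebesgue_integral_def
          by (rule Bochner_Integration.integral_cong) (use r \<eta> in \<open>auto simp: indicator_def\<close>)
        also have "\<dots> = (LINT t|?U. indicator {1 - t..1} r * ?h t)"
        proof (rule integral_unit_interval_measure[symmetric])
          have "(\<lambda>t. indicator {1 - r..} t * ?h t) \<in> borel_measurable borel"
            by (rule borel_measurable_times[OF borel_measurable_indicator borel_measurable_continuous_onI[OF ch]]) auto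
          also have "(\<lambda>t. indicator {1 - r..} t * ?h t) = (\<lambda>t. indicator {1 - t..1} r * ?h t)"
            using r by (auto simp: indicator_def fun_eq_iff)
          finally show "(\<lambda>t. indicator {1 - t..1} r * ?h t) \<in> borel_measurable borel" .
        qed
        finally have "r ^ n1 * lam0 = (LINT t|?U. r ^ n1 * (indicator {1 - t..1} r * ?h t))" by simp
        also have "\<dots> = (LINT t|?U. indicator {1 - t..1} r * (\<eta> t * t) * (r ^ (2 * k + 1) * ?K ((1 + r\<^sup>2 - t\<^sup>2) / (2 * r))))"
          by (rule Bochner_Integration.integral_cong[OF refl]) (use r in \<open>simp add: n1_def\<close>)
        finally show ?thesis .
      qed
      have "(LINT \<omega>|sphere_measure. (LINT \<theta>|?S. of_real (\<eta> (norm (r *\<^sub>R \<omega> - \<theta>))) * f (r *\<^sub>R \<omega>) * q' \<theta>)) = (LINT \<omega>|sphere_measure. of_real (?A * lam0) * (f (r *\<^sub>R \<omega>) * q \<omega>))"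
        by (rule Bochner_Integration.integral_cong[OF refl]) (use inner in \<open>auto simp: space_sphere_measure\<close>)
      also have "\<dots> = of_real (?A * lam0) * ?\<phi>" by (rule integral_mult_right_zero)
      finally have "r ^ (DIM('a) - 1) *\<^sub>R (LINT \<omega>|sphere_measure. (LINT \<theta>|?S. of_real (\<eta> (norm (r *\<^sub>R \<omega> - \<theta>))) * f (r *\<^sub>R \<omega>) * q' \<theta>)) = of_real (?A * (r ^ n1 * lam0)) * ?\<phi>"
        unfolding n1 by (simp add: scaleR_conv_of_real mult_ac)
      also have "?A * (r ^ n1 * lam0) = (LINT t|?U. indicator {1 - t..1} r * (\<eta> t * t) * (?A * (r ^ (2 * k + 1) * ?K ((1 + r\<^sup>2 - t\<^sup>2) / (2 * r)))))"
        unfolding lam integral_mult_right_zero[symmetric] by (rule Bochner_Integration.integral_cong[OF refl]) (simp only: mult_ac)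
      also have "of_real \<dots> * ?\<phi> = (LINT t|?U. of_real (indicator {1 - t..1} r * (\<eta> t * t) * (?A * (r ^ (2 * k + 1) * ?K ((1 + r\<^sup>2 - t\<^sup>2) / (2 * r))))) * ?\<phi>)"
        by (simp only: integral_mult_left_zero integral_complex_of_real)
      finally show ?thesis .
    qed
    then show "indicator {0<..<1} r *\<^sub>R r ^ (DIM('a) - 1) *\<^sub>R (LINT \<omega>|sphere_measure. (LINT \<theta>|?S. of_real (\<eta> (norm (r *\<^sub>R \<omega> - \<theta>))) * f (r *\<^sub>R \<omega>) * q' \<theta>)) =
      indicator {0<..<1} r *\<^sub>R (LINT t|?U. of_real (indicator {1 - t..1} r * (\<eta> t * t) * (?A * (r ^ (2 * k + 1) * ?K ((1 + r\<^sup>2 - t\<^sup>2) / (2 * r))))) * ?\<phi>)"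
      by (auto simp: indicator_def)
  qed
  also have "\<dots> = (LINT t:{0<..<1}|lborel. of_real (\<eta> t) * (of_real (?A * t) *
        (LINT r:{1 - t..1}|lborel. of_real (r ^ (2 * k + 1) * ?K ((1 + r\<^sup>2 - t\<^sup>2) / (2 * r))) * (LINT \<omega>|sphere_measure. f (r *\<^sub>R \<omega>) * q \<omega>))))"
  proof -
    define \<phi> where "\<phi> r = (LINT \<omega>|?S. f (r *\<^sub>R \<omega>) * q' \<omega>)" for r
    have \<phi>: "(LINT \<omega>|sphere_measure. f (r *\<^sub>R \<omega>) * q \<omega>) = \<phi> r" for r unfolding \<phi>_def by (rule Sq) measurable
    have m\<phi> [measurable]: "\<phi> \<in> borel_measurable borel"
      unfolding \<phi>_def[abs_def] by (rule S.borel_measurable_lebesgue_integral) (simp add: split_beta, measurable)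
    have B\<phi>: "norm (\<phi> r) \<le> Bf * Bq * CS" for r
    proof -
      have *: "norm (f (r *\<^sub>R \<omega>) * q' \<omega>) \<le> Bf * Bq" for \<omega> unfolding norm_mult using Bf Bq by (intro mult_mono) auto
      have "norm (\<phi> r) \<le> (LINT \<omega>|?S. norm (f (r *\<^sub>R \<omega>) * q' \<omega>))" unfolding \<phi>_def by (rule integral_norm_bound)
      also have "\<dots> \<le> (LINT \<omega>|?S. Bf * Bq)"
        by (rule integral_mono) (use * in \<open>auto intro!: S.integrable_const_bound[where B="Bf * Bq"]\<close>)
      finally show ?thesis by (simp add: CS_def mult_ac)
    qed
    obtain BK where BK: "\<And>s. s \<in> {-1..1} \<Longrightarrow> \<bar>?K s\<bar> \<le> BK" "BK \<ge> 0"
    proof -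
      have "compact (?K ` {-1..1})" by (intro compact_continuous_image) (auto intro: continuous_at_imp_continuous_on poly_isCont)
      then obtain B where "\<And>s. s \<in> {-1..1} \<Longrightarrow> norm (?K s) \<le> B" by (metis compact_imp_bounded bounded_iff image_eqI)
      then show ?thesis using that[of "max 0 B"] by (auto simp: le_max_iff_disj)
    qed
    \<comment> \<open>One indicator of the pair describes the region of integration, which makes
      \<open>J\<close> jointly measurable and bounded on the plane; \<open>t ^ 1\<close> matches the
      form of \<open>tb\<close>.\<close>
    define J where "J r t = of_real (indicator {z. 1 - snd z \<le> fst z \<and> 0 < fst z \<and> fst z < 1 \<and> snd z < 1} (r, t) * (\<eta> t * t ^ 1) * (?A * (r ^ (2 * k + 1) * ?K ((1 + r\<^sup>2 - t\<^sup>2) / (2 * r))))) * \<phi> r" for r t :: real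
    have [measurable]: "?K \<in> borel_measurable borel"
      by (intro borel_measurable_continuous_onI) (auto intro: continuous_at_imp_continuous_on poly_isCont)
    have mJ: "(\<lambda>(r, t). J r t) \<in> borel_measurable (borel \<Otimes>\<^sub>M borel)"
      unfolding J_def split_beta by measurable
    have mJt: "(\<lambda>r. J r t) \<in> borel_measurable borel" for t
      using measurable_compose[OF measurable_Pair2'[of t borel borel] mJ] by simp
    have BJ: "norm (J r t) \<le> Bc * (\<bar>?A\<bar> * (1 * BK)) * (Bf * Bq * CS)" for r t
    proof (cases "1 - t \<le> r \<and> 0 < r \<and> r < 1 \<and> t < 1")
      case True
      \<comment> \<open>On the region the argument of the kernel is a cosine:
        \<open>1 - t \<le> r\<close> makes it at most 1 and \<open>t < 1\<close> makes it
        nonnegative.\<close>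
      have "(1 - r)\<^sup>2 \<le> t\<^sup>2" using True by (intro power_mono) auto
      then have 1: "(1 + r\<^sup>2 - t\<^sup>2) / (2 * r) \<le> 1" using True by (simp add: power2_eq_square algebra_simps)
      have "t\<^sup>2 \<le> 1" using True by (simp add: abs_square_le_1)
      then have "0 \<le> 1 + r\<^sup>2 - t\<^sup>2" using zero_le_power2[of r] by linarith
      then have "0 \<le> (1 + r\<^sup>2 - t\<^sup>2) / (2 * r)" using True by (intro divide_nonneg_pos) auto
      with 1 have K: "\<bar>?K ((1 + r\<^sup>2 - t\<^sup>2) / (2 * r))\<bar> \<le> BK" by (intro BK) auto
      have "\<bar>r\<bar> ^ (2 * k + 1) \<le> 1" using True by (intro power_le_one) auto
      with K tb[of t 1] show ?thesis
        unfolding J_def norm_mult norm_of_real abs_mult power_abs using True Bc Bf Bq CS BK(2) B\<phi>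
        by (intro mult_mono) (auto simp: abs_mult)
    next
      case False
      then have "J r t = 0" by (auto simp: J_def)
      then show ?thesis using Bc Bf Bq CS BK(2) by simp
    qed
    have ae: "AE r in lborel. r \<noteq> (1::real)" by (rule AE_lborel_singleton)
    have "(LINT r:{0<..<1}|lborel. LINT t|?U. of_real (indicator {1 - t..1} r * (\<eta> t * t) * (?A * (r ^ (2 * k + 1) * ?K ((1 + r\<^sup>2 - t\<^sup>2) / (2 * r))))) * \<phi> r)
       = (LINT r:{0<..<1}|lborel. LINT t|?U. J r t)"
      unfolding set_lebesgue_integral_def
    proof (rule Bochner_Integration.integral_cong[OF refl])
      fix r :: real
      have "of_real (indicator {1 - t..1} r * (\<eta> t * t) * (?A * (r ^ (2 * k + 1) * ?K ((1 + r\<^sup>2 - t\<^sup>2) / (2 * r))))) * \<phi> r = J r t" if "0 < r" "r < 1" for t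
        using that out1[of t] by (cases "t < 1") (auto simp: J_def indicator_def)
      then have *: "(LINT t|?U. of_real (indicator {1 - t..1} r * (\<eta> t * t) * (?A * (r ^ (2 * k + 1) * ?K ((1 + r\<^sup>2 - t\<^sup>2) / (2 * r))))) * \<phi> r) = (LINT t|?U. J r t)" if "0 < r" "r < 1"
        using that by (intro Bochner_Integration.integral_cong[OF refl])
      show "indicator {0<..<1} r *\<^sub>R (LINT t|?U. of_real (indicator {1 - t..1} r * (\<eta> t * t) * (?A * (r ^ (2 * k + 1) * ?K ((1 + r\<^sup>2 - t\<^sup>2) / (2 * r))))) * \<phi> r) = indicator {0<..<1} r *\<^sub>R (LINT t|?U. J r t)"
      proof (cases "0 < r \<and> r < 1")
        case True
        then show ?thesis by (simp only: *)
      next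
        case False
        then have "indicator {0<..<1} r = (0 :: real)" by auto
        then show ?thesis by (simp only: scaleR_zero_left)
      qed
    qed
    also have "\<dots> = (LINT r|?U. LINT t|?U. J r t)"
      by (rule integral_unit_interval_measure[symmetric], rule U.borel_measurable_lebesgue_integral) (use mJ in simp)
    also have "\<dots> = (LINT t|?U. LINT r|?U. J r t)"
      by (rule finite_measure_integral_swap[OF finite_measures_aux(1,1) _ BJ]) (use mJ in simp)
    also have "\<dots> = (LINT t:{0<..<1}|lborel. LINT r|?U. J r t)"
      by (rule integral_unit_interval_measure, rule U.borel_measurable_lebesgue_integral) (unfold J_def split_beta, measurable)
    also have "\<dots> = (LINT t:{0<..<1}|lborel. of_real (\<eta> t) * (of_real (?A * t) * (LINT r:{1 - t..1}|lborel. of_real (r ^ (2 * k + 1) * ?K ((1 + r\<^sup>2 - t\<^sup>2) / (2 * r))) * \<phi> r)))"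
      unfolding set_lebesgue_integral_def
    proof (rule Bochner_Integration.integral_cong[OF refl])
      fix t :: real
      have "(LINT r|?U. J r t) = of_real (\<eta> t) * (of_real (?A * t) * (LINT r|lborel. indicator {1 - t..1} r *\<^sub>R (of_real (r ^ (2 * k + 1) * ?K ((1 + r\<^sup>2 - t\<^sup>2) / (2 * r))) * \<phi> r)))" if t: "0 < t" "t < 1"
      proof -
        have "(LINT r|?U. J r t) = (LINT r:{0<..<1}|lborel. J r t)"
          by (rule integral_unit_interval_measure[OF mJt])
        also have "\<dots> = (LINT r|lborel. (of_real (\<eta> t) * of_real (?A * t)) * (indicator {1 - t..1} r *\<^sub>R (of_real (r ^ (2 * k + 1) * ?K ((1 + r\<^sup>2 - t\<^sup>2) / (2 * r))) * \<phi> r)))"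
          unfolding set_lebesgue_integral_def
        proof (rule integral_cong_AE)
          show "AE r in lborel. indicator {0<..<1} r *\<^sub>R J r t = (of_real (\<eta> t) * of_real (?A * t)) * (indicator {1 - t..1} r *\<^sub>R (of_real (r ^ (2 * k + 1) * ?K ((1 + r\<^sup>2 - t\<^sup>2) / (2 * r))) * \<phi> r))"
            using ae by eventually_elim (use t in \<open>auto simp: J_def indicator_def mult_ac\<close>)
          show "(\<lambda>r. indicator {0<..<1} r *\<^sub>R J r t) \<in> borel_measurable lborel"
            using mJt by (auto intro!: borel_measurable_scaleR borel_measurable_indicator)
          show "(\<lambda>r. (of_real (\<eta> t) * of_real (?A * t)) * (indicator {1 - t..1} r *\<^sub>R (of_real (r ^ (2 * k + 1) * ?K ((1 + r\<^sup>2 - t\<^sup>2) / (2 * r))) * \<phi> r))) \<in> borel_measurable lborel"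
            by measurable
        qed
        also have "\<dots> = (of_real (\<eta> t) * of_real (?A * t)) * (LINT r|lborel. indicator {1 - t..1} r *\<^sub>R (of_real (r ^ (2 * k + 1) * ?K ((1 + r\<^sup>2 - t\<^sup>2) / (2 * r))) * \<phi> r))"
          by (subst integral_mult_right_zero) (rule refl)
        finally show ?thesis by (simp only: mult.assoc)
      qed
      then show "indicator {0<..<1} t *\<^sub>R (LINT r|?U. J r t) = indicator {0<..<1} t *\<^sub>R (of_real (\<eta> t) * (of_real (?A * t) * (LINT r|lborel. indicator {1 - t..1} r *\<^sub>R (of_real (r ^ (2 * k + 1) * ?K ((1 + r\<^sup>2 - t\<^sup>2) / (2 * r))) * \<phi> r))))"
        by (auto simp: indicator_def)
    qed
    finally show ?thesis unfolding \<phi> .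
  qed
  finally show ?thesis .
qed

section \<open>Lagrange inversion and residues\<close>

unbundle no vec_syntax
unbundle fps_syntax

text \<open>Absence of a polar part. Regular series have residue 0 and may be dropped in residue
  computations.\<close>

definition fls_regular :: "'a::field fls \<Rightarrow> bool" where
  "fls_regular z \<longleftrightarrow> (\<exists>P. z = fps_to_fls P)"

lemma fls_regular_fps [intro, simp]: "fls_regular (fps_to_fls P)"
  by (auto simp: fls_regular_def)

lemma fls_regular_add: "fls_regular x \<Longrightarrow> fls_regular y \<Longrightarrow> fls_regular (x + y)"
  unfolding fls_regular_def by (metis fps_to_fls_plus)

lemma fls_regular_mult: "fls_regular x \<Longrightarrow> fls_regular y \<Longrightarrow> fls_regular (x * y)"
  unfolding fls_regular_def by (metis fls_times_fps_to_fls)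

lemma fls_regular_const: "fls_regular (fls_const c)"
  unfolding fls_regular_def by (metis fps_const_to_fls)

lemma fls_regular_uminus: "fls_regular x \<Longrightarrow> fls_regular (- x)"
  using fls_regular_mult[OF fls_regular_const[of "-1"], of x] by simp

lemma fls_regular_of_nat: "fls_regular (of_nat n)"
  using fls_regular_const[of "of_nat n"] by (simp add: fls_of_nat)

lemma fls_regular_power: "fls_regular x \<Longrightarrow> fls_regular (x ^ n)"
  by (auto simp: fls_regular_def simp flip: fps_to_fls_power)

lemma fls_regular_sum: "(\<And>i. i \<in> A \<Longrightarrow> fls_regular (f i)) \<Longrightarrow> fls_regular (\<Sum>i\<in>A. f i)"
proof (induction A rule: infinite_finite_induct)
  case (insert x F) then show ?case by (simp add: fls_regular_add)
qed (use fls_regular_const[of 0] in auto)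

lemma fls_inverse_fps:
  fixes P :: "'a::field fps"
  assumes "P $ 0 \<noteq> 0"
  shows "inverse (fps_to_fls P) = fps_to_fls (inverse P)"
proof -
  have "fps_to_fls P * fps_to_fls (inverse P) = 1"
    using inverse_mult_eq_1'[OF assms] by (simp flip: fls_times_fps_to_fls)
  then show ?thesis by (rule inverse_unique)
qed

lemma fls_regular_residue: "fls_regular x \<Longrightarrow> x $$ -1 = 0"
  by (auto simp: fls_regular_def)

text \<open>Lagrange inversion: \<open>q\<close>-fold differentiation with respect to \<open>H\<close> is a residue, by integration by parts.\<close>

lemma iterated_deriv_residue:
  fixes H e P :: "complex fps"
  assumes H0: "H $ 0 = 0" and e: "e * fps_deriv H = 1"
  shows "((\<lambda>P. fps_deriv P * e) ^^ q) P $ 0 =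
    fact q * (fps_to_fls P * fps_to_fls (fps_deriv H) * inverse (fps_to_fls H) ^ Suc q) $$ -1"
proof (induction q arbitrary: P)
  case 0
  \<comment> \<open>The zero of \<open>H\<close> is simple: \<open>e * fps_deriv H = 1\<close>
    forces the linear coefficient to be nonzero, so \<open>U\<close> is a unit.\<close>
  define U where "U = fps_shift 1 H"
  have HU: "H = fps_X * U" using H0 by (intro fps_ext) (simp add: U_def)
  have "e $ 0 * fps_deriv H $ 0 = 1" using arg_cong[OF e, of "\<lambda>f. f $ 0"] by simp
  then have "U $ 0 \<noteq> 0" by (auto simp: U_def)
  then have invU: "inverse (fps_to_fls U) = fps_to_fls (inverse U)" by (rule fls_inverse_fps)
  have H: "fps_to_fls H \<noteq> 0" "fps_to_fls H = fls_X * fps_to_fls U" "fls_X \<noteq> (0 :: complex fls)"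
    using \<open>U $ 0 \<noteq> 0\<close> by (auto simp: HU fls_times_fps_to_fls)
  have "fls_subdegree (fps_to_fls H) = 1"
    using \<open>U $ 0 \<noteq> 0\<close> unfolding H(2) by (subst fls_subdegree_mult) (auto simp: fls_subdegree_fls_to_fps subdegree_eq_0_iff)
  with fls_residue_deriv_times_inverse_eq_subdegree(1)[of "fps_to_fls H"]
  have 1: "(fps_to_fls (fps_deriv H) * inverse (fps_to_fls H)) $$ -1 = 1"
    by (simp add: fls_deriv_fps_to_fls)
  define Q where "Q = fps_shift 1 P"
  have PQ: "P = fps_const (P $ 0) + fps_X * Q" by (intro fps_ext) (simp add: Q_def)
  \<comment> \<open>Only the constant term of \<open>P\<close> meets the simple pole of H'/H, whose
    residue is 1; the remainder is regular.\<close>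
  have "fps_to_fls P * fps_to_fls (fps_deriv H) * inverse (fps_to_fls H) =
     fls_const (P $ 0) * (fps_to_fls (fps_deriv H) * inverse (fps_to_fls H)) + fps_to_fls (Q * fps_deriv H * inverse U)"
  proof -
    have gen: "(c + X * Q) * D * inverse (X * V) = c * (D * inverse (X * V)) + Q * D * inverse V" if "X \<noteq> 0" for c X Q D V :: "complex fls"
    proof -
      have "(c + X * Q) * D * inverse (X * V) = c * (D * inverse (X * V)) + (X * inverse X) * (Q * D * inverse V)"
        by (simp only: inverse_mult_distrib distrib_right distrib_left mult_ac)
      with that show ?thesis by simp
    qed
    have "fps_to_fls P = fls_const (P $ 0) + fls_X * fps_to_fls Q"
      by (subst PQ) (simp add: fls_times_fps_to_fls)
    then show ?thesis unfolding H(2) by (simp only: gen[OF H(3)] fls_times_fps_to_fls invU)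
  qed
  then show ?case using 1 by (simp add: fls_residue_fls_const_times)
next
  case (Suc q)
  let ?f = "fps_to_fls" and ?E = "\<lambda>P. fps_deriv P * e"
  let ?G = "inverse (?f H)"
  have H: "?f H \<noteq> 0" using e by (auto simp: fps_to_fls_eq_0_iff)
  have G': "fls_deriv ?G = - ?f (fps_deriv H) * ?G\<^sup>2"
    by (simp add: fls_inverse_deriv fls_deriv_fps_to_fls)
  have "fls_deriv (?G ^ Suc q) = of_nat (Suc q) * ?G ^ q * fls_deriv ?G"
    by (simp add: fls_deriv_power mult_ac del: power_Suc)
  also have "\<dots> = - of_nat (Suc q) * (?f (fps_deriv H) * ?G ^ Suc (Suc q))"
    unfolding G' by (simp add: power2_eq_square algebra_simps)
  finally have Gq: "fls_deriv (?G ^ Suc q) = - of_nat (Suc q) * (?f (fps_deriv H) * ?G ^ Suc (Suc q))" .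
  have "(?E ^^ Suc q) P $ 0 = (?E ^^ q) (?E P) $ 0" by (simp only: funpow_Suc_right comp_apply)
  also have "\<dots> = fact q * (?f (?E P) * ?f (fps_deriv H) * ?G ^ Suc q) $$ -1" by (rule Suc.IH)
  also have "?f (?E P) * ?f (fps_deriv H) = ?f (fps_deriv P)"
    using e by (simp flip: fls_times_fps_to_fls add: mult.assoc)
  \<comment> \<open>A derivative has residue 0, so differentiation moves from \<open>P\<close> to
    the power of 1/H and raises the order of the pole by one.\<close>
  also have "(?f (fps_deriv P) * ?G ^ Suc q) $$ -1 = - (?f P * fls_deriv (?G ^ Suc q)) $$ -1"
    using fls_residue_times_deriv[of "?f P" "?G ^ Suc q"] by (simp add: fls_deriv_fps_to_fls)
  also have "\<dots> = (of_nat (Suc q) * (?f P * ?f (fps_deriv H) * ?G ^ Suc (Suc q))) $$ -1"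
    unfolding Gq by (rule arg_cong[where f="\<lambda>x. x $$ -1"]) (simp add: algebra_simps)
  also have "\<dots> = of_nat (Suc q) * (?f P * ?f (fps_deriv H) * ?G ^ Suc (Suc q)) $$ -1"
    using fls_residue_of_int_times(1)[of "int (Suc q)"] by simp
  finally show ?case by (simp add: mult_ac del: power_Suc of_nat_Suc)
qed

section \<open>The partial fraction identity of Chaundy and Bullard\<close>

lemma chaundy_bullard_aux:
  fixes b :: "'a::comm_ring_1"
  shows "(1 - b) * (\<Sum>l\<le>M. of_nat (Suc K + l choose l) * b ^ l) =
    (\<Sum>l\<le>M. of_nat (K + l choose l) * b ^ l) - of_nat (Suc K + M choose M) * b ^ Suc M"
proof (induction M)
  case (Suc M)
  have "(Suc K + Suc M choose Suc M) = (K + Suc M choose Suc M) + (Suc K + M choose M)"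
    by simp
  then have *: "(of_nat (Suc K + Suc M choose Suc M) :: 'a) = of_nat (K + Suc M choose Suc M) + of_nat (Suc K + M choose M)"
    by (metis of_nat_add)
  show ?case
    unfolding sum.atMost_Suc distrib_left Suc.IH * by (simp add: algebra_simps)
qed simp

text \<open>Divided by (a b)^(N+1) this is a partial fraction decomposition; the sums are the
  binomial series of (1 - b)^(-N-1) and (1 - a)^(-N-1), truncated after degree N.\<close>

lemma chaundy_bullard:
  fixes a b :: "'a::comm_ring_1"
  assumes "a + b = 1"
  shows "a ^ Suc N * (\<Sum>l\<le>N. of_nat (N + l choose l) * b ^ l) + b ^ Suc N * (\<Sum>l\<le>N. of_nat (N + l choose l) * a ^ l) = 1"
proof (induction N)
  case 0 then show ?case using assms by simp
next
  case (Suc N)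
  define c where "c = (of_nat (N + Suc N choose Suc N) :: 'a)"
  have "(Suc N + Suc N choose Suc N) = 2 * (N + Suc N choose Suc N)"
  proof -
    have "(Suc N + Suc N choose Suc N) = (N + Suc N choose Suc N) + (N + Suc N choose N)" by simp
    also have "(N + Suc N choose N) = (N + Suc N choose Suc N)"
      using binomial_symmetric[of N "N + Suc N"] by simp
    finally show ?thesis by simp
  qed
  then have c2: "(of_nat (Suc N + Suc N choose Suc N) :: 'a) = 2 * c"
    unfolding c_def by (metis of_nat_mult of_nat_numeral)
  \<comment> \<open>Raising N by one leaves a central binomial term in each of the two sums; these
    cancel, since 1 - 2b = a - b = -(1 - 2a).\<close>
  have step: "(1 - x) * (\<Sum>l\<le>Suc N. of_nat (Suc N + l choose l) * x ^ l) = (\<Sum>l\<le>N. of_nat (N + l choose l) * x ^ l) + c * x ^ Suc N * (1 - 2 * x)" for x :: 'a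
    unfolding chaundy_bullard_aux c2 unfolding sum.atMost_Suc c_def[symmetric] by (simp add: algebra_simps)
  have ab: "1 - b = a" "1 - a = b" "1 - 2 * b = a - b" "1 - 2 * a = b - a" using assms by (auto simp: algebra_simps)
  have "a ^ Suc (Suc N) * (\<Sum>l\<le>Suc N. of_nat (Suc N + l choose l) * b ^ l) + b ^ Suc (Suc N) * (\<Sum>l\<le>Suc N. of_nat (Suc N + l choose l) * a ^ l)
    = a ^ Suc N * ((1 - b) * (\<Sum>l\<le>Suc N. of_nat (Suc N + l choose l) * b ^ l)) + b ^ Suc N * ((1 - a) * (\<Sum>l\<le>Suc N. of_nat (Suc N + l choose l) * a ^ l))"
    unfolding ab by (simp only: power_Suc mult_ac)
  also have "\<dots> = a ^ Suc N * (\<Sum>l\<le>N. of_nat (N + l choose l) * b ^ l) + b ^ Suc N * (\<Sum>l\<le>N. of_nat (N + l choose l) * a ^ l)"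
    unfolding step unfolding ab by (simp add: algebra_simps)
  finally show ?case using Suc by simp
qed

text \<open>The identity for a = (x - y)/x and b = y/x. In the application \<open>y\<close> vanishes
  at the base point and \<open>x - y\<close> does not, so the subtracted sum is regular.\<close>

lemma chaundy_bullard_field:
  fixes x y :: "'a::field"
  assumes "x \<noteq> 0" "y \<noteq> 0" "x - y \<noteq> 0"
  shows "(\<Sum>q\<le>N. of_nat (2 * N - q choose N) * x ^ q * inverse y ^ Suc q) =
     x ^ (2 * N + 1) * inverse (y * (x - y)) ^ Suc N
     - (\<Sum>l\<le>N. of_nat (N + l choose N) * x ^ (N - l) * (x - y) ^ l * inverse (x - y) ^ Suc N)"
proof -
  let ?a = "(x - y) / x" and ?b = "y / x"
  have ab: "?a + ?b = 1" using assms by (simp add: field_simps)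
  have ch: "(N + l choose l) = (N + l choose N)" for l using binomial_symmetric[of l "N + l"] by simp
  have S: "(\<Sum>l\<le>N. of_nat (N + l choose l) * (z / x) ^ l) = (\<Sum>l\<le>N. of_nat (N + l choose N) * x ^ (N - l) * z ^ l) / x ^ N" for z
    unfolding sum_divide_distrib
  proof (rule sum.cong[OF refl])
    fix l assume "l \<in> {..N}"
    then have "x ^ N = x ^ l * x ^ (N - l)" by (simp flip: power_add)
    then show "of_nat (N + l choose l) * (z / x) ^ l = of_nat (N + l choose N) * x ^ (N - l) * z ^ l / x ^ N"
      unfolding ch power_divide using assms(1) by simp
  qed
  let ?A = "\<Sum>l\<le>N. of_nat (N + l choose N) * x ^ (N - l) * y ^ l" and ?B = "\<Sum>l\<le>N. of_nat (N + l choose N) * x ^ (N - l) * (x - y) ^ l"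
  from chaundy_bullard[OF ab, of N] have "((x - y) ^ Suc N * ?A + y ^ Suc N * ?B) / (x ^ Suc N * x ^ N) = 1"
    unfolding S unfolding power_divide times_divide_times_eq add_divide_distrib .
  then have "(x - y) ^ Suc N * ?A + y ^ Suc N * ?B = x ^ Suc N * x ^ N"
    using assms(1) by (simp add: divide_eq_1_iff del: power_Suc)
  also have "\<dots> = x ^ (2 * N + 1)" by (simp add: mult_2 power_add)
  finally have "x ^ (2 * N + 1) * inverse (y * (x - y)) ^ Suc N = ?A / y ^ Suc N + ?B / (x - y) ^ Suc N"
  proof -
    assume *: "(x - y) ^ Suc N * ?A + y ^ Suc N * ?B = x ^ (2 * N + 1)"
    have gen: "(v * A + u * B) * inverse (u * v) = A / u + B / v" if "u \<noteq> 0" "v \<noteq> 0" for u v A B :: 'a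
      using that by (simp add: field_simps)
    show ?thesis unfolding *[symmetric] power_inverse power_mult_distrib
      by (rule gen) (use assms(2,3) in auto)
  qed
  moreover have "?A / y ^ Suc N = (\<Sum>q\<le>N. of_nat (2 * N - q choose N) * x ^ q * inverse y ^ Suc q)"
  proof -
    have "?A / y ^ Suc N = (\<Sum>q\<le>N. of_nat (N + (N - q) choose N) * x ^ (N - (N - q)) * y ^ (N - q) / y ^ Suc N)"
      unfolding sum_divide_distrib by (rule sum.nat_diff_reindex[of _ "Suc N", simplified lessThan_Suc_atMost, simplified, symmetric])
    also have "\<dots> = (\<Sum>q\<le>N. of_nat (2 * N - q choose N) * x ^ q * inverse y ^ Suc q)"
    proof (rule sum.cong[OF refl])
      fix q assume "q \<in> {..N}"
      then obtain d where d: "N = q + d" using le_Suc_ex by auto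
      show "of_nat (N + (N - q) choose N) * x ^ (N - (N - q)) * y ^ (N - q) / y ^ Suc N = of_nat (2 * N - q choose N) * x ^ q * inverse y ^ Suc q"
      proof -
        have e: "N + (N - q) = 2 * N - q" "N - (N - q) = q" "y ^ Suc N = y ^ (N - q) * y ^ Suc q"
          by (simp_all add: d add.commute flip: power_add)
        show ?thesis unfolding e power_inverse using assms(2) by (simp add: field_simps del: power_Suc)
      qed
    qed
    finally show ?thesis .
  qed
  moreover have "?B / (x - y) ^ Suc N = (\<Sum>l\<le>N. of_nat (N + l choose N) * x ^ (N - l) * (x - y) ^ l * inverse (x - y) ^ Suc N)"
    unfolding sum_divide_distrib by (simp add: divide_inverse power_inverse del: power_Suc)
  ultimately show ?thesis by simp
qed

text \<open>The numerical coefficient of D^q in \<open>L_op N\<close>, multiplied by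
  \<open>2 ^ N * fact N\<close> to clear denominators.\<close>

definition lop_coeff :: "nat \<Rightarrow> nat \<Rightarrow> real" where
  "lop_coeff N q = 2 ^ q * fact (2 * N - q) * real (N choose q)"

text \<open>The factor q! of the residue formula leaves exactly the binomial coefficient of the
  partial fraction identity.\<close>

lemma lop_coeff_fact:
  assumes "q \<le> N"
  shows "lop_coeff N q * fact q = (fact N)\<^sup>2 * (2 ^ q * real (2 * N - q choose N))"
proof -
  obtain d where d: "N = q + d" using assms le_Suc_ex by auto
  have "real (N choose q) = fact N / (fact q * fact d)" by (simp add: d binomial_fact)
  moreover have "real (2 * N - q choose N) = fact (2 * N - q) / (fact N * fact d)" by (simp add: d binomial_fact)
  ultimately show ?thesis by (simp add: lop_coeff_def power2_eq_square)
qed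

text \<open>Both sides are the residue of \<open>\<phi>(t)\<close> times the \<open>2N + 1\<close>-st power of \<open>4 t\<^sub>0 (1 - t)\<close> divided by the
  \<open>N + 1\<close>-st power of the product of \<open>t + t\<^sub>0\<close>, \<open>t - t\<^sub>0\<close>, \<open>2 - t - t\<^sub>0\<close> and \<open>2 - t + t\<^sub>0\<close>.\<close>

lemma iterated_deriv_identity_fps:
  fixes \<phi> :: "complex fps" and t0 :: complex
  assumes t0: "t0 \<noteq> 0" "t0 \<noteq> 1"
  defines "T \<equiv> fps_const t0 + fps_X"
  defines "R \<equiv> 1 - T"
  shows "t0 ^ (2 * N + 1) * (\<Sum>q\<le>N. (-1) ^ q * of_real (lop_coeff N q) * ((\<lambda>P. fps_deriv P * inverse T) ^^ q) (\<phi> * R ^ q * inverse T) $ 0)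
       = (\<Sum>q\<le>N. of_real (lop_coeff N q) * t0 ^ q * ((\<lambda>P. fps_deriv P * (- inverse R)) ^^ q) (R ^ (2 * N) * \<phi>) $ 0)"
proof -
  let ?f = "fps_to_fls :: complex fps \<Rightarrow> complex fls"
  have T0: "T $ 0 \<noteq> 0" and R0: "R $ 0 \<noteq> 0" using t0 by (auto simp: T_def R_def)
  \<comment> \<open>\<open>H1\<close> and \<open>H2\<close> vanish at the base point and have
    derivatives \<open>T\<close> and \<open>- R\<close>. Differentiation with respect to them is
    therefore D in the variables t and 1 - t.\<close>
  define H1 where "H1 = fps_const (1 / 2) * (T\<^sup>2 - fps_const (t0\<^sup>2))"
  define H2 where "H2 = fps_const (1 / 2) * (R\<^sup>2 - fps_const ((1 - t0)\<^sup>2))"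
  have half: "fps_const (1 / 2) * (2 * P) = P" for P :: "complex fps"
  proof -
    have "fps_const (1 / 2) * (2 :: complex fps) = fps_const (1 / 2) * fps_const 2" by (simp only: numeral_fps_const)
    also have "\<dots> = 1" by simp
    finally show ?thesis by (simp flip: mult.assoc)
  qed
  have dT: "fps_deriv T = 1" and dR: "fps_deriv R = -1" by (simp_all add: T_def R_def)
  have d1: "fps_deriv H1 = T" unfolding H1_def by (simp add: fps_deriv_power dT half power2_eq_square mult_2[symmetric])
  have d2: "fps_deriv H2 = - R" 
  proof -
    have "fps_deriv (R\<^sup>2 - fps_const ((1 - t0)\<^sup>2)) = 2 * (- R)" by (simp add: dR power2_eq_square)
    then have "fps_deriv H2 = fps_const (1 / 2) * (2 * (- R))" by (simp only: H2_def fps_deriv_mult_const_left)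
    then show ?thesis by (simp only: half)
  qed
  have e1: "inverse T * fps_deriv H1 = 1" "H1 $ 0 = 0"
    using T0 by (simp_all add: d1 inverse_mult_eq_1) (simp add: H1_def T_def power2_eq_square)
  have e2: "(- inverse R) * fps_deriv H2 = 1" "H2 $ 0 = 0"
    using R0 by (simp_all add: d2 inverse_mult_eq_1) (simp add: H2_def R_def T_def power2_eq_square)
  define \<tau> \<rho> c where "\<tau> = ?f T" and "\<rho> = ?f R" and "c = ?f (fps_const t0)"
  have cc: "c = fls_const t0" by (simp add: c_def)
  have \<rho>: "\<rho> = 1 - \<tau>" by (simp add: \<rho>_def \<tau>_def R_def)
  \<comment> \<open>Here y1 = (t - t0)(t + t0), and \<open>x1\<close> is chosen to make x1 - y1 =
    (t0 + t - 2)(t0 + 2 - t). The products y2 and x2 - y2 regroup the same four linear factors, up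
    to signs that cancel.\<close>
  define y1 x1 y2 x2 where "y1 = \<tau>\<^sup>2 - c\<^sup>2" and "x1 = - 4 * \<rho>" and "y2 = \<rho>\<^sup>2 - (1 - c)\<^sup>2" and "x2 = 4 * c"
  have y1: "y1 = 2 * ?f H1" and y2: "y2 = 2 * ?f H2"
  proof -
    have two: "2 * ?f P = ?f (2 * P)" for P by (simp add: fls_times_fps_to_fls)
    have "2 * H1 = T\<^sup>2 - fps_const (t0\<^sup>2)"
      unfolding H1_def by (subst mult.left_commute) (rule half)
    then show "y1 = 2 * ?f H1" unfolding two by (simp add: y1_def \<tau>_def c_def fps_to_fls_power fls_const_power)
    have "1 - fps_const t0 = fps_const (1 - t0)" by (metis fps_const_1_eq_1 fps_const_sub)
    then have *: "fps_const ((1 - t0)\<^sup>2) = (1 - fps_const t0)\<^sup>2" by (simp only: fps_const_power)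
    have "2 * H2 = R\<^sup>2 - fps_const ((1 - t0)\<^sup>2)"
      unfolding H2_def by (subst mult.left_commute) (rule half)
    then show "y2 = 2 * ?f H2" unfolding two * by (simp add: y2_def \<rho>_def c_def fps_to_fls_power)
  qed
  have nz: "y1 \<noteq> 0" "y2 \<noteq> 0" using e1 e2 by (auto simp: y1 y2)
  have "(4 * fps_const t0) $ 0 = 4 * t0" "((-4) * R) $ 0 = -4 * (1 - t0)"
    by (simp_all add: R_def T_def numeral_fps_const)
  then have P0: "(- 4 * R - 2 * H1) $ 0 \<noteq> 0" "(4 * fps_const t0 - 2 * H2) $ 0 \<noteq> 0"
    using t0 e1(2) e2(2) by (simp_all add: numeral_fps_const)
  have xy: "x1 - y1 = ?f (- 4 * R - 2 * H1)" "x2 - y2 = ?f (4 * fps_const t0 - 2 * H2)"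
    unfolding x1_def x2_def y1 y2 \<rho>_def c_def by (simp_all add: fls_times_fps_to_fls)
  have xnz: "x1 \<noteq> 0" "x2 \<noteq> 0" "x1 - y1 \<noteq> 0" "x2 - y2 \<noteq> 0"
  proof -
    have f0: "?f P \<noteq> 0" if "P $ 0 \<noteq> 0" for P using that by (metis fps_to_fls_eq_0_iff fps_zero_nth)
    show "x1 \<noteq> 0" "x2 \<noteq> 0" using t0 f0[OF R0] by (simp_all add: x1_def x2_def \<rho>_def cc)
    show "x1 - y1 \<noteq> 0" "x2 - y2 \<noteq> 0" unfolding xy by (rule f0, rule P0)+
  qed
  have reg: "fls_regular (\<Sum>l\<le>N. of_nat (N + l choose N) * x ^ (N - l) * (x - y) ^ l * inverse (x - y) ^ Suc N)"
    if "fls_regular x" "x - y = ?f P" "P $ 0 \<noteq> 0" for x y P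
    unfolding that(2) fls_inverse_fps[OF that(3)]
    by (intro fls_regular_sum fls_regular_mult fls_regular_power fls_regular_of_nat fls_regular_fps that(1))
  have regx: "fls_regular x1" "fls_regular x2" "fls_regular c" "fls_regular \<rho>"
    using fls_regular_mult[OF fls_regular_of_nat[of 4], of c]
      fls_regular_uminus[OF fls_regular_mult[OF fls_regular_of_nat[of 4], of \<rho>]]
    by (simp_all add: x1_def x2_def c_def \<rho>_def del: fps_const_to_fls)
  define S1 where "S1 = (\<Sum>q\<le>N. of_nat (2 * N - q choose N) * x1 ^ q * inverse y1 ^ Suc q)"
  define S2 where "S2 = (\<Sum>q\<le>N. of_nat (2 * N - q choose N) * x2 ^ q * inverse y2 ^ Suc q)"
  have w: "y1 * (x1 - y1) = y2 * (x2 - y2)"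
    unfolding y1_def x1_def y2_def x2_def \<rho> by (simp add: power2_eq_square algebra_simps)
  \<comment> \<open>The exponent is odd and c x1 = - rho x2; this is what makes the two terms with
    the common denominator cancel.\<close>
  define M where "M = 2 * N + 1"
  have "c ^ M * x1 ^ M = (-1) ^ M * (\<rho> * x2) ^ M"
    unfolding power_mult_distrib[symmetric] x1_def x2_def by (simp add: mult_ac)
  then have cx: "c ^ M * x1 ^ M + \<rho> ^ M * x2 ^ M = 0" by (simp add: M_def power_mult_distrib)
  have "\<exists>z1 z2. fls_regular z1 \<and> fls_regular z2 \<and> S1 = x1 ^ M * inverse (y1 * (x1 - y1)) ^ Suc N - z1 \<and> S2 = x2 ^ M * inverse (y1 * (x1 - y1)) ^ Suc N - z2"
    unfolding S1_def S2_def M_def chaundy_bullard_field[OF xnz(1) nz(1) xnz(3)]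
    unfolding w chaundy_bullard_field[OF xnz(2) nz(2) xnz(4)]
    using reg[OF regx(1) xy(1) P0(1)] reg[OF regx(2) xy(2) P0(2)] by blast
  then obtain z1 z2 where z: "fls_regular z1" "fls_regular z2" and S: "S1 = x1 ^ M * inverse (y1 * (x1 - y1)) ^ Suc N - z1"
    "S2 = x2 ^ M * inverse (y1 * (x1 - y1)) ^ Suc N - z2" by blast
  have "c ^ M * S1 + \<rho> ^ M * S2 = (c ^ M * x1 ^ M + \<rho> ^ M * x2 ^ M) * inverse (y1 * (x1 - y1)) ^ Suc N + - (c ^ M * z1 + \<rho> ^ M * z2)"
    unfolding S by (simp add: algebra_simps)
  then have CS: "c ^ M * S1 + \<rho> ^ M * S2 = - (c ^ M * z1 + \<rho> ^ M * z2)" unfolding cx by simp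
  have "fls_regular (?f \<phi> * (c ^ M * S1 + \<rho> ^ M * S2))"
    unfolding CS by (intro fls_regular_mult fls_regular_uminus fls_regular_add fls_regular_power fls_regular_fps z regx)
  then have res0: "(?f \<phi> * (c ^ M * S1)) $$ -1 + (?f \<phi> * (\<rho> ^ M * S2)) $$ -1 = 0"
    using fls_regular_residue by (fastforce simp: distrib_left)
  have sumres: "(\<Sum>q\<le>N. a q * (z q) $$ -1) = (\<Sum>q\<le>N. fls_const (a q) * z q) $$ -1" for a and z :: "nat \<Rightarrow> complex fls"
  proof -
    have "(\<Sum>q\<in>A. a q * (z q) $$ -1) = (\<Sum>q\<in>A. fls_const (a q) * z q) $$ -1" if "finite A" for A
      using that by (induction A) (auto simp: fls_residue_fls_const_times)
    then show ?thesis by simp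
  qed
  have cN: "of_real (lop_coeff N q) * fact q = (2 * (fact N)\<^sup>2) * (of_nat (2 * N - q choose N) * (2 ^ q / 2) :: complex)" if "q \<le> N" for q
    using arg_cong[OF lop_coeff_fact[OF that], of complex_of_real] by simp
  have fc: "fls_const (of_nat j) = (of_nat j :: complex fls)" for j by (simp add: fls_of_nat)
  have Linv: "inverse y1 ^ Suc q = fls_const (1 / 2) ^ Suc q * inverse (?f H1) ^ Suc q" "inverse y2 ^ Suc q = fls_const (1 / 2) ^ Suc q * inverse (?f H2) ^ Suc q" for q
  proof -
    have i2: "inverse (2 :: complex fls) = fls_const (1 / 2)"
      by (metis fls_const_numeral fls_inverse_const inverse_eq_divide)
    show "inverse y1 ^ Suc q = fls_const (1 / 2) ^ Suc q * inverse (?f H1) ^ Suc q" "inverse y2 ^ Suc q = fls_const (1 / 2) ^ Suc q * inverse (?f H2) ^ Suc q"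
      unfolding y1 y2 inverse_mult_distrib power_mult_distrib i2 by (rule refl)+
  qed
  have reassoc: "n * d * (p * r * g) = p * (n * x * (u * g))" if "x * u = d * r" for n d p r g x u :: "complex fls"
  proof -
    have "p * (n * x * (u * g)) = n * p * g * (x * u)" by (simp only: mult_ac)
    then show ?thesis unfolding that by (simp only: mult_ac)
  qed
  have reassoc': "n * d * (p * r * g) = p * (r * (n * x * (u * g)))" if "x * u = d" for n d p r g x u :: "complex fls"
    unfolding that[symmetric] by (simp only: mult_ac)
  \<comment> \<open>The factor \<open>inverse T\<close> cancels the derivative of \<open>H1\<close>,
    so the residue formula leaves phi R^q / H1^(q+1). With x1 = -4 R and y1 = 2 H1 the terms add up
    to \<open>S1\<close>.\<close>
  have L: "t0 ^ M * (\<Sum>q\<le>N. (-1) ^ q * of_real (lop_coeff N q) * ((\<lambda>P. fps_deriv P * inverse T) ^^ q) (\<phi> * R ^ q * inverse T) $ 0)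
     = (2 * (fact N)\<^sup>2) * (?f \<phi> * (c ^ M * S1)) $$ -1"
  proof -
    have "(-1) ^ q * of_real (lop_coeff N q) * ((\<lambda>P. fps_deriv P * inverse T) ^^ q) (\<phi> * R ^ q * inverse T) $ 0
      = (2 * (fact N)\<^sup>2) * ((of_nat (2 * N - q choose N) * ((-2) ^ q / 2)) * (?f \<phi> * \<rho> ^ q * inverse (?f H1) ^ Suc q) $$ -1)" if "q \<le> N" for q
    proof -
      have "?f (\<phi> * R ^ q * inverse T) * ?f (fps_deriv H1) = ?f \<phi> * \<rho> ^ q"
        using e1(1) by (simp add: \<rho>_def mult.assoc flip: fls_times_fps_to_fls fps_to_fls_power)
      then have "((\<lambda>P. fps_deriv P * inverse T) ^^ q) (\<phi> * R ^ q * inverse T) $ 0 = fact q * (?f \<phi> * \<rho> ^ q * inverse (?f H1) ^ Suc q) $$ -1"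
        unfolding iterated_deriv_residue[OF e1(2) e1(1)] by simp
      then have "(-1) ^ q * of_real (lop_coeff N q) * ((\<lambda>P. fps_deriv P * inverse T) ^^ q) (\<phi> * R ^ q * inverse T) $ 0
        = (-1) ^ q * (of_real (lop_coeff N q) * fact q) * (?f \<phi> * \<rho> ^ q * inverse (?f H1) ^ Suc q) $$ -1" by (simp only: mult_ac)
      also have "\<dots> = (2 * (fact N)\<^sup>2) * ((of_nat (2 * N - q choose N) * ((-1) ^ q * 2 ^ q / 2)) * (?f \<phi> * \<rho> ^ q * inverse (?f H1) ^ Suc q) $$ -1)"
        unfolding cN[OF that] by (simp add: mult_ac del: power_Suc)
      also have "(-1) ^ q * 2 ^ q = ((-2) ^ q :: complex)" by (simp flip: power_mult_distrib)
      finally show ?thesis .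
    qed
    then have "(\<Sum>q\<le>N. (-1) ^ q * of_real (lop_coeff N q) * ((\<lambda>P. fps_deriv P * inverse T) ^^ q) (\<phi> * R ^ q * inverse T) $ 0)
      = (2 * (fact N)\<^sup>2) * (\<Sum>q\<le>N. (of_nat (2 * N - q choose N) * ((-2) ^ q / 2)) * (?f \<phi> * \<rho> ^ q * inverse (?f H1) ^ Suc q) $$ -1)"
      by (simp add: sum_distrib_left del: power_Suc)
    also have "(\<Sum>q\<le>N. (of_nat (2 * N - q choose N) * ((-2) ^ q / 2)) * (?f \<phi> * \<rho> ^ q * inverse (?f H1) ^ Suc q) $$ -1) = (?f \<phi> * S1) $$ -1"
      unfolding sumres S1_def sum_distrib_left
    proof (rule arg_cong[where f="\<lambda>x. x $$ -1"], rule sum.cong[OF refl])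
      fix q
      have "x1 ^ q * fls_const (1 / 2) ^ Suc q = fls_const ((-2) ^ q / 2) * \<rho> ^ q"
      proof -
        have "x1 = fls_const (-4) * \<rho>" by (simp add: x1_def flip: fls_const_numeral)
        then have "x1 ^ q * fls_const (1 / 2) ^ Suc q = (fls_const (-4) ^ q * fls_const (1 / 2) ^ Suc q) * \<rho> ^ q"
          by (simp only: power_mult_distrib mult_ac)
        also have "\<dots> = fls_const ((-4) ^ q * (1 / 2) ^ Suc q) * \<rho> ^ q"
          by (simp only: fls_const_power[symmetric] fls_const_mult_const)
        also have "(-4) ^ q * (1 / 2) ^ Suc q = ((-2) ^ q / 2 :: complex)"
          by (simp flip: power_mult_distrib)
        finally show ?thesis .
      qed
      then show "fls_const (of_nat (2 * N - q choose N) * ((-2) ^ q / 2)) * (?f \<phi> * \<rho> ^ q * inverse (?f H1) ^ Suc q)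
        = ?f \<phi> * (of_nat (2 * N - q choose N) * x1 ^ q * inverse y1 ^ Suc q)"
        unfolding Linv fls_const_mult_const[symmetric] fc by (rule reassoc)
    qed
    also have "t0 ^ M * ((2 * (fact N)\<^sup>2) * (?f \<phi> * S1) $$ -1) = (2 * (fact N)\<^sup>2) * (?f \<phi> * (c ^ M * S1)) $$ -1"
    proof -
      have eq: "?f \<phi> * (c ^ M * S1) = fls_const (t0 ^ M) * (?f \<phi> * S1)" by (simp add: cc fls_const_power mult_ac)
      have "(?f \<phi> * (c ^ M * S1)) $$ -1 = t0 ^ M * (?f \<phi> * S1) $$ -1" unfolding eq by simp
      then show ?thesis by (simp only: mult.left_commute)
    qed
    finally show ?thesis .
  qed
  \<comment> \<open>Here the derivative \<open>- R\<close> of \<open>H2\<close> raises R^(2N) to the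
    odd power \<open>M\<close> and contributes the sign.\<close>
  have R: "(\<Sum>q\<le>N. of_real (lop_coeff N q) * t0 ^ q * ((\<lambda>P. fps_deriv P * (- inverse R)) ^^ q) (R ^ (2 * N) * \<phi>) $ 0)
     = - ((2 * (fact N)\<^sup>2) * (?f \<phi> * (\<rho> ^ M * S2)) $$ -1)"
  proof -
    have RQ: "of_real (lop_coeff N q) * t0 ^ q * ((\<lambda>P. fps_deriv P * (- inverse R)) ^^ q) (R ^ (2 * N) * \<phi>) $ 0
      = (2 * (fact N)\<^sup>2) * ((of_nat (2 * N - q choose N) * ((2 * t0) ^ q / 2)) * (- (?f \<phi> * \<rho> ^ M * inverse (?f H2) ^ Suc q)) $$ -1)" if "q \<le> N" for q
    proof -
      have "?f (R ^ (2 * N) * \<phi>) * ?f (fps_deriv H2) = - (?f \<phi> * \<rho> ^ M)"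
        unfolding d2 M_def \<rho>_def by (simp add: fls_times_fps_to_fls fps_to_fls_power mult_ac)
      then have "((\<lambda>P. fps_deriv P * (- inverse R)) ^^ q) (R ^ (2 * N) * \<phi>) $ 0 = fact q * (- (?f \<phi> * \<rho> ^ M * inverse (?f H2) ^ Suc q)) $$ -1"
        unfolding iterated_deriv_residue[OF e2(2) e2(1)] by simp
      then have "of_real (lop_coeff N q) * t0 ^ q * ((\<lambda>P. fps_deriv P * (- inverse R)) ^^ q) (R ^ (2 * N) * \<phi>) $ 0
        = t0 ^ q * (of_real (lop_coeff N q) * fact q) * (- (?f \<phi> * \<rho> ^ M * inverse (?f H2) ^ Suc q)) $$ -1" by (simp only: mult_ac)
      then show ?thesis
        unfolding cN[OF that] power_mult_distrib by (simp only: mult_ac times_divide_eq_left times_divide_eq_right)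
    qed
    have "(\<Sum>q\<le>N. of_real (lop_coeff N q) * t0 ^ q * ((\<lambda>P. fps_deriv P * (- inverse R)) ^^ q) (R ^ (2 * N) * \<phi>) $ 0)
      = (2 * (fact N)\<^sup>2) * (\<Sum>q\<le>N. (of_nat (2 * N - q choose N) * ((2 * t0) ^ q / 2)) * (- (?f \<phi> * \<rho> ^ M * inverse (?f H2) ^ Suc q)) $$ -1)"
      unfolding sum_distrib_left by (rule sum.cong[OF refl], rule RQ) simp
    also have "(\<Sum>q\<le>N. (of_nat (2 * N - q choose N) * ((2 * t0) ^ q / 2)) * (- (?f \<phi> * \<rho> ^ M * inverse (?f H2) ^ Suc q)) $$ -1) = (- (?f \<phi> * (\<rho> ^ M * S2))) $$ -1"
      unfolding sumres S2_def sum_distrib_left sum_negf[symmetric]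
    proof (rule arg_cong[where f="\<lambda>x. x $$ -1"], rule sum.cong[OF refl])
      fix q
      have "x2 ^ q * fls_const (1 / 2) ^ Suc q = fls_const ((2 * t0) ^ q / 2)"
      proof -
        have "x2 = fls_const (4 * t0)" by (simp add: x2_def cc flip: fls_const_mult_const)
        then have "x2 ^ q * fls_const (1 / 2) ^ Suc q = fls_const ((4 * t0) ^ q * (1 / 2) ^ Suc q)"
          by (simp only: fls_const_power[symmetric] fls_const_mult_const)
        also have "(4 * t0) ^ q * (1 / 2) ^ Suc q = (2 * t0) ^ q / 2"
        proof -
          have "(4 * t0) ^ q * (1 / 2) ^ q = (4 * t0 * (1 / 2)) ^ q" by (rule power_mult_distrib[symmetric])
          then show ?thesis by simp
        qed
        finally show ?thesis .
      qed
      then show "fls_const (of_nat (2 * N - q choose N) * ((2 * t0) ^ q / 2)) * - (?f \<phi> * \<rho> ^ M * inverse (?f H2) ^ Suc q)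
        = - (?f \<phi> * (\<rho> ^ M * (of_nat (2 * N - q choose N) * x2 ^ q * inverse y2 ^ Suc q)))"
        unfolding Linv fls_const_mult_const[symmetric] fc mult_minus_right by (intro arg_cong[where f=uminus] reassoc')
    qed
    finally show ?thesis by simp
  qed
  have "(?f \<phi> * (c ^ M * S1)) $$ -1 = - ((?f \<phi> * (\<rho> ^ M * S2)) $$ -1)"
    using res0 by (simp only: eq_neg_iff_add_eq_0)
  then show ?thesis
    unfolding M_def[symmetric] L R by (simp only: mult_minus_right)
qed

section \<open>Smooth functions of a real variable\<close>

lemma C_k_on_cong:
  fixes f g :: "'a::euclidean_space \<Rightarrow> 'b::real_normed_vector"
  assumes S: "open S" and eq: "\<And>x. x \<in> S \<Longrightarrow> f x = g x" and "C_k_on k f S"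
  shows "C_k_on k g S"
  using eq assms(3)
proof (induction k arbitrary: f g)
  case 0 then show ?case by (metis C_k_on.simps(1) continuous_on_cong)
next
  case (Suc k)
  have d: "(g has_derivative frechet_derivative f (at x)) (at x)" if "x \<in> S" for x
  proof -
    have "(f has_derivative frechet_derivative f (at x)) (at x)"
      using Suc.prems(2) that by (simp add: frechet_derivative_works)
    then show ?thesis
      by (rule has_derivative_transform_within_open[OF _ S that]) (use Suc.prems(1) in auto)
  qed
  have "frechet_derivative f (at x) b = frechet_derivative g (at x) b" if "x \<in> S" for x b
    using frechet_derivative_at[OF d[OF that]] by simp
  with Suc.IH[of "\<lambda>x. frechet_derivative f (at x) b" "\<lambda>x. frechet_derivative g (at x) b" for b] Suc.prems(2) d
  show ?case by (auto simp: differentiable_def)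
qed

lemma d_dt_eqI: "(f has_vector_derivative f') (at x) \<Longrightarrow> d_dt f x = f'"
  unfolding d_dt_def by (rule vector_derivative_at)

text \<open>On the line the only basis direction is 1. Openness of \<open>S\<close> lets the two
  notions of derivative be exchanged although they agree on \<open>S\<close> alone.\<close>

lemma C_k_on_Suc_iff:
  fixes f :: "real \<Rightarrow> complex"
  assumes S: "open S"
  shows "C_k_on (Suc k) f S \<longleftrightarrow> (\<forall>x\<in>S. (f has_vector_derivative d_dt f x) (at x)) \<and> C_k_on k (d_dt f) S"
proof -
  have 1: "f differentiable (at x) \<longleftrightarrow> (f has_vector_derivative d_dt f x) (at x)" for x
    unfolding d_dt_def by (metis differentiableI_vector vector_derivative_works)
  have 2: "frechet_derivative f (at x) 1 = d_dt f x" if "f differentiable (at x)" for x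
    using that unfolding d_dt_def
    by (metis frechet_derivative_at has_vector_derivative_def scaleR_one vector_derivative_works)
  have "C_k_on k (\<lambda>x. frechet_derivative f (at x) 1) S \<longleftrightarrow> C_k_on k (d_dt f) S" if "\<forall>x\<in>S. f differentiable (at x)"
  proof -
    have "frechet_derivative f (at x) 1 = d_dt f x" if "x \<in> S" for x using \<open>\<forall>x\<in>S. f differentiable (at x)\<close> 2 that by blast
    then show ?thesis by (intro iffI; elim C_k_on_cong[OF S, rotated]) simp_all
  qed
  then show ?thesis by (auto simp: 1)
qed

declare C_k_on.simps(2) [simp del]

lemma C_k_on_SucI:
  fixes f :: "real \<Rightarrow> complex"
  assumes S: "open S" and "\<And>x. x \<in> S \<Longrightarrow> (f has_vector_derivative f' x) (at x)" and "C_k_on k f' S"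
  shows "C_k_on (Suc k) f S"
  unfolding C_k_on_Suc_iff[OF S] using assms(2) d_dt_eqI[OF assms(2)] C_k_on_cong[OF S _ assms(3), of "d_dt f"] by auto

lemma C_k_on_deriv:
  fixes f :: "real \<Rightarrow> complex"
  assumes "C_k_on (Suc k) f S" "open S" "x \<in> S"
  shows "(f has_vector_derivative d_dt f x) (at x)"
  using assms by (simp add: C_k_on_Suc_iff)

lemma C_k_on_continuous:
  fixes f :: "real \<Rightarrow> complex"
  assumes "C_k_on k f S" "open S"
  shows "continuous_on S f"
proof (cases k)
  case (Suc k')
  with assms show ?thesis
    by (auto simp: C_k_on_Suc_iff continuous_on_eq_continuous_at intro: has_vector_derivative_continuous)
qed (use assms in simp)

lemma C_k_on_Suc_imp:
  fixes f :: "real \<Rightarrow> complex"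
  assumes "open S"
  shows "C_k_on (Suc k) f S \<Longrightarrow> C_k_on k f S"
proof (induction k arbitrary: f)
  case 0 then show ?case using C_k_on_continuous[OF _ assms, of "Suc 0"] by simp
next
  case (Suc k) then show ?case using C_k_on_Suc_iff[OF assms] by blast
qed

lemma C_k_on_le:
  fixes f :: "real \<Rightarrow> complex"
  assumes "open S" "C_k_on k f S" "j \<le> k"
  shows "C_k_on j f S"
  using assms(3,2) by (induction rule: inc_induct) (auto intro: C_k_on_Suc_imp[OF assms(1)])

lemma C_k_on_add:
  fixes f g :: "real \<Rightarrow> complex"
  assumes "open S"
  shows "C_k_on k f S \<Longrightarrow> C_k_on k g S \<Longrightarrow> C_k_on k (\<lambda>x. f x + g x) S"
proof (induction k arbitrary: f g)
  case (Suc k)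
  show ?case
    by (rule C_k_on_SucI[OF assms, where f'="\<lambda>x. d_dt f x + d_dt g x"])
       (use Suc in \<open>auto simp: C_k_on_Suc_iff[OF assms] intro!: has_vector_derivative_add\<close>)
qed (auto intro: continuous_on_add)

lemma C_k_on_mult:
  fixes f g :: "real \<Rightarrow> complex"
  assumes "open S"
  shows "C_k_on k f S \<Longrightarrow> C_k_on k g S \<Longrightarrow> C_k_on k (\<lambda>x. f x * g x) S"
proof (induction k arbitrary: f g)
  case (Suc k)
  note [simp] = C_k_on_Suc_iff[OF assms]
  show ?case
  proof (rule C_k_on_SucI[OF assms, where f'="\<lambda>x. f x * d_dt g x + d_dt f x * g x"])
    show "((\<lambda>x. f x * g x) has_vector_derivative f x * d_dt g x + d_dt f x * g x) (at x)" if "x \<in> S" for x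
      using Suc.prems that by (auto intro!: has_vector_derivative_mult)
    show "C_k_on k (\<lambda>x. f x * d_dt g x + d_dt f x * g x) S"
      using Suc C_k_on_Suc_imp[OF assms] by (intro C_k_on_add[OF assms] Suc.IH) auto
  qed
qed (auto intro: continuous_on_mult)

lemma C_k_on_const:
  assumes "open S"
  shows "C_k_on k (\<lambda>x::real. c::complex) S"
proof (induction k arbitrary: c)
  case (Suc k) show ?case by (rule C_k_on_SucI[OF assms _ Suc]) (rule has_vector_derivative_const)
qed auto

lemma C_k_on_of_real:
  assumes "open S"
  shows "C_k_on k complex_of_real S"
proof (cases k)
  case (Suc k')
  have "((\<lambda>x. complex_of_real x) has_vector_derivative of_real 1) (at x)" for x
    by (intro has_vector_derivative_of_real) auto
  then show ?thesis unfolding Suc by (intro C_k_on_SucI[OF assms _ C_k_on_const[OF assms]]) auto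
qed (auto intro: continuous_intros)

lemma C_k_on_diff:
  fixes f g :: "real \<Rightarrow> complex"
  assumes "open S" "C_k_on k f S" "C_k_on k g S"
  shows "C_k_on k (\<lambda>x. f x - g x) S"
  using C_k_on_add[OF assms(1,2) C_k_on_mult[OF assms(1) C_k_on_const[OF assms(1), of _ "-1"] assms(3)]] by simp

lemma C_k_on_power:
  fixes f :: "real \<Rightarrow> complex"
  assumes "open S" "C_k_on k f S"
  shows "C_k_on k (\<lambda>x. f x ^ n) S"
  by (induction n) (auto intro: C_k_on_mult C_k_on_const assms)

lemma C_k_on_sum:
  fixes f :: "'i \<Rightarrow> real \<Rightarrow> complex"
  assumes "open S" "\<And>i. i \<in> A \<Longrightarrow> C_k_on k (f i) S"
  shows "C_k_on k (\<lambda>x. \<Sum>i\<in>A. f i x) S"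
  using assms(2) by (induction A rule: infinite_finite_induct) (auto intro: C_k_on_add C_k_on_const assms(1))

text \<open>The derivative of 1/f is itself built from 1/f, to which the induction hypothesis one
  order lower applies.\<close>

lemma C_k_on_inverse:
  fixes f :: "real \<Rightarrow> complex"
  assumes S: "open S" and "C_k_on k f S" and nz: "\<And>x. x \<in> S \<Longrightarrow> f x \<noteq> 0"
  shows "C_k_on k (\<lambda>x. inverse (f x)) S"
  using assms(2)
proof (induction k)
  case (Suc k)
  note [simp] = C_k_on_Suc_iff[OF S]
  show ?case
  proof (rule C_k_on_SucI[OF S, where f'="\<lambda>x. (-1) * (inverse (f x) * d_dt f x * inverse (f x))"])
    show "((\<lambda>x. inverse (f x)) has_vector_derivative (-1) * (inverse (f x) * d_dt f x * inverse (f x))) (at x)" if "x \<in> S" for x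
    proof -
      have "(f has_derivative (\<lambda>h. of_real h * d_dt f x)) (at x)"
        using Suc.prems that by (simp add: has_vector_derivative_def scaleR_conv_of_real)
      from Deriv.has_derivative_inverse[OF nz[OF that] this] show ?thesis
        by (simp add: has_vector_derivative_def scaleR_conv_of_real mult_ac)
    qed
    show "C_k_on k (\<lambda>x. (-1) * (inverse (f x) * d_dt f x * inverse (f x))) S"
      using Suc C_k_on_Suc_imp[OF S] by (intro C_k_on_mult[OF S] C_k_on_const[OF S] Suc.IH) auto
  qed
qed (use nz in \<open>auto intro: continuous_on_inverse\<close>)

lemma has_vector_derivative_reflect:
  fixes f :: "real \<Rightarrow> complex"
  assumes "(f has_vector_derivative f') (at (1 - x))"
  shows "((\<lambda>x. f (1 - x)) has_vector_derivative - f') (at x)"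
proof -
  have "((\<lambda>x. 1 - x) has_derivative (\<lambda>h. - h)) (at x)" by (auto intro!: derivative_eq_intros)
  from has_derivative_compose[OF this, of f "\<lambda>h. h *\<^sub>R f'"] assms
  show ?thesis by (simp add: has_vector_derivative_def)
qed

lemma C_k_on_reflect:
  fixes f :: "real \<Rightarrow> complex"
  shows "C_k_on k f {a<..<b} \<Longrightarrow> C_k_on k (\<lambda>x. f (1 - x)) {1-b<..<1-a}"
proof (induction k arbitrary: f)
  case 0
  then show ?case by (auto intro!: continuous_on_compose2[of "{a<..<b}" f] continuous_intros)
next
  case (Suc k)
  have op: "open {a<..<b}" "open {1-b<..<1-a}" by auto
  note [simp] = C_k_on_Suc_iff[OF op(1)]
  show ?case
  proof (rule C_k_on_SucI[OF op(2), where f'="\<lambda>x. (-1) * d_dt f (1 - x)"])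
    show "((\<lambda>x. f (1 - x)) has_vector_derivative (-1) * d_dt f (1 - x)) (at x)" if "x \<in> {1-b<..<1-a}" for x
      using Suc.prems that has_vector_derivative_reflect[of f _ x] by auto
    show "C_k_on k (\<lambda>x. (-1) * d_dt f (1 - x)) {1-b<..<1-a}"
      using Suc by (intro C_k_on_mult[OF op(2)] C_k_on_const[OF op(2)]) auto
  qed
qed

definition smooth_on :: "real set \<Rightarrow> (real \<Rightarrow> complex) \<Rightarrow> bool" where
  "smooth_on S f \<longleftrightarrow> (\<forall>k. C_k_on k f S)"

lemma smooth_on_C_k: "smooth_on S f \<Longrightarrow> C_k_on k f S"
  by (simp add: smooth_on_def)

lemma smooth_on_deriv: "smooth_on S f \<Longrightarrow> open S \<Longrightarrow> x \<in> S \<Longrightarrow> (f has_vector_derivative d_dt f x) (at x)"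
  using C_k_on_deriv[of 0 f S x] by (auto simp: smooth_on_def)

lemma smooth_on_d_dt: "open S \<Longrightarrow> smooth_on S f \<Longrightarrow> smooth_on S (d_dt f)"
  unfolding smooth_on_def using C_k_on_Suc_iff by blast

lemma smooth_on_d_dt_funpow: "open S \<Longrightarrow> smooth_on S f \<Longrightarrow> smooth_on S ((d_dt ^^ n) f)"
  by (induction n) (auto intro: smooth_on_d_dt)

lemma smooth_on_cong: "open S \<Longrightarrow> (\<And>x. x \<in> S \<Longrightarrow> f x = g x) \<Longrightarrow> smooth_on S f \<Longrightarrow> smooth_on S g"
  unfolding smooth_on_def using C_k_on_cong by metis

lemma smooth_on_intros:
  assumes "open S"
  shows "smooth_on S (\<lambda>x. c)" "smooth_on S complex_of_real"
    "smooth_on S f \<Longrightarrow> smooth_on S g \<Longrightarrow> smooth_on S (\<lambda>x. f x + g x)"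
    "smooth_on S f \<Longrightarrow> smooth_on S g \<Longrightarrow> smooth_on S (\<lambda>x. f x - g x)"
    "smooth_on S f \<Longrightarrow> smooth_on S g \<Longrightarrow> smooth_on S (\<lambda>x. f x * g x)"
    "smooth_on S f \<Longrightarrow> smooth_on S (\<lambda>x. f x ^ n)"
    "smooth_on S f \<Longrightarrow> (\<And>x. x \<in> S \<Longrightarrow> f x \<noteq> 0) \<Longrightarrow> smooth_on S (\<lambda>x. inverse (f x))"
  unfolding smooth_on_def
  by (auto intro!: C_k_on_const C_k_on_of_real C_k_on_add C_k_on_diff C_k_on_mult C_k_on_power C_k_on_inverse assms)

lemma smooth_on_sum:
  assumes "open S" "\<And>i. i \<in> A \<Longrightarrow> smooth_on S (f i)"
  shows "smooth_on S (\<lambda>x. \<Sum>i\<in>A. f i x)"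
  using assms unfolding smooth_on_def by (auto intro: C_k_on_sum)

lemma smooth_on_reflect: "smooth_on {a<..<b} f \<Longrightarrow> smooth_on {1-b<..<1-a} (\<lambda>x. f (1 - x))"
  unfolding smooth_on_def using C_k_on_reflect by blast

lemma d_dt_cong:
  assumes "open S" "\<And>x. x \<in> S \<Longrightarrow> f x = g x" "x \<in> S"
  shows "d_dt f x = d_dt g x"
  unfolding d_dt_def
  by (rule vector_derivative_cong_eq)
     (use assms in \<open>auto simp: eventually_nhds intro!: exI[of _ S]\<close>)

lemma d_dt_funpow_cong:
  assumes "open S" "\<And>x. x \<in> S \<Longrightarrow> f x = g x"
  shows "x \<in> S \<Longrightarrow> (d_dt ^^ n) f x = (d_dt ^^ n) g x"
  by (induction n arbitrary: x) (auto simp: assms intro: d_dt_cong[OF assms(1)])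

text \<open>A formal Taylor series, without any claim of convergence. On smooth functions it
  respects sums, products and derivatives, which transfers identities between iterated derivatives
  to power series.\<close>

definition taylor :: "(real \<Rightarrow> complex) \<Rightarrow> real \<Rightarrow> complex fps" where
  "taylor f x = Abs_fps (\<lambda>n. (d_dt ^^ n) f x / fact n)"

lemma taylor_nth_0 [simp]: "fps_nth (taylor f x) 0 = f x"
  by (simp add: taylor_def)

lemma fps_deriv_taylor: "fps_deriv (taylor f x) = taylor (d_dt f) x"
  by (rule fps_ext) (simp add: taylor_def funpow_swap1 del: of_nat_Suc)

lemma taylor_cong:
  assumes "open S" "\<And>x. x \<in> S \<Longrightarrow> f x = g x" "x \<in> S"
  shows "taylor f x = taylor g x"
  using d_dt_funpow_cong[OF assms(1,2,3)] by (simp add: taylor_def)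

lemma fps_eq_if_deriv:
  fixes P Q :: "complex fps"
  assumes "fps_nth P 0 = fps_nth Q 0" "\<And>n. fps_nth (fps_deriv P) n = fps_nth (fps_deriv Q) n"
  shows "P = Q"
proof (rule fps_ext)
  fix n show "fps_nth P n = fps_nth Q n"
    using assms(1) assms(2)[of "n - 1"] by (cases n) (auto simp del: of_nat_Suc)
qed

lemma taylor_nth_Suc: "of_nat (Suc n) * fps_nth (taylor f x) (Suc n) = fps_nth (taylor (d_dt f) x) n"
  using fps_deriv_taylor[of f x] by (metis fps_deriv_nth Suc_eq_plus1)

lemma d_dt_add:
  assumes "open S" "smooth_on S f" "smooth_on S g" "x \<in> S"
  shows "d_dt (\<lambda>x. f x + g x) x = d_dt f x + d_dt g x"
  by (intro d_dt_eqI has_vector_derivative_add smooth_on_deriv[OF _ assms(1)] assms)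

lemma d_dt_mult:
  assumes "open S" "smooth_on S f" "smooth_on S g" "x \<in> S"
  shows "d_dt (\<lambda>x. f x * g x) x = f x * d_dt g x + d_dt f x * g x"
  by (intro d_dt_eqI has_vector_derivative_mult smooth_on_deriv[OF _ assms(1)] assms)

lemma taylor_add:
  assumes S: "open S" "x \<in> S"
  shows "smooth_on S f \<Longrightarrow> smooth_on S g \<Longrightarrow> taylor (\<lambda>x. f x + g x) x = taylor f x + taylor g x"
proof -
  have "fps_nth (taylor (\<lambda>x. f x + g x) x) n = fps_nth (taylor f x + taylor g x) n" if "smooth_on S f" "smooth_on S g" for n
    using that
  proof (induction n arbitrary: f g)
    case (Suc n)
    have "of_nat (Suc n) * fps_nth (taylor (\<lambda>x. f x + g x) x) (Suc n) = fps_nth (taylor (\<lambda>x. d_dt f x + d_dt g x) x) n"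
      unfolding taylor_nth_Suc using taylor_cong[OF S(1) d_dt_add[OF S(1) Suc.prems] S(2)] by simp
    also have "\<dots> = of_nat (Suc n) * fps_nth (taylor f x + taylor g x) (Suc n)"
      unfolding Suc.IH[OF smooth_on_d_dt[OF S(1) Suc.prems(1)] smooth_on_d_dt[OF S(1) Suc.prems(2)]]
      by (simp only: fps_add_nth distrib_left taylor_nth_Suc)
    finally show ?case by (simp del: of_nat_Suc)
  qed simp
  then show "smooth_on S f \<Longrightarrow> smooth_on S g \<Longrightarrow> taylor (\<lambda>x. f x + g x) x = taylor f x + taylor g x"
    by (auto intro: fps_ext)
qed

text \<open>Leibniz's rule reduces each coefficient to the preceding one, for products in which one
  factor has been differentiated.\<close>

lemma taylor_mult:
  assumes S: "open S" "x \<in> S"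
  shows "smooth_on S f \<Longrightarrow> smooth_on S g \<Longrightarrow> taylor (\<lambda>x. f x * g x) x = taylor f x * taylor g x"
proof -
  have "fps_nth (taylor (\<lambda>x. f x * g x) x) n = fps_nth (taylor f x * taylor g x) n" if "smooth_on S f" "smooth_on S g" for n
    using that
  proof (induction n arbitrary: f g)
    case (Suc n)
    note d = smooth_on_d_dt[OF S(1) Suc.prems(1)] smooth_on_d_dt[OF S(1) Suc.prems(2)]
    have "of_nat (Suc n) * fps_nth (taylor (\<lambda>x. f x * g x) x) (Suc n) = fps_nth (taylor (\<lambda>x. f x * d_dt g x + d_dt f x * g x) x) n"
      unfolding taylor_nth_Suc using taylor_cong[OF S(1) d_dt_mult[OF S(1) Suc.prems] S(2)] by simp
    also have "taylor (\<lambda>x. f x * d_dt g x + d_dt f x * g x) x = taylor (\<lambda>x. f x * d_dt g x) x + taylor (\<lambda>x. d_dt f x * g x) x"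
      by (intro taylor_add[OF S] smooth_on_intros[OF S(1)] d Suc.prems)
    also have "fps_nth \<dots> n = fps_nth (taylor f x * taylor (d_dt g) x + taylor (d_dt f) x * taylor g x) n"
      unfolding fps_add_nth Suc.IH[OF Suc.prems(1) d(2)] Suc.IH[OF d(1) Suc.prems(2)] ..
    also have "\<dots> = fps_nth (fps_deriv (taylor f x * taylor g x)) n"
      by (simp add: fps_deriv_taylor)
    also have "\<dots> = of_nat (Suc n) * fps_nth (taylor f x * taylor g x) (Suc n)"
      by (simp only: fps_deriv_nth Suc_eq_plus1)
    finally show ?case by (simp del: of_nat_Suc)
  qed simp
  then show "smooth_on S f \<Longrightarrow> smooth_on S g \<Longrightarrow> taylor (\<lambda>x. f x * g x) x = taylor f x * taylor g x"
    by (auto intro: fps_ext)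
qed

lemma d_dt_const: "d_dt (\<lambda>x. c) = (\<lambda>x. 0)"
  by (auto intro!: d_dt_eqI)

lemma taylor_const: "taylor (\<lambda>x. c) x = fps_const c"
proof -
  have "(d_dt ^^ Suc n) (\<lambda>x. c) = (\<lambda>x. 0)" for n and c :: complex
    by (induction n arbitrary: c) (simp_all add: funpow_swap1 d_dt_const)
  then show ?thesis
    by (intro fps_ext) (auto simp: taylor_def fps_const_def gr0_conv_Suc simp del: funpow.simps split: if_splits)
qed

lemma taylor_of_real: "taylor complex_of_real x = fps_const (of_real x) + fps_X"
proof (rule fps_eq_if_deriv)
  have "d_dt complex_of_real = (\<lambda>x. 1)"
    using has_vector_derivative_of_real[OF DERIV_ident] by (auto intro!: d_dt_eqI)
  then show "fps_nth (fps_deriv (taylor complex_of_real x)) n = fps_nth (fps_deriv (fps_const (of_real x) + fps_X)) n" for n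
    by (simp add: fps_deriv_taylor taylor_const)
qed simp

lemma taylor_power:
  assumes "open S" "x \<in> S" "smooth_on S f"
  shows "taylor (\<lambda>x. f x ^ n) x = taylor f x ^ n"
proof (induction n)
  case (Suc n)
  then show ?case
    using taylor_mult[OF assms(1,2,3) smooth_on_intros(6)[OF assms(1,3)], of n] by simp
qed (simp add: taylor_const)

lemma taylor_inverse:
  assumes S: "open S" "x \<in> S" and f: "smooth_on S f" and nz: "\<And>x. x \<in> S \<Longrightarrow> f x \<noteq> 0"
  shows "taylor (\<lambda>x. inverse (f x)) x = inverse (taylor f x)"
proof -
  have "taylor f x * taylor (\<lambda>x. inverse (f x)) x = taylor (\<lambda>x. f x * inverse (f x)) x"
    by (intro taylor_mult[OF S, symmetric] smooth_on_intros[OF S(1)] f nz)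
  also have "\<dots> = taylor (\<lambda>x. 1) x"
    by (rule taylor_cong[OF S(1) _ S(2)]) (use nz in auto)
  finally have "taylor f x * taylor (\<lambda>x. inverse (f x)) x = 1" by (simp add: taylor_const)
  then show ?thesis by (rule fps_inverse_unique[symmetric])
qed

text \<open>The operator \<open>\<psi> \<mapsto> e \<psi>'\<close> covers both \<open>D\<close> in the variable \<open>t\<close> and \<open>D\<close> in the variable \<open>1 - t\<close>.\<close>

definition weighted_deriv :: "(real \<Rightarrow> complex) \<Rightarrow> (real \<Rightarrow> complex) \<Rightarrow> real \<Rightarrow> complex" where
  "weighted_deriv e \<psi> t = d_dt \<psi> t * e t"

lemma D_op_weighted_deriv: "D_op = weighted_deriv (\<lambda>t. inverse (of_real t))"
  by (auto simp: fun_eq_iff D_op_def weighted_deriv_def divide_inverse)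

lemma smooth_on_weighted_deriv:
  assumes "open S" "smooth_on S e" "smooth_on S \<psi>"
  shows "smooth_on S ((weighted_deriv e ^^ q) \<psi>)"
proof (induction q)
  case (Suc q)
  have "smooth_on S (\<lambda>t. d_dt ((weighted_deriv e ^^ q) \<psi>) t * e t)"
    by (intro smooth_on_intros[OF assms(1)] smooth_on_d_dt assms Suc)
  then show ?case by (simp add: weighted_deriv_def[abs_def])
qed (use assms in simp)

lemma taylor_weighted_deriv:
  assumes S: "open S" "x \<in> S" and e: "smooth_on S e" and \<psi>: "smooth_on S \<psi>"
  shows "taylor ((weighted_deriv e ^^ q) \<psi>) x = ((\<lambda>P. fps_deriv P * taylor e x) ^^ q) (taylor \<psi> x)"
proof (induction q)
  case (Suc q)
  let ?g = "(weighted_deriv e ^^ q) \<psi>"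
  have "taylor (weighted_deriv e ?g) x = taylor (\<lambda>t. d_dt ?g t * e t) x"
    by (simp add: weighted_deriv_def[abs_def])
  also have "\<dots> = taylor (d_dt ?g) x * taylor e x"
    by (intro taylor_mult[OF S] smooth_on_d_dt smooth_on_weighted_deriv S e \<psi>)
  also have "\<dots> = fps_deriv (taylor ?g x) * taylor e x" by (simp add: fps_deriv_taylor)
  finally show ?case using Suc by simp
qed simp

lemma weighted_deriv_Suc: "(weighted_deriv e ^^ Suc q) f x = d_dt ((weighted_deriv e ^^ q) f) x * e x"
  by (simp add: weighted_deriv_def)

text \<open>The reflection t -> 1 - t reverses the sign of a derivative; the weight absorbs
  it.\<close>

lemma weighted_deriv_reflect:
  assumes f: "smooth_on {a<..<b} f" and e: "smooth_on {a<..<b} e" and x: "x \<in> {1-b<..<1-a}"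
  shows "(weighted_deriv e ^^ q) f (1 - x) = (weighted_deriv (\<lambda>t. - e (1 - t)) ^^ q) (\<lambda>t. f (1 - t)) x"
  using x
proof (induction q arbitrary: x)
  case (Suc q)
  let ?g = "(weighted_deriv e ^^ q) f"
  have "smooth_on {a<..<b} ?g" by (intro smooth_on_weighted_deriv f e) auto
  then have "(?g has_vector_derivative d_dt ?g (1 - x)) (at (1 - x))"
    by (rule smooth_on_deriv) (use Suc.prems in auto)
  from d_dt_eqI[OF has_vector_derivative_reflect[OF this]]
  have "d_dt ?g (1 - x) = - d_dt (\<lambda>t. ?g (1 - t)) x" by simp
  also have "d_dt (\<lambda>t. ?g (1 - t)) x = d_dt ((weighted_deriv (\<lambda>t. - e (1 - t)) ^^ q) (\<lambda>t. f (1 - t))) x"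
    by (rule d_dt_cong[of "{1-b<..<1-a}"]) (use Suc in auto)
  finally have "d_dt ?g (1 - x) = - d_dt ((weighted_deriv (\<lambda>t. - e (1 - t)) ^^ q) (\<lambda>t. f (1 - t))) x" .
  then show ?case unfolding weighted_deriv_Suc by (simp only: mult_minus_left mult_minus_right)
qed simp

text \<open>Evaluating an iterated operator at \<open>t\<close> is taking the constant coefficient
  of its formal counterpart at base point \<open>t\<close>, so the power series identity applies
  directly.\<close>

lemma iterated_D_identity:
  fixes F :: "real \<Rightarrow> complex"
  assumes F: "smooth_on {0<..<1} F" and t: "t \<in> {0<..<1}"
  shows "of_real t ^ (2 * N + 1) * (\<Sum>q\<le>N. (-1) ^ q * of_real (lop_coeff N q) *
            (D_op ^^ q) (\<lambda>t. F (1 - t) * of_real (1 - t) ^ q * inverse (of_real t)) t)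
       = (\<Sum>q\<le>N. of_real (lop_coeff N q) * of_real t ^ q * (D_op ^^ q) (\<lambda>r. of_real r ^ (2 * N) * F r) (1 - t))"
proof -
  let ?S = "{0<..<1::real}"
  have S: "open ?S" "t \<in> ?S" using t by auto
  have refl: "smooth_on ?S (\<lambda>t. F (1 - t))" using smooth_on_reflect[OF F] by simp
  note si = smooth_on_intros[OF S(1)]
  have s1: "smooth_on ?S (\<lambda>t. of_real (1 - t))"
    using si(4)[OF si(1)[of 1] si(2)] by simp
  have inv: "smooth_on ?S (\<lambda>t. inverse (of_real t))" "smooth_on ?S (\<lambda>t. inverse (of_real (1 - t)))"
    by (intro si(7) si(2) s1; simp)+
  define T where "T = taylor complex_of_real t"
  define \<phi> where "\<phi> = taylor (\<lambda>t. F (1 - t)) t"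
  have T: "T = fps_const (of_real t) + fps_X" by (simp add: T_def taylor_of_real)
  have R: "taylor (\<lambda>t. of_real (1 - t)) t = 1 - T"
  proof (rule fps_eq_if_deriv)
    have "d_dt (\<lambda>t. complex_of_real (1 - t)) = (\<lambda>t. -1)"
      using has_vector_derivative_of_real[OF DERIV_diff[OF DERIV_const[of 1] DERIV_ident]]
      by (auto intro!: d_dt_eqI)
    then show "fps_nth (fps_deriv (taylor (\<lambda>t. of_real (1 - t)) t)) n = fps_nth (fps_deriv (1 - T)) n" for n
      by (simp add: fps_deriv_taylor taylor_const T)
  qed (simp add: T)
  have Ti: "taylor (\<lambda>t. inverse (of_real t)) t = inverse T"
    unfolding T_def by (rule taylor_inverse[OF S si(2)]) auto
  have Ri: "taylor (\<lambda>t. - inverse (of_real (1 - t))) t = - inverse (1 - T)"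
  proof -
    have "taylor (\<lambda>t. (-1) * inverse (of_real (1 - t))) t = taylor (\<lambda>t. -1) t * taylor (\<lambda>t. inverse (of_real (1 - t))) t"
      by (intro taylor_mult[OF S] si inv) 
    also have "taylor (\<lambda>t. inverse (of_real (1 - t))) t = inverse (1 - T)"
      unfolding R[symmetric] by (rule taylor_inverse[OF S s1]) auto
    finally show ?thesis by (simp add: taylor_const flip: fps_const_neg)
  qed
  have L: "(D_op ^^ q) (\<lambda>t. F (1 - t) * of_real (1 - t) ^ q * inverse (of_real t)) t =
     fps_nth (((\<lambda>P. fps_deriv P * inverse T) ^^ q) (\<phi> * (1 - T) ^ q * inverse T)) 0" for q
  proof -
    have sm: "smooth_on ?S (\<lambda>t. F (1 - t) * of_real (1 - t) ^ q)" by (intro si refl s1)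
    have "(D_op ^^ q) (\<lambda>t. F (1 - t) * of_real (1 - t) ^ q * inverse (of_real t)) t
      = fps_nth (taylor ((D_op ^^ q) (\<lambda>t. F (1 - t) * of_real (1 - t) ^ q * inverse (of_real t))) t) 0" by simp
    also have "taylor ((D_op ^^ q) (\<lambda>t. F (1 - t) * of_real (1 - t) ^ q * inverse (of_real t))) t
      = ((\<lambda>P. fps_deriv P * inverse T) ^^ q) (taylor (\<lambda>t. F (1 - t) * of_real (1 - t) ^ q * inverse (of_real t)) t)"
      unfolding D_op_weighted_deriv Ti[symmetric] by (intro taylor_weighted_deriv[OF S] inv si(5) sm)
    also have "taylor (\<lambda>t. F (1 - t) * of_real (1 - t) ^ q * inverse (of_real t)) t = \<phi> * (1 - T) ^ q * inverse T"
      unfolding taylor_mult[OF S sm inv(1)] taylor_mult[OF S refl si(6)[OF s1]] taylor_power[OF S s1] Ti R \<phi>_def ..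
    finally show ?thesis .
  qed
  have R': "(D_op ^^ q) (\<lambda>r. of_real r ^ (2 * N) * F r) (1 - t) =
     fps_nth (((\<lambda>P. fps_deriv P * (- inverse (1 - T))) ^^ q) ((1 - T) ^ (2 * N) * \<phi>)) 0" for q
  proof -
    have sm: "smooth_on ?S (\<lambda>r. of_real r ^ (2 * N) * F r)" by (intro si F)
    have sm': "smooth_on ?S (\<lambda>t. - inverse (complex_of_real (1 - t)))" using si(5)[OF si(1)[of "-1"] inv(2)] by simp
    have "(D_op ^^ q) (\<lambda>r. of_real r ^ (2 * N) * F r) (1 - t) =
       (weighted_deriv (\<lambda>t. - inverse (of_real (1 - t))) ^^ q) (\<lambda>t. of_real (1 - t) ^ (2 * N) * F (1 - t)) t"
      unfolding D_op_weighted_deriv by (rule weighted_deriv_reflect[OF sm inv(1)]) (use t in auto)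
    also have "\<dots> = fps_nth (taylor ((weighted_deriv (\<lambda>t. - inverse (of_real (1 - t))) ^^ q) (\<lambda>t. of_real (1 - t) ^ (2 * N) * F (1 - t))) t) 0"
      by simp
    also have "taylor ((weighted_deriv (\<lambda>t. - inverse (of_real (1 - t))) ^^ q) (\<lambda>t. of_real (1 - t) ^ (2 * N) * F (1 - t))) t
       = ((\<lambda>P. fps_deriv P * (- inverse (1 - T))) ^^ q) (taylor (\<lambda>t. of_real (1 - t) ^ (2 * N) * F (1 - t)) t)"
      unfolding Ri[symmetric] by (intro taylor_weighted_deriv[OF S] sm' si(5) si(6) s1 refl)
    also have "taylor (\<lambda>t. of_real (1 - t) ^ (2 * N) * F (1 - t)) t = (1 - T) ^ (2 * N) * \<phi>"
      unfolding taylor_mult[OF S si(6)[OF s1] refl] taylor_power[OF S s1] R \<phi>_def ..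
    finally show ?thesis .
  qed
  have t0: "complex_of_real t \<noteq> 0" "complex_of_real t \<noteq> 1" using t by auto
  show ?thesis
    unfolding L R' using iterated_deriv_identity_fps[OF t0, of N \<phi>] unfolding T[symmetric] .
qed

section \<open>The differential equation\<close>

text \<open>By Heron's formula the base is 16 times the squared area of a triangle with sides 1, r
  and the square root of the polynomial variable u. Treating it as a polynomial in u separates the
  dependence on t, through u = t^2, from that on r.\<close>

definition heron_poly :: "nat \<Rightarrow> real \<Rightarrow> real poly" where
  "heron_poly N r = ([:- ((1 - r)\<^sup>2), 1:] * [:(1 + r)\<^sup>2, -1:]) ^ N"

lemma coeff_pderiv_funpow:
  "coeff ((pderiv ^^ j) (p :: real poly)) i = fact (i + j) / fact i * coeff p (i + j)"
proof (induction j arbitrary: i)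
  case (Suc j)
  have e: "of_nat (Suc i) * (fact (Suc i + j) / fact (Suc i)) = (fact (Suc i + j) / fact i :: real)"
    unfolding fact_Suc[of i] by (simp del: of_nat_Suc fact_Suc)
  show ?case
    unfolding funpow.simps comp_apply coeff_pderiv Suc.IH mult.assoc[symmetric] e by simp
qed simp

lemma degree_heron_poly: "degree (heron_poly N r) \<le> 2 * N"
proof -
  have "degree ([:- ((1 - r)\<^sup>2), 1:] * [:(1 + r)\<^sup>2, -1:]) \<le> 2"
    by (rule order_trans[OF degree_mult_le]) simp
  then show ?thesis
    unfolding heron_poly_def by (intro order_trans[OF degree_power_le]) simp
qed

lemma smooth_on_coeff_mult:
  assumes S: "open S"
    and "\<And>i. smooth_on S (\<lambda>r. of_real (coeff (p r) i))" "\<And>i. smooth_on S (\<lambda>r. of_real (coeff (q r) i))"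
  shows "smooth_on S (\<lambda>r. of_real (coeff (p r * q r) i))"
proof -
  have "smooth_on S (\<lambda>r. \<Sum>j\<le>i. of_real (coeff (p r) j) * of_real (coeff (q r) (i - j)))"
    by (intro smooth_on_sum smooth_on_intros S assms)
  then show ?thesis by (simp add: coeff_mult)
qed

lemma smooth_on_coeff_heron_poly:
  assumes S: "open S"
  shows "smooth_on S (\<lambda>r. of_real (coeff (heron_poly N r) i))"
proof -
  note si = smooth_on_intros[OF S]
  have c: "smooth_on S (\<lambda>r. of_real (coeff [:a r, b:] i))" if "smooth_on S (\<lambda>r. of_real (a r))" for a b i
  proof (cases i)
    case (Suc i')
    then show ?thesis using si(1) by (cases i') simp_all
  qed (use that in simp)
  have a: "smooth_on S (\<lambda>r. of_real (- ((1 - r)\<^sup>2)))" "smooth_on S (\<lambda>r. of_real ((1 + r)\<^sup>2))"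
  proof -
    have "smooth_on S (\<lambda>r. (-1) * (1 - of_real r) ^ 2)" "smooth_on S (\<lambda>r. (1 + of_real r) ^ 2)" by (intro si)+
    then show "smooth_on S (\<lambda>r. of_real (- ((1 - r)\<^sup>2)))" "smooth_on S (\<lambda>r. of_real ((1 + r)\<^sup>2))" by simp_all
  qed
  show ?thesis
    unfolding heron_poly_def
  proof (induction N arbitrary: i)
    case 0 then show ?case using si(1) by (simp add: coeff_1)
  next
    case (Suc N)
    then show ?case unfolding power_Suc by (intro smooth_on_coeff_mult[OF S] c a)
  qed
qed

lemma pderiv_funpow_pcompose_shift: "(pderiv ^^ j) (pcompose p [:a, 1:]) = pcompose ((pderiv ^^ j) p) [:a, 1:]"
  for p :: "real poly"
  by (induction j) (simp_all add: pderiv_pcompose pderiv_pCons flip: one_pCons)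

text \<open>At \<open>r = 1 - t\<close> the polynomial is \<open>v^N (4r - v)^N\<close> in \<open>v = u - t^2\<close>.\<close>

lemma poly_pderiv_heron_poly:
  "poly ((pderiv ^^ j) (heron_poly N (1 - t))) (t\<^sup>2) =
    (if N \<le> j \<and> j \<le> 2 * N then fact j * real (N choose (j - N)) * (-1) ^ (j - N) * (4 * (1 - t)) ^ (2 * N - j) else 0)"
proof -
  let ?p = "heron_poly N (1 - t)"
  have p: "pcompose ?p [:t\<^sup>2, 1:] = monom 1 N * [:4 * (1 - t), -1:] ^ N"
  proof -
    have base: "pcompose ([:- ((1 - (1 - t))\<^sup>2), 1:] * [:(1 + (1 - t))\<^sup>2, -1:]) [:t\<^sup>2, 1:] = monom 1 1 * [:4 * (1 - t), -1:]"
      by (simp add: pcompose_mult pcompose_pCons monom_altdef power2_eq_square algebra_simps)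
    have pw: "pcompose (q ^ N) r = pcompose q r ^ N" for q r :: "real poly"
      by (induction N) (simp_all add: pcompose_mult pcompose_1)
    show ?thesis unfolding heron_poly_def pw base unfolding power_mult_distrib monom_power by simp
  qed
  have "poly ((pderiv ^^ j) ?p) (t\<^sup>2) = poly (pcompose ((pderiv ^^ j) ?p) [:t\<^sup>2, 1:]) 0"
    by (simp add: poly_pcompose)
  also have "\<dots> = coeff ((pderiv ^^ j) (monom 1 N * [:4 * (1 - t), -1:] ^ N)) 0"
    unfolding pderiv_funpow_pcompose_shift[symmetric] p by (rule poly_0_coeff_0)
  also have "\<dots> = fact j * coeff (monom 1 N * [:4 * (1 - t), -1:] ^ N) j"
    by (simp add: coeff_pderiv_funpow)
  also have "coeff (monom 1 N * [:4 * (1 - t), -1:] ^ N) j = (if N \<le> j then coeff ([:4 * (1 - t), -1:] ^ N) (j - N) else 0)"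
    by (simp add: coeff_monom_mult)
  also have "\<dots> = (if N \<le> j \<and> j \<le> 2 * N then real (N choose (j - N)) * (-1) ^ (j - N) * (4 * (1 - t)) ^ (2 * N - j) else 0)"
  proof (cases "N \<le> j \<and> j \<le> 2 * N")
    case True
    then have "j - N \<le> N" "N - (j - N) = 2 * N - j" by auto
    with True show ?thesis by (simp add: coeff_linear_poly_power)
  next
    case False
    have "degree ([:4 * (1 - t), -1:] ^ N) \<le> N"
      by (rule order_trans[OF degree_power_le]) simp
    then have "coeff ([:4 * (1 - t), -1:] ^ N) (j - N) = 0" if "N \<le> j" using that False by (intro coeff_eq_0) auto
    with False show ?thesis by auto
  qed
  finally show ?thesis by auto
qed

lemma smooth_on_antiderivative:
  assumes "open S" "\<And>t. t \<in> S \<Longrightarrow> (f has_vector_derivative f' t) (at t)" "smooth_on S f'"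
  shows "smooth_on S f"
proof -
  have "C_k_on (Suc k) f S" for k
    by (rule C_k_on_SucI[OF assms(1,2) smooth_on_C_k[OF assms(3)]])
  then show ?thesis unfolding smooth_on_def using C_k_on_Suc_imp[OF assms(1)] by blast
qed

lemma D_op_Suc: "(D_op ^^ Suc i) f t = d_dt ((D_op ^^ i) f) t / of_real t"
  by (simp add: D_op_def)

lemma D_op_funpow_add:
  assumes S: "open S" "0 \<notin> S" and "smooth_on S f" "smooth_on S g" "t \<in> S"
  shows "(D_op ^^ i) (\<lambda>t. f t + g t) t = (D_op ^^ i) f t + (D_op ^^ i) g t"
  using assms(5)
proof (induction i arbitrary: t)
  case (Suc i)
  have inv: "smooth_on S (\<lambda>t. inverse (of_real t))" using S by (intro smooth_on_intros) auto
  note sm = smooth_on_weighted_deriv[OF S(1) inv assms(3), of i] smooth_on_weighted_deriv[OF S(1) inv assms(4), of i]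
  have "d_dt ((D_op ^^ i) (\<lambda>t. f t + g t)) t = d_dt (\<lambda>t. (D_op ^^ i) f t + (D_op ^^ i) g t) t"
    by (rule d_dt_cong[OF S(1) Suc.IH Suc.prems])
  also have "\<dots> = d_dt ((D_op ^^ i) f) t + d_dt ((D_op ^^ i) g) t"
    using d_dt_add[OF S(1) sm Suc.prems] by (simp add: D_op_weighted_deriv)
  finally show ?case unfolding D_op_Suc by (simp only: add_divide_distrib)
qed simp

lemma smooth_on_D_op:
  assumes "open S" "0 \<notin> S" "smooth_on S f"
  shows "smooth_on S ((D_op ^^ i) f)"
  unfolding D_op_weighted_deriv
  by (rule smooth_on_weighted_deriv[OF assms(1) _ assms(3)]) (use assms in \<open>intro smooth_on_intros; auto\<close>)

lemma D_op_funpow_cong: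
  assumes "open S" "\<And>t. t \<in> S \<Longrightarrow> f t = g t"
  shows "t \<in> S \<Longrightarrow> (D_op ^^ i) f t = (D_op ^^ i) g t"
proof (induction i arbitrary: t)
  case (Suc i)
  from d_dt_cong[OF assms(1) Suc.IH Suc.prems] show ?case by (simp add: D_op_def)
qed (use assms in simp)

lemma D_op_funpow_cmult:
  assumes S: "open S" "0 \<notin> S" and "smooth_on S f" "t \<in> S"
  shows "(D_op ^^ i) (\<lambda>t. c * f t) t = c * (D_op ^^ i) f t"
  using assms(4)
proof (induction i arbitrary: t)
  case (Suc i)
  have "d_dt ((D_op ^^ i) (\<lambda>t. c * f t)) t = d_dt (\<lambda>t. c * (D_op ^^ i) f t) t"
    by (rule d_dt_cong[OF S(1) Suc.IH Suc.prems])
  also have "\<dots> = c * d_dt ((D_op ^^ i) f) t"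
    by (intro d_dt_eqI has_vector_derivative_mult_right)
       (rule smooth_on_deriv[OF smooth_on_D_op[OF S assms(3)] S(1) Suc.prems])
  finally show ?case unfolding D_op_Suc by (simp only: times_divide_eq_right)
qed simp

text \<open>In the application \<open>B i t\<close> integrates F(r) times the i-th coefficient over
  (1 - t, 1), and this is the integral of F(r) times 2^j times the j-th derivative of the polynomial
  at u = t^2. Expanded in powers of t, the integrands are free of t. The factor 2^j reflects that D
  is 2 d/du.\<close>

definition heron_int :: "nat \<Rightarrow> (nat \<Rightarrow> real \<Rightarrow> complex) \<Rightarrow> nat \<Rightarrow> real \<Rightarrow> complex" where
  "heron_int N B j t = (\<Sum>i\<le>2 * N. of_real (2 ^ j * fact (i + j) / fact i * t ^ (2 * i)) * B (i + j) t)"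

text \<open>The product rule, term by term: differentiating \<open>B\<close> gives the boundary
  value at r = 1 - t, and differentiating the powers of t gives t times the integral of the next
  index.\<close>

lemma heron_int_deriv:
  assumes B: "\<And>i. (B i has_vector_derivative G * of_real (coeff (heron_poly N (1 - t)) i)) (at t)"
    and B0: "\<And>i t. 2 * N < i \<Longrightarrow> B i t = 0"
  shows "(heron_int N B j has_vector_derivative
     G * of_real (2 ^ j * poly ((pderiv ^^ j) (heron_poly N (1 - t))) (t\<^sup>2)) + of_real t * heron_int N B (Suc j) t) (at t)"
proof -
  let ?c = "\<lambda>j i. 2 ^ j * fact (i + j) / fact i :: real"
  let ?p = "heron_poly N (1 - t)"
  have D: "(heron_int N B j has_vector_derivative
     (\<Sum>i\<le>2 * N. of_real (?c j i * t ^ (2 * i)) * (G * of_real (coeff ?p (i + j))) + of_real (?c j i * (real (2 * i) * t ^ (2 * i - 1))) * B (i + j) t)) (at t)"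
    unfolding heron_int_def[abs_def]
  proof (rule has_vector_derivative_sum)
    fix i
    have "((\<lambda>t. t ^ (2 * i)) has_real_derivative real (2 * i) * t ^ (2 * i - 1)) (at t)"
      using DERIV_pow[of "2 * i" t] by simp
    from has_vector_derivative_mult[OF has_vector_derivative_of_real[OF DERIV_cmult[OF this, of "?c j i"]] B[of "i + j"]]
    show "((\<lambda>t. of_real (?c j i * t ^ (2 * i)) * B (i + j) t) has_vector_derivative
       of_real (?c j i * t ^ (2 * i)) * (G * of_real (coeff ?p (i + j))) + of_real (?c j i * (real (2 * i) * t ^ (2 * i - 1))) * B (i + j) t) (at t)" .
  qed
  have 1: "(\<Sum>i\<le>2 * N. of_real (?c j i * t ^ (2 * i)) * (G * of_real (coeff ?p (i + j)))) = G * of_real (2 ^ j * poly ((pderiv ^^ j) ?p) (t\<^sup>2))"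
  proof -
    have "poly ((pderiv ^^ j) ?p) (t\<^sup>2) = (\<Sum>i\<le>2 * N. coeff ((pderiv ^^ j) ?p) i * (t\<^sup>2) ^ i)"
    proof -
      have "coeff ((pderiv ^^ j) ?p) i = 0" if "2 * N < i" for i
        using that degree_heron_poly[of N "1 - t"] by (simp add: coeff_pderiv_funpow coeff_eq_0)
      then have "degree ((pderiv ^^ j) ?p) \<le> 2 * N" by (intro degree_le) auto
      then show ?thesis unfolding poly_altdef by (intro sum.mono_neutral_left) (auto simp: coeff_eq_0)
    qed
    then have "G * of_real (2 ^ j * poly ((pderiv ^^ j) ?p) (t\<^sup>2)) = (\<Sum>i\<le>2 * N. G * of_real (2 ^ j * (coeff ((pderiv ^^ j) ?p) i * (t\<^sup>2) ^ i)))"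
      by (simp only: sum_distrib_left of_real_sum)
    also have "\<dots> = (\<Sum>i\<le>2 * N. of_real (?c j i * t ^ (2 * i)) * (G * of_real (coeff ?p (i + j))))"
    proof (rule sum.cong[OF refl])
      fix i
      have "(t\<^sup>2) ^ i = t ^ (2 * i)" by (simp add: power_mult)
      then show "G * of_real (2 ^ j * (coeff ((pderiv ^^ j) ?p) i * (t\<^sup>2) ^ i)) = of_real (?c j i * t ^ (2 * i)) * (G * of_real (coeff ?p (i + j)))"
        unfolding coeff_pderiv_funpow by (simp add: mult_ac del: power_mult)
    qed
    finally show ?thesis ..
  qed
  have 2: "(\<Sum>i\<le>2 * N. of_real (?c j i * (real (2 * i) * t ^ (2 * i - 1))) * B (i + j) t) = of_real t * heron_int N B (Suc j) t"
  proof -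
    let ?g = "\<lambda>i. of_real (?c j i * (real (2 * i) * t ^ (2 * i - 1))) * B (i + j) t"
    \<comment> \<open>The added top term is 0 by \<open>B0\<close>, and the term of index 0 carries
      the factor 0, so the index can be shifted by one.\<close>
    have "(\<Sum>i\<le>2 * N. ?g i) = (\<Sum>i\<le>Suc (2 * N). ?g i)" using B0 by simp
    also have "\<dots> = (\<Sum>i\<le>2 * N. ?g (Suc i))" by (subst sum.atMost_Suc_shift) simp
    also have "\<dots> = of_real t * heron_int N B (Suc j) t"
      unfolding heron_int_def sum_distrib_left
    proof (rule sum.cong[OF refl])
      fix i
      have "?c j (Suc i) * (real (2 * Suc i) * t ^ (2 * Suc i - 1)) = t * (?c (Suc j) i * t ^ (2 * i))"
      proof -
        have r2: "real (2 * Suc i) = 2 * real (Suc i)" by simp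
        have A: "fact (Suc i + j) / fact (Suc i) * real (2 * Suc i) = 2 * (fact (Suc i + j) / fact i :: real)"
          unfolding r2 fact_Suc[of i] by (simp del: of_nat_Suc fact_Suc)
        have "?c j (Suc i) * (real (2 * Suc i) * t ^ (2 * Suc i - 1)) = 2 ^ j * (fact (Suc i + j) / fact (Suc i) * real (2 * Suc i)) * t ^ (2 * Suc i - 1)"
          by (simp only: times_divide_eq_left times_divide_eq_right mult_ac)
        also have "\<dots> = 2 ^ j * (2 * (fact (i + Suc j) / fact i)) * (t * t ^ (2 * i))" unfolding A by simp
        also have "\<dots> = t * (?c (Suc j) i * t ^ (2 * i))"
          by (simp only: times_divide_eq_left times_divide_eq_right mult_ac power_Suc)
        finally show ?thesis .
      qed
      then show "?g (Suc i) = of_real t * (of_real (?c (Suc j) i * t ^ (2 * i)) * B (i + Suc j) t)"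
        by (simp only: mult.assoc[symmetric] of_real_mult[symmetric]) simp
    qed
    finally show ?thesis .
  qed
  show ?thesis using D unfolding sum.distrib 1 2 .
qed

text \<open>Reindexing by the number q = N - l of derivatives; at 1 - t the coefficient (1 - s)^q
  becomes t^q.\<close>

lemma L_op_lop_coeff:
  "of_real (2 ^ N * fact N) * L_op N F (1 - t) = (\<Sum>q\<le>N. of_real (lop_coeff N q) * of_real t ^ q * (D_op ^^ q) F (1 - t))"
proof -
  have "L_op N F (1 - t) = (\<Sum>l\<le>N. of_real (fact (N + l) / (fact (N - l) * fact l * 2 ^ l) * t ^ (N - l)) * (D_op ^^ (N - l)) F (1 - t))"
    unfolding L_op_def atLeast0AtMost by simp
  also have "\<dots> = (\<Sum>q\<le>N. of_real (fact (N + (N - q)) / (fact (N - (N - q)) * fact (N - q) * 2 ^ (N - q)) * t ^ (N - (N - q))) * (D_op ^^ (N - (N - q))) F (1 - t))"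
    using sum.nat_diff_reindex[of "\<lambda>l. of_real (fact (N + l) / (fact (N - l) * fact l * 2 ^ l) * t ^ (N - l)) * (D_op ^^ (N - l)) F (1 - t)" "Suc N"]
    by (simp add: lessThan_Suc_atMost)
  finally have "of_real (2 ^ N * fact N) * L_op N F (1 - t) = (\<Sum>q\<le>N. of_real (2 ^ N * fact N) * (of_real (fact (N + (N - q)) / (fact (N - (N - q)) * fact (N - q) * 2 ^ (N - q)) * t ^ (N - (N - q))) * (D_op ^^ (N - (N - q))) F (1 - t)))"
    by (simp only: sum_distrib_left)
  also have "\<dots> = (\<Sum>q\<le>N. of_real (lop_coeff N q) * of_real t ^ q * (D_op ^^ q) F (1 - t))"
  proof (rule sum.cong[OF refl])
    fix q assume "q \<in> {..N}"
    then obtain d where d: "N = q + d" using le_Suc_ex by auto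
    have e: "N - q = d" "N - d = q" "N + d = 2 * N - q" by (simp_all add: d)
    have "real (N choose q) = fact N / (fact q * fact d)" by (simp add: d binomial_fact)
    then have "lop_coeff N q = 2 ^ N * fact N * (fact (2 * N - q) / (fact q * fact d * 2 ^ d))"
      by (simp add: lop_coeff_def) (simp add: d power_add)
    then show "of_real (2 ^ N * fact N) * (of_real (fact (N + (N - q)) / (fact (N - (N - q)) * fact (N - q) * 2 ^ (N - q)) * t ^ (N - (N - q))) * (D_op ^^ (N - (N - q))) F (1 - t))
       = of_real (lop_coeff N q) * of_real t ^ q * (D_op ^^ q) F (1 - t)"
      unfolding e by (simp only: of_real_mult of_real_power mult.assoc)
  qed
  finally show ?thesis .
qed

text \<open>Each D passes from one index to the next and leaves the boundary value
  \<open>b j\<close> behind for the remaining applications of D. These are the left side of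
  \<open>iterated_D_identity\<close>, which converts them into \<open>L_op\<close>.\<close>

lemma heron_int_ode:
  fixes F :: "real \<Rightarrow> complex"
  assumes F: "smooth_on {0<..<1} F" and N: "N = m + k"
    and B: "\<And>i t. t \<in> {0<..<1} \<Longrightarrow> (B i has_vector_derivative F (1 - t) * of_real (coeff (heron_poly N (1 - t)) i)) (at t)"
    and B0: "\<And>i t. 2 * N < i \<Longrightarrow> B i t = 0"
  shows "smooth_on {0<..<1} (heron_int N B m)"
    and "t \<in> {0<..<1} \<Longrightarrow> d_dt ((D_op ^^ (m + 2 * k)) (heron_int N B m)) t =
      of_real ((-1) ^ N * 4 ^ N * (2 ^ N * fact N) / t ^ (2 * N)) * L_op N (\<lambda>r. of_real r ^ (2 * N) * F r) (1 - t)"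
proof -
  let ?S = "{0<..<1::real}"
  have S: "open ?S" "0 \<notin> ?S" by auto
  note si = smooth_on_intros[OF S(1)]
  have reflF: "smooth_on ?S (\<lambda>t. F (1 - t))" using smooth_on_reflect[OF F] by simp
  have co: "smooth_on ?S (\<lambda>t. of_real (coeff (heron_poly N (1 - t)) i))" for i
    using smooth_on_reflect[OF smooth_on_coeff_heron_poly[of ?S N i]] by simp
  have Bs: "smooth_on ?S (B i)" for i
    by (rule smooth_on_antiderivative[OF S(1)], rule B, assumption) (intro si(5) reflF co)
  have smI: "smooth_on ?S (heron_int N B j)" for j
  proof -
    have "smooth_on ?S (\<lambda>t. \<Sum>i\<le>2 * N. (of_real (2 ^ j * fact (i + j) / fact i) * of_real t ^ (2 * i)) * B (i + j) t)"
      by (intro smooth_on_sum S si Bs)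
    then show ?thesis by (simp add: heron_int_def[abs_def])
  qed
  then show "smooth_on ?S (heron_int N B m)" .
  define P where "P j t = 2 ^ j * poly ((pderiv ^^ j) (heron_poly N (1 - t))) (t\<^sup>2)" for j t
  define b where "b j t = F (1 - t) * of_real (P j t) * inverse (of_real t)" for j t
  have smP: "smooth_on ?S (\<lambda>t. of_real (P j t))" for j
  proof -
    have s1: "smooth_on ?S (\<lambda>t. of_real 4 * (1 - of_real t))" by (intro si)
    have "smooth_on ?S (\<lambda>t. of_real (2 ^ j * (fact j * real (N choose (j - N)) * (-1) ^ (j - N))) * (of_real 4 * (1 - of_real t)) ^ (2 * N - j))"
      by (intro si(5) si(1) si(6) s1)
    then have "smooth_on ?S (\<lambda>t. of_real (2 ^ j * (if N \<le> j \<and> j \<le> 2 * N then fact j * real (N choose (j - N)) * (-1) ^ (j - N) * (4 * (1 - t)) ^ (2 * N - j) else 0)))"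
    proof (cases "N \<le> j \<and> j \<le> 2 * N")
      case True
      assume "smooth_on ?S (\<lambda>t. of_real (2 ^ j * (fact j * real (N choose (j - N)) * (-1) ^ (j - N))) * (of_real 4 * (1 - of_real t)) ^ (2 * N - j))"
      then show ?thesis unfolding if_P[OF True] by (simp add: mult.assoc)
    next
      case False
      show ?thesis unfolding if_not_P[OF False] using si(1)[of 0] by simp
    qed
    then show ?thesis unfolding P_def poly_pderiv_heron_poly .
  qed
  have smb: "smooth_on ?S (b j)" for j
    unfolding b_def[abs_def] by (intro si(5) reflF smP si(7) si(2)) auto
  have dI: "d_dt (heron_int N B j) t = of_real t * (b j t + heron_int N B (Suc j) t)" if t: "t \<in> ?S" for j t
  proof -
    have "(heron_int N B j has_vector_derivative F (1 - t) * of_real (P j t) + of_real t * heron_int N B (Suc j) t) (at t)"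
      unfolding P_def by (rule heron_int_deriv[OF B[OF t] B0])
    from d_dt_eqI[OF this] have "d_dt (heron_int N B j) t = F (1 - t) * of_real (P j t) + of_real t * heron_int N B (Suc j) t" .
    moreover have "of_real t * b j t = F (1 - t) * of_real (P j t)" using t by (simp add: b_def)
    ultimately show ?thesis by (simp only: distrib_left)
  qed
  have DI: "(D_op ^^ i) (heron_int N B j) t = heron_int N B (j + i) t + (\<Sum>l<i. (D_op ^^ (i - 1 - l)) (b (j + l)) t)"
    if "t \<in> ?S" for i j t
    using that
  proof (induction i arbitrary: j t)
    case (Suc i)
    have "(D_op ^^ Suc i) (heron_int N B j) t = (D_op ^^ i) (D_op (heron_int N B j)) t" by (simp add: funpow_swap1)
    also have "\<dots> = (D_op ^^ i) (\<lambda>t. b j t + heron_int N B (Suc j) t) t"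
      by (rule D_op_funpow_cong[OF S(1) _ Suc.prems]) (use dI S in \<open>simp add: D_op_def\<close>)
    also have "\<dots> = (D_op ^^ i) (b j) t + (D_op ^^ i) (heron_int N B (Suc j)) t"
      by (rule D_op_funpow_add[OF S smb smI Suc.prems])
    also have "\<dots> = heron_int N B (j + Suc i) t + ((D_op ^^ i) (b j) t + (\<Sum>l<i. (D_op ^^ (i - 1 - l)) (b (Suc j + l)) t))"
      unfolding Suc.IH[OF Suc.prems] by simp
    also have "(D_op ^^ i) (b j) t + (\<Sum>l<i. (D_op ^^ (i - 1 - l)) (b (Suc j + l)) t) = (\<Sum>l<Suc i. (D_op ^^ (Suc i - 1 - l)) (b (j + l)) t)"
    proof -
      have e: "Suc i - 1 - Suc l = i - 1 - l" "j + Suc l = Suc j + l" "Suc i - 1 - 0 = i" "j + 0 = j" for l by simp_all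
      show ?thesis by (simp only: sum.lessThan_Suc_shift e)
    qed
    finally show ?case .
  qed simp
  assume t: "t \<in> ?S"
  have t0: "t \<noteq> 0" using t by auto
  have b_low: "b j = (\<lambda>t. 0)" if "j < N" for j
    using that by (simp add: b_def[abs_def] P_def poly_pderiv_heron_poly)
  have b_high: "heron_int N B (2 * N + 1) t = 0"
    unfolding heron_int_def using B0 by simp
  have D0: "(D_op ^^ i) (\<lambda>t. 0) = (\<lambda>t. 0)" for i
    by (induction i) (simp_all add: D_op_def[abs_def] d_dt_const)
  have bq: "(D_op ^^ q) (b (2 * N - q)) t = of_real ((-1) ^ N * 4 ^ N) * ((-1) ^ q * of_real (lop_coeff N q) * (D_op ^^ q) (\<lambda>t. F (1 - t) * of_real (1 - t) ^ q * inverse (of_real t)) t)"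
    if q: "q \<le> N" for q
  proof -
    \<comment> \<open>The identity \<open>2 ^ (2 * N - q) * 4 ^ q = 4 ^ N * 2 ^ q\<close> splits off
      the constant 4^N and leaves precisely \<open>lop_coeff N q\<close>.\<close>
    have P: "P (2 * N - q) s = (-1) ^ N * 4 ^ N * ((-1) ^ q * lop_coeff N q) * (1 - s) ^ q" for s
    proof -
      obtain d where d: "N = q + d" using q le_Suc_ex by auto
      have e: "2 * N - q - N = d" "2 * N - (2 * N - q) = q" "2 * N - q = q + 2 * d" by (simp_all add: d)
      have ch: "(N choose d) = (N choose q)" using binomial_symmetric[of q N] q by (simp add: d)
      have sg: "(-1) ^ d = (-1) ^ N * ((-1) ^ q :: real)" by (simp add: d power_add mult.commute flip: power_mult_distrib)
      have p2: "2 ^ (2 * N - q) * 4 ^ q = (4 ^ N * 2 ^ q :: real)"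
      proof -
        have "(4::real) ^ j = 2 ^ (2 * j)" for j by (simp add: power_mult)
        then show ?thesis unfolding e(3) by (simp add: d algebra_simps flip: power_add)
      qed
      have "poly ((pderiv ^^ (2 * N - q)) (heron_poly N (1 - s))) (s\<^sup>2) = fact (2 * N - q) * real (N choose d) * (-1) ^ d * (4 * (1 - s)) ^ q"
      proof -
        have "N \<le> 2 * N - q \<and> 2 * N - q \<le> 2 * N" using q by arith
        then show ?thesis unfolding poly_pderiv_heron_poly by (simp only: if_True e(1,2) simp_thms)
      qed
      then have "P (2 * N - q) s = 2 ^ (2 * N - q) * (fact (2 * N - q) * real (N choose q) * ((-1) ^ N * (-1) ^ q) * (4 ^ q * (1 - s) ^ q))"
        unfolding P_def ch sg power_mult_distrib by (simp only:)
      also have "\<dots> = (2 ^ (2 * N - q) * 4 ^ q) * (fact (2 * N - q) * real (N choose q) * ((-1) ^ N * (-1) ^ q) * (1 - s) ^ q)"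
        by (simp only: mult_ac)
      finally show ?thesis unfolding p2 lop_coeff_def by (simp only: mult_ac)
    qed
    have "(D_op ^^ q) (b (2 * N - q)) t = (D_op ^^ q) (\<lambda>t. (of_real ((-1) ^ N * 4 ^ N) * ((-1) ^ q * of_real (lop_coeff N q))) * (F (1 - t) * of_real (1 - t) ^ q * inverse (of_real t))) t"
      unfolding b_def[abs_def] P by (simp add: mult_ac)
    also have "\<dots> = (of_real ((-1) ^ N * 4 ^ N) * ((-1) ^ q * of_real (lop_coeff N q))) * (D_op ^^ q) (\<lambda>t. F (1 - t) * of_real (1 - t) ^ q * inverse (of_real t)) t"
    proof (rule D_op_funpow_cmult[OF S _ t])
      have "smooth_on ?S (\<lambda>t. of_real (1 - t))" using si(4)[OF si(1)[of 1] si(2)] by simp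
      then show "smooth_on ?S (\<lambda>t. F (1 - t) * of_real (1 - t) ^ q * inverse (of_real t))"
        by (intro si(5) si(6) si(7) si(2) reflF) auto
    qed
    finally show ?thesis by (simp only: mult.assoc)
  qed
  let ?i = "m + 2 * k"
  have "D_op ((D_op ^^ ?i) (heron_int N B m)) t = (D_op ^^ Suc ?i) (heron_int N B m) t" by simp
  also have "\<dots> = (\<Sum>l<Suc ?i. (D_op ^^ (Suc ?i - 1 - l)) (b (m + l)) t)"
  proof -
    \<comment> \<open>Starting from index m, one more than m + 2k steps reach 2N + 1, which exceeds
      the degree 2N in u.\<close>
    have e: "m + Suc ?i = 2 * N + 1" by (simp add: N)
    show ?thesis unfolding DI[OF t] e b_high by simp
  qed
  also have "\<dots> = (\<Sum>q\<le>?i. (D_op ^^ q) (b (2 * N - q)) t)"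
  proof -
    have "(\<Sum>l\<le>?i. (D_op ^^ (?i - l)) (b (m + l)) t) = (\<Sum>q\<le>?i. (D_op ^^ (?i - (?i - q))) (b (m + (?i - q))) t)"
      using sum.nat_diff_reindex[of "\<lambda>l. (D_op ^^ (?i - l)) (b (m + l)) t" "Suc ?i"] by (simp add: lessThan_Suc_atMost)
    also have "\<dots> = (\<Sum>q\<le>?i. (D_op ^^ q) (b (2 * N - q)) t)"
      by (rule sum.cong[OF refl]) (auto simp: N)
    finally show ?thesis by (simp add: lessThan_Suc_atMost)
  qed
  \<comment> \<open>Terms with q > N belong to indices below N, where the zero of order N at r = 1 -
    t kills the boundary value.\<close>
  also have "\<dots> = (\<Sum>q\<le>N. (D_op ^^ q) (b (2 * N - q)) t)"
  proof (rule sum.mono_neutral_right)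
    show "{..N} \<subseteq> {..?i}" by (auto simp: N)
    show "\<forall>q\<in>{..?i} - {..N}. (D_op ^^ q) (b (2 * N - q)) t = 0"
    proof
      fix q assume "q \<in> {..?i} - {..N}"
      then have "2 * N - q < N" by (auto simp: N)
      from b_low[OF this] show "(D_op ^^ q) (b (2 * N - q)) t = 0" by (simp add: D0)
    qed
  qed simp
  also have "\<dots> = of_real ((-1) ^ N * 4 ^ N) * (\<Sum>q\<le>N. (-1) ^ q * of_real (lop_coeff N q) * (D_op ^^ q) (\<lambda>t. F (1 - t) * of_real (1 - t) ^ q * inverse (of_real t)) t)"
    unfolding sum_distrib_left by (rule sum.cong[OF refl]) (use bq in auto)
  finally have D: "D_op ((D_op ^^ ?i) (heron_int N B m)) t = of_real ((-1) ^ N * 4 ^ N) * (\<Sum>q\<le>N. (-1) ^ q * of_real (lop_coeff N q) * (D_op ^^ q) (\<lambda>t. F (1 - t) * of_real (1 - t) ^ q * inverse (of_real t)) t)" (is "_ = _ * ?X") .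
  have X: "?X = of_real (2 ^ N * fact N) * L_op N (\<lambda>r. of_real r ^ (2 * N) * F r) (1 - t) / of_real t ^ (2 * N + 1)"
    using iterated_D_identity[OF F t, of N] t0 unfolding L_op_lop_coeff by (simp add: eq_divide_eq mult.commute del: power_Suc)
  have "d_dt ((D_op ^^ ?i) (heron_int N B m)) t = of_real t * D_op ((D_op ^^ ?i) (heron_int N B m)) t"
    using t0 by (simp add: D_op_def)
  also have "\<dots> = of_real ((-1) ^ N * 4 ^ N * (2 ^ N * fact N) / t ^ (2 * N)) * L_op N (\<lambda>r. of_real r ^ (2 * N) * F r) (1 - t)"
    unfolding D X using t0 by (simp add: field_simps)
  finally show "d_dt ((D_op ^^ ?i) (heron_int N B m)) t =
      of_real ((-1) ^ N * 4 ^ N * (2 ^ N * fact N) / t ^ (2 * N)) * L_op N (\<lambda>r. of_real r ^ (2 * N) * F r) (1 - t)" .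
qed

section \<open>Uniqueness\<close>

text \<open>Gronwall in both directions: exp(-K r) v decreases to the right of \<open>r0\<close>,
  and exp(K r) v increases up to \<open>r0\<close>.\<close>

lemma zero_if_deriv_le:
  fixes v v' :: "real \<Rightarrow> real"
  assumes der: "\<And>r. r \<in> {a..b} \<Longrightarrow> (v has_real_derivative v' r) (at r)"
    and bound: "\<And>r. r \<in> {a..b} \<Longrightarrow> \<bar>v' r\<bar> \<le> K * v r"
    and nonneg: "\<And>r. v r \<ge> 0" and r0: "r0 \<in> {a..b}" "v r0 = 0" and r: "r \<in> {a..b}"
  shows "v r = 0"
proof -
  have "v r \<le> 0"
  proof (cases "r0 \<le> r")
    case True
    have "exp (- K * r) * v r \<le> exp (- K * r0) * v r0"
    proof (rule DERIV_nonpos_imp_nonincreasing[OF True])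
      fix x assume x: "r0 \<le> x" "x \<le> r"
      have "((\<lambda>x. exp (- K * x)) has_real_derivative exp (- K * x) * - K) (at x)"
        by (auto intro!: derivative_eq_intros)
      from DERIV_mult[OF this der[of x]] x r r0
      have "((\<lambda>x. exp (- K * x) * v x) has_real_derivative exp (- K * x) * (v' x - K * v x)) (at x)"
        by (simp add: algebra_simps)
      moreover have "exp (- K * x) * (v' x - K * v x) \<le> 0"
        using bound[of x] x r r0 by (intro mult_nonneg_nonpos) auto
      ultimately show "\<exists>y. ((\<lambda>x. exp (- K * x) * v x) has_real_derivative y) (at x) \<and> y \<le> 0" by blast
    qed
    then show ?thesis using r0 by (simp add: mult_le_0_iff)
  next
    case False
    then have "r \<le> r0" by simp
    have "exp (K * r) * v r \<le> exp (K * r0) * v r0"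
    proof (rule DERIV_nonneg_imp_nondecreasing[OF \<open>r \<le> r0\<close>])
      fix x assume x: "r \<le> x" "x \<le> r0"
      have "((\<lambda>x. exp (K * x)) has_real_derivative exp (K * x) * K) (at x)"
        by (auto intro!: derivative_eq_intros)
      from DERIV_mult[OF this der[of x]] x r r0
      have "((\<lambda>x. exp (K * x) * v x) has_real_derivative exp (K * x) * (v' x + K * v x)) (at x)"
        by (simp add: algebra_simps)
      moreover have "exp (K * x) * (v' x + K * v x) \<ge> 0"
        using bound[of x] x r r0 by (intro mult_nonneg_nonneg) auto
      ultimately show "\<exists>y. ((\<lambda>x. exp (K * x) * v x) has_real_derivative y) (at x) \<and> y \<ge> 0" by blast
    qed
    then show ?thesis using r0 by (simp add: mult_le_0_iff)
  qed
  with nonneg[of r] show ?thesis by simp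
qed

text \<open>Gronwall for the sum v of the squared norms. Since the square of a sum of N terms is at
  most N times the sum of squares, |v'| is bounded by 2 C N v.\<close>

lemma linear_system_zero:
  fixes z z' :: "nat \<Rightarrow> real \<Rightarrow> complex"
  assumes der: "\<And>q r. q < N \<Longrightarrow> r \<in> {a..b} \<Longrightarrow> (z q has_vector_derivative z' q r) (at r)"
    and bound: "\<And>q r. q < N \<Longrightarrow> r \<in> {a..b} \<Longrightarrow> norm (z' q r) \<le> C * (\<Sum>p<N. norm (z p r))"
    and C: "C \<ge> 0" and r0: "r0 \<in> {a..b}" "\<And>q. q < N \<Longrightarrow> z q r0 = 0" and r: "r \<in> {a..b}" and q: "q < N"
  shows "z q r = 0"
proof -
  define v where "v r = (\<Sum>q<N. z q r \<bullet> z q r)" for r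
  define v' where "v' r = (\<Sum>q<N. z q r \<bullet> z' q r + z' q r \<bullet> z q r)" for r
  have "v r = 0"
  proof (rule zero_if_deriv_le[where v=v and r=r and ?r0.0=r0 and a=a and b=b and v'=v' and K="2 * C * real N"])
    show "(v has_real_derivative v' r) (at r)" if "r \<in> {a..b}" for r
      unfolding v_def[abs_def] v'_def has_real_derivative_iff_has_vector_derivative
      by (intro has_vector_derivative_sum bounded_bilinear.has_vector_derivative[OF bounded_bilinear_inner] der that) auto
    show "\<bar>v' r\<bar> \<le> 2 * C * real N * v r" if "r \<in> {a..b}" for r
    proof -
      let ?s = "\<Sum>p<N. norm (z p r)"
      have "\<bar>v' r\<bar> \<le> (\<Sum>q<N. \<bar>z q r \<bullet> z' q r + z' q r \<bullet> z q r\<bar>)"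
        unfolding v'_def by (rule sum_abs)
      also have "\<dots> \<le> (\<Sum>q<N. 2 * C * ?s * norm (z q r))"
      proof (rule sum_mono)
        fix q assume "q \<in> {..<N}"
        then have q: "q < N" by simp
        have "\<bar>z q r \<bullet> z' q r + z' q r \<bullet> z q r\<bar> = 2 * \<bar>z q r \<bullet> z' q r\<bar>"
          by (simp add: inner_commute)
        also have "\<dots> \<le> 2 * (norm (z q r) * norm (z' q r))" using Cauchy_Schwarz_ineq2[of "z q r" "z' q r"] by simp
        also have "\<dots> \<le> 2 * (norm (z q r) * (C * ?s))"
          using bound[OF q that] by (intro mult_left_mono) auto
        finally show "\<bar>z q r \<bullet> z' q r + z' q r \<bullet> z q r\<bar> \<le> 2 * C * ?s * norm (z q r)" by (simp add: mult_ac)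
      qed
      also have "\<dots> = 2 * C * ?s\<^sup>2" by (simp add: power2_eq_square flip: sum_distrib_left)
      also have "\<dots> \<le> 2 * C * (real N * (\<Sum>p<N. (norm (z p r))\<^sup>2))"
        using sum_squared_le_sum_of_squares[of "\<lambda>p. norm (z p r)" "{..<N}"] C by (intro mult_left_mono) (auto simp: mult.commute)
      also have "(\<Sum>p<N. (norm (z p r))\<^sup>2) = v r" unfolding v_def by (simp add: dot_square_norm)
      finally show ?thesis by (simp add: mult.assoc)
    qed
    show "v r0 = 0" unfolding v_def using r0 by simp
    show "v r \<ge> 0" for r unfolding v_def by (intro sum_nonneg) auto
  qed (use r r0 in auto)
  then have "\<forall>q\<in>{..<N}. z q r \<bullet> z q r = 0"
    unfolding v_def by (subst (asm) sum_nonneg_eq_0_iff) auto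
  then show ?thesis using q by simp
qed

text \<open>The initial conditions in a form that passes through sums, products and D.\<close>

definition flat_at :: "nat \<Rightarrow> (real \<Rightarrow> complex) \<Rightarrow> real \<Rightarrow> bool" where
  "flat_at n f x \<longleftrightarrow> (\<forall>i<n. (d_dt ^^ i) f x = 0)"

lemma flat_at_Suc: "flat_at (Suc n) f x \<longleftrightarrow> f x = 0 \<and> flat_at n (d_dt f) x"
  unfolding flat_at_def by (auto simp: less_Suc_eq_0_disj funpow_swap1)

lemma flat_at_le: "flat_at n f x \<Longrightarrow> m \<le> n \<Longrightarrow> flat_at m f x"
  by (auto simp: flat_at_def)

lemma flat_at_cong:
  assumes "open S" "\<And>x. x \<in> S \<Longrightarrow> f x = g x" "x \<in> S"
  shows "flat_at n f x \<longleftrightarrow> flat_at n g x"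
  using d_dt_funpow_cong[OF assms] by (simp add: flat_at_def)

lemma flat_at_add:
  assumes S: "open S" "x \<in> S"
  shows "C_k_on n f S \<Longrightarrow> C_k_on n g S \<Longrightarrow> flat_at n f x \<Longrightarrow> flat_at n g x \<Longrightarrow> flat_at n (\<lambda>x. f x + g x) x"
proof (induction n arbitrary: f g)
  case (Suc n)
  note [simp] = C_k_on_Suc_iff[OF S(1)]
  have "flat_at n (\<lambda>x. d_dt f x + d_dt g x) x"
    by (rule Suc.IH) (use Suc.prems in \<open>auto simp: flat_at_Suc\<close>)
  moreover have "d_dt (\<lambda>x. f x + g x) y = d_dt f y + d_dt g y" if "y \<in> S" for y
    by (rule d_dt_eqI, rule has_vector_derivative_add) (use Suc.prems that in auto)
  ultimately have "flat_at n (d_dt (\<lambda>x. f x + g x)) x"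
    by (subst flat_at_cong[OF S(1) _ S(2)]) auto
  then show ?case using Suc.prems by (simp add: flat_at_Suc)
qed (simp add: flat_at_def)

lemma flat_at_mult:
  assumes S: "open S" "x \<in> S"
  shows "C_k_on n f S \<Longrightarrow> C_k_on n g S \<Longrightarrow> flat_at n f x \<Longrightarrow> flat_at n (\<lambda>x. f x * g x) x"
proof (induction n arbitrary: f g)
  case (Suc n)
  note iff = C_k_on_Suc_iff[OF S(1)]
  have low: "C_k_on n f S" "C_k_on n g S" "C_k_on n (d_dt f) S" "C_k_on n (d_dt g) S" "flat_at n f x" "flat_at n (d_dt f) x"
    using Suc.prems C_k_on_Suc_imp[OF S(1)] iff flat_at_le[of "Suc n" f x n] by (auto simp: flat_at_Suc)
  have "flat_at n (\<lambda>x. f x * d_dt g x + d_dt f x * g x) x"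
    by (intro flat_at_add[OF S] C_k_on_mult[OF S(1)] Suc.IH low)
  moreover have "d_dt (\<lambda>x. f x * g x) y = f y * d_dt g y + d_dt f y * g y" if "y \<in> S" for y
    by (rule d_dt_eqI, rule has_vector_derivative_mult) (use Suc.prems iff that in auto)
  ultimately have "flat_at n (d_dt (\<lambda>x. f x * g x)) x"
    by (subst flat_at_cong[OF S(1) _ S(2)]) auto
  then show ?case using Suc.prems by (simp add: flat_at_Suc)
qed (simp add: flat_at_def)

lemma C_k_on_D_op:
  assumes S: "open S" "0 \<notin> S"
  shows "C_k_on (Suc k) f S \<Longrightarrow> C_k_on k (D_op f) S"
proof -
  assume "C_k_on (Suc k) f S"
  then have "C_k_on k (\<lambda>x. d_dt f x * inverse (of_real x)) S"
    by (intro C_k_on_mult C_k_on_inverse C_k_on_of_real S) (use C_k_on_Suc_iff[OF S(1)] S in auto)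
  then show ?thesis by (simp add: D_op_def[abs_def] divide_inverse)
qed

lemma C_k_on_D_op_funpow:
  assumes S: "open S" "0 \<notin> S"
  shows "C_k_on (k + q) f S \<Longrightarrow> C_k_on k ((D_op ^^ q) f) S"
proof (induction q arbitrary: k)
  case (Suc q)
  then show ?case using C_k_on_D_op[OF S] by simp
qed simp

text \<open>Each D costs one order of vanishing and one order of differentiability.\<close>

lemma flat_at_D_op_funpow:
  assumes S: "open S" "0 \<notin> S" "x \<in> S"
  shows "C_k_on (n + q) f S \<Longrightarrow> flat_at (n + q) f x \<Longrightarrow> flat_at n ((D_op ^^ q) f) x"
proof (induction q arbitrary: n)
  case (Suc q)
  let ?g = "(D_op ^^ q) f"
  have g: "C_k_on (Suc n) ?g S" "flat_at (Suc n) ?g x"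
    using Suc.prems by (auto intro!: C_k_on_D_op_funpow[OF S(1,2)] Suc.IH)
  have "flat_at n (\<lambda>x. d_dt ?g x * inverse (of_real x)) x"
    by (intro flat_at_mult[OF S(1,3)] C_k_on_inverse C_k_on_of_real S(1)) (use g C_k_on_Suc_iff[OF S(1)] S in \<open>auto simp: flat_at_Suc\<close>)
  then show ?case by (simp add: D_op_def[abs_def] divide_inverse)
qed simp

lemma D_op_funpow_diff:
  assumes S: "open S" "0 \<notin> S"
  shows "C_k_on q f S \<Longrightarrow> C_k_on q g S \<Longrightarrow> t \<in> S \<Longrightarrow> (D_op ^^ q) (\<lambda>t. f t - g t) t = (D_op ^^ q) f t - (D_op ^^ q) g t"
proof (induction q arbitrary: t)
  case (Suc q)
  have IH: "(D_op ^^ q) (\<lambda>t. f t - g t) t = (D_op ^^ q) f t - (D_op ^^ q) g t" if "t \<in> S" for t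
    by (rule Suc.IH[OF C_k_on_Suc_imp[OF S(1) Suc.prems(1)] C_k_on_Suc_imp[OF S(1) Suc.prems(2)] that])
  have "d_dt ((D_op ^^ q) (\<lambda>t. f t - g t)) t = d_dt (\<lambda>t. (D_op ^^ q) f t - (D_op ^^ q) g t) t"
    by (rule d_dt_cong[OF S(1) IH Suc.prems(3)])
  also have "\<dots> = d_dt ((D_op ^^ q) f) t - d_dt ((D_op ^^ q) g) t"
    by (intro d_dt_eqI has_vector_derivative_diff C_k_on_deriv[of 0, OF C_k_on_D_op_funpow[OF S] S(1)])
       (use Suc.prems in auto)
  finally show ?case unfolding D_op_Suc by (simp only: diff_divide_distrib)
qed simp

lemma L_op_diff:
  assumes S: "open S" "0 \<notin> S" and "C_k_on N f S" "C_k_on N g S" "s \<in> S"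
  shows "L_op N (\<lambda>t. f t - g t) s = L_op N f s - L_op N g s"
proof -
  have "(D_op ^^ (N - l)) (\<lambda>t. f t - g t) s = (D_op ^^ (N - l)) f s - (D_op ^^ (N - l)) g s" for l
    by (rule D_op_funpow_diff[OF S]) (use assms C_k_on_le[OF S(1)] in \<open>auto\<close>)
  then show ?thesis unfolding L_op_def by (simp add: right_diff_distrib sum_subtractf)
qed

text \<open>With H = r^M G and z_q = D^q H one has z_q' = r z_(q+1), and the equation expresses z_N
  through z_0, ..., z_(N-1), because its leading coefficient (1 - s)^N is nonzero for s < 1. Only
  derivatives up to order N occur, which matches the class C^N.\<close>

lemma L_op_zero_imp_zero:
  fixes G :: "real \<Rightarrow> complex"
  assumes \<epsilon>: "0 < \<epsilon>" and G: "C_k_on N G {\<epsilon><..<1}"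
    and L: "\<And>s. s \<in> {\<epsilon><..<1} \<Longrightarrow> L_op N (\<lambda>r. of_real (r ^ M) * G r) s = 0"
    and r0: "r0 \<in> {\<epsilon><..<1}" "flat_at N G r0" and r: "r \<in> {\<epsilon><..<1}"
  shows "G r = 0"
proof -
  let ?S = "{\<epsilon><..<1}"
  have S: "open ?S" "0 \<notin> ?S" using \<epsilon> by auto
  define H where "H r = of_real (r ^ M) * G r" for r
  have CM: "C_k_on k (\<lambda>r. complex_of_real (r ^ M)) ?S" for k
    using C_k_on_power[OF S(1) C_k_on_of_real[OF S(1)], of k M] by simp
  have H: "C_k_on N H ?S" unfolding H_def[abs_def] by (intro C_k_on_mult[OF S(1)] CM G)
  have flatH: "flat_at N H r0"
    using flat_at_mult[OF S(1) r0(1) G CM r0(2)] by (simp add: H_def[abs_def] mult.commute)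
  define z where "z q = (D_op ^^ q) H" for q
  define c where "c l s = fact (N + l) / (fact (N - l) * fact l * 2 ^ l) * (1 - s) ^ (N - l)" for l and s :: real
  have Lz: "(\<Sum>l\<le>N. of_real (c l s) * z (N - l) s) = 0" if "s \<in> ?S" for s
    using L[OF that] unfolding L_op_def H_def[symmetric] z_def c_def atLeast0AtMost .
  have zN: "(1 - s) ^ N * norm (z N s) \<le> (\<Sum>l=1..N. \<bar>c l s\<bar> * norm (z (N - l) s))" if "s \<in> ?S" for s
  proof -
    \<comment> \<open>The term \<open>l = 0\<close> is the only one that contains D^N; it is
      isolated to bound \<open>z N\<close>.\<close>
    have "{..N} = insert 0 {1..N}" by auto
    then have "of_real (c 0 s) * z N s + (\<Sum>l=1..N. of_real (c l s) * z (N - l) s) = 0"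
      using Lz[OF that] by simp
    then have "of_real (c 0 s) * z N s = - (\<Sum>l=1..N. of_real (c l s) * z (N - l) s)"
      by (simp only: eq_neg_iff_add_eq_0)
    then have "norm (of_real (c 0 s) * z N s) = norm (\<Sum>l=1..N. of_real (c l s) * z (N - l) s)" by (simp only: norm_minus_cancel)
    also have "\<dots> \<le> (\<Sum>l=1..N. norm (of_real (c l s) * z (N - l) s))" by (rule norm_sum)
    finally have "\<bar>c 0 s\<bar> * norm (z N s) \<le> (\<Sum>l=1..N. \<bar>c l s\<bar> * norm (z (N - l) s))"
      by (simp only: norm_mult norm_of_real)
    moreover have "\<bar>c 0 s\<bar> = (1 - s) ^ N" using that by (simp add: c_def)
    ultimately show ?thesis by simp
  qed
  have "H r = 0"
  proof (cases "N = 0")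
    case True
    with Lz[OF r] show ?thesis by (simp add: z_def c_def)
  next
    case False
    \<comment> \<open>The compact interval between the two points; \<open>b < 1\<close> keeps (1 -
      s)^N away from 0.\<close>
    define a b where "a = min r r0" and "b = max r r0"
    have ab: "{a..b} \<subseteq> ?S" "r \<in> {a..b}" "r0 \<in> {a..b}" "b < 1" using r r0 by (auto simp: a_def b_def min_def max_def)
    define A where "A = (\<Sum>l=1..N. fact (N + l) / (fact (N - l) * fact l * 2 ^ l) :: real)"
    \<comment> \<open>The summand 1 serves the equations with q + 1 < N, the second one bounds
      \<open>z N\<close> in the last equation.\<close>
    define C where "C = 1 + A / (1 - b) ^ N"
    have A: "A \<ge> 0" unfolding A_def by (intro sum_nonneg) auto
    have C: "C \<ge> 1" using A ab(4) by (simp add: C_def)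
    have zq: "norm (z (Suc q) s) \<le> C * (\<Sum>p<N. norm (z p s))" if q: "q < N" and s: "s \<in> {a..b}" for q s
    proof -
      let ?s = "\<Sum>p<N. norm (z p s)"
      have s0: "?s \<ge> 0" by (intro sum_nonneg) auto
      have s1: "0 \<le> 1 - s" "1 - s \<le> 1" "1 - b \<le> 1 - s" using s ab \<epsilon> by auto
      have le: "norm (z p s) \<le> ?s" if "p < N" for p
        by (rule member_le_sum[where f="\<lambda>p. norm (z p s)"]) (use that in auto)
      show ?thesis
      proof (cases "Suc q < N")
        case True
        have "norm (z (Suc q) s) \<le> 1 * ?s" using le[OF True] by simp
        also have "\<dots> \<le> C * ?s" using C s0 by (intro mult_right_mono)
        finally show ?thesis .
      next
        case False
        with q have "Suc q = N" by simp
        have "(1 - b) ^ N * norm (z N s) \<le> (1 - s) ^ N * norm (z N s)"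
          using s1 ab(4) by (intro mult_right_mono power_mono) auto
        also have "\<dots> \<le> (\<Sum>l=1..N. \<bar>c l s\<bar> * norm (z (N - l) s))" using zN s ab by blast
        also have "\<dots> \<le> (\<Sum>l=1..N. fact (N + l) / (fact (N - l) * fact l * 2 ^ l) * ?s)"
        proof (rule sum_mono)
          fix l assume l: "l \<in> {1..N}"
          have "\<bar>c l s\<bar> = fact (N + l) / (fact (N - l) * fact l * 2 ^ l) * (1 - s) ^ (N - l)"
            using s1 by (simp add: c_def abs_mult)
          also have "\<dots> \<le> fact (N + l) / (fact (N - l) * fact l * 2 ^ l)"
            using s1 by (intro mult_right_le_one_le power_le_one) auto
          finally show "\<bar>c l s\<bar> * norm (z (N - l) s) \<le> fact (N + l) / (fact (N - l) * fact l * 2 ^ l) * ?s"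
            using l False by (intro mult_mono le) auto
        qed
        also have "\<dots> = A * ?s" by (simp add: A_def sum_distrib_right)
        finally have "norm (z N s) \<le> A / (1 - b) ^ N * ?s" using ab(4) by (simp add: field_simps)
        also have "\<dots> \<le> C * ?s" using s0 by (intro mult_right_mono) (auto simp: C_def)
        finally show ?thesis using \<open>Suc q = N\<close> by simp
      qed
    qed
    have "z 0 r = 0"
    proof (rule linear_system_zero[where z=z and z'="\<lambda>q s. of_real s * z (Suc q) s" and C=C and a=a and b=b and N=N and r=r and ?r0.0=r0 and q=0])
      fix q s assume q: "q < N" and s: "s \<in> {a..b}"
      have "s \<in> ?S" using s ab by auto
      then have s0: "s \<noteq> 0" "\<bar>s\<bar> \<le> 1" using \<epsilon> by auto
      have "C_k_on (Suc (N - Suc q)) (z q) ?S"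
        unfolding z_def using H q by (intro C_k_on_D_op_funpow[OF S]) simp
      from C_k_on_deriv[OF this S(1) \<open>s \<in> ?S\<close>]
      show "(z q has_vector_derivative of_real s * z (Suc q) s) (at s)"
        using s0 by (simp add: z_def D_op_def)
      have "norm (of_real s * z (Suc q) s) \<le> 1 * norm (z (Suc q) s)"
        unfolding norm_mult norm_of_real using s0 by (intro mult_right_mono) auto
      also have "\<dots> \<le> C * (\<Sum>p<N. norm (z p s))" using zq[OF q s] by simp
      finally show "norm (of_real s * z (Suc q) s) \<le> C * (\<Sum>p<N. norm (z p s))" .
    next
      fix q assume q: "q < N"
      have "flat_at (N - q) (z q) r0"
        unfolding z_def by (rule flat_at_D_op_funpow[OF S r0(1)]) (use H flatH q in auto)
      then show "z q r0 = 0" using q by (auto simp: flat_at_def dest!: spec[of _ 0])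
    qed (use C ab False in auto)
    then show ?thesis by (simp add: z_def)
  qed
  then show ?thesis using r \<epsilon> by (simp add: H_def)
qed

section \<open>Smoothness of the coefficients of \<open>f\<close> and continuity of those of its
  means\<close>

lemma has_vector_derivative_ray:
  fixes f :: "'a::euclidean_space \<Rightarrow> complex"
  assumes "f differentiable (at (t *\<^sub>R \<omega>))"
  shows "((\<lambda>t. f (t *\<^sub>R \<omega>)) has_vector_derivative (\<Sum>b\<in>Basis. (\<omega> \<bullet> b) *\<^sub>R dir_deriv b f (t *\<^sub>R \<omega>))) (at t)"
proof -
  have "((\<lambda>s::real. f (t *\<^sub>R \<omega> + s *\<^sub>R \<omega>)) has_vector_derivative dir_deriv \<omega> f (t *\<^sub>R \<omega>)) (at 0)"
    by (rule dir_deriv_vector_derivative[OF assms])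
  then have "((\<lambda>t. f (t *\<^sub>R \<omega>)) has_vector_derivative dir_deriv \<omega> f (t *\<^sub>R \<omega>)) (at t)"
    by (simp add: has_vector_derivative_iff_quotient scaleR_add_left)
  then show ?thesis using dir_deriv_sum_basis[OF assms, of \<omega>] by simp
qed

text \<open>A radial derivative produces factors \<open>\<omega> \<bullet> b\<close>, which are
  absorbed into the continuous function \<open>q\<close>; hence the induction runs over all
  \<open>f\<close> and \<open>q\<close> at once.\<close>

lemma C_k_on_ball_coeff:
  fixes f :: "'a::euclidean_space \<Rightarrow> complex"
  assumes "\<And>k. C_k_on k f (ball 0 1)" and q: "continuous_on UNIV q"
  shows "C_k_on k (\<lambda>r. LINT \<omega>|sphere_measure. f (r *\<^sub>R \<omega>) * q \<omega>) {-1<..<1}"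
proof -
  let ?S = "sphere_measure :: 'a measure"
  have der: "((\<lambda>r. LINT \<omega>|?S. f (r *\<^sub>R \<omega>) * q \<omega>) has_vector_derivative
      (\<Sum>b\<in>Basis. LINT \<omega>|?S. dir_deriv b f (r *\<^sub>R \<omega>) * ((\<omega> \<bullet> b) *\<^sub>R q \<omega>))) (at r)"
    if f: "\<And>k. C_k_on k f (ball 0 1)" and q: "continuous_on UNIV q" and r: "r \<in> {-1<..<1}" for f q :: "'a \<Rightarrow> complex" and r :: real
  proof -
    have cf: "continuous_on (ball 0 1) f" using f[of 0] by simp
    have df: "f differentiable (at x)" if "x \<in> ball 0 1" for x
      using f[of "Suc 0"] that unfolding C_k_on.simps by blast
    have cd: "continuous_on (ball 0 1) (dir_deriv b f)" if "b \<in> Basis" for b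
      using f[of "Suc 0"] that unfolding C_k_on.simps by blast
    \<comment> \<open>The derivatives of \<open>f\<close> are bounded on smaller closed balls, not
      necessarily on the open unit ball; such a ball is fixed around the sphere of radius
      |r|.\<close>
    obtain \<rho> where \<rho>: "\<bar>r\<bar> < \<rho>" "\<rho> < 1" using r dense[of "\<bar>r\<bar>" 1] by (auto simp: abs_less_iff)
    have in_ball: "t *\<^sub>R \<omega> \<in> ball 0 1" "t *\<^sub>R \<omega> \<in> cball 0 \<rho>" if "t \<in> {-\<rho><..<\<rho>}" "\<omega> \<in> sphere 0 1" for t and \<omega> :: 'a
      using that \<rho> by auto
    have csub: "cball (0::'a) \<rho> \<subseteq> ball 0 1" using \<rho> by auto
    have ccomp: "continuous_on (sphere 0 1) (\<lambda>\<omega>. g (t *\<^sub>R \<omega>))" if "continuous_on (ball 0 1) g" "t \<in> {-\<rho><..<\<rho>}" for g :: "'a \<Rightarrow> complex" and t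
      by (rule continuous_on_compose2[OF that(1)]) (use in_ball that in \<open>auto intro!: continuous_intros\<close>)
    have cqs: "continuous_on (sphere 0 1) q" by (rule continuous_on_subset[OF q]) simp
    have bdd: "\<exists>B. \<forall>x\<in>K. norm (g x) \<le> B" if "continuous_on K g" "compact K" for g :: "'a \<Rightarrow> complex" and K
      using compact_imp_bounded[OF compact_continuous_image[OF that]] by (auto simp: bounded_iff)
    have "\<exists>B. \<forall>x\<in>cball 0 \<rho>. norm (dir_deriv b f x) \<le> B" if "b \<in> Basis" for b
      by (rule bdd[OF continuous_on_subset[OF cd[OF that] csub] compact_cball])
    then obtain B where B: "\<And>b x. b \<in> Basis \<Longrightarrow> x \<in> cball 0 \<rho> \<Longrightarrow> norm (dir_deriv b f x) \<le> B b" by metis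
    obtain Bq where Bq: "\<And>x. x \<in> sphere 0 1 \<Longrightarrow> norm (q x) \<le> Bq" using bdd[OF cqs compact_sphere] by blast
    let ?F' = "\<lambda>t \<omega>. (\<Sum>b\<in>Basis. (\<omega> \<bullet> b) *\<^sub>R dir_deriv b f (t *\<^sub>R \<omega>)) * q \<omega>"
    have cF': "continuous_on (sphere 0 1) (?F' t)" if "t \<in> {-\<rho><..<\<rho>}" for t
      by (intro continuous_on_mult[OF _ cqs] continuous_on_sum continuous_on_scaleR ccomp[OF cd that] continuous_on_inner
          continuous_on_id continuous_on_const)
    have "((\<lambda>r. LINT \<omega>|?S. f (r *\<^sub>R \<omega>) * q \<omega>) has_vector_derivative (LINT \<omega>|?S. ?F' r \<omega>)) (at r)"
    proof (rule has_vector_derivative_integral[where a="-\<rho>" and b=\<rho> and w="\<lambda>_. (\<Sum>b\<in>Basis. B b) * Bq"])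
      show "r \<in> {-\<rho><..<\<rho>}" using \<rho> by auto
      then show "?F' r \<in> borel_measurable ?S" by (intro borel_measurable_integrable integrable_sphere_measure cF')
      show "integrable ?S (\<lambda>\<omega>. f (t *\<^sub>R \<omega>) * q \<omega>)" if "t \<in> {-\<rho><..<\<rho>}" for t
        by (intro integrable_sphere_measure continuous_on_mult[OF ccomp[OF cf that] cqs])
      show "integrable ?S (\<lambda>_. (\<Sum>b\<in>Basis. B b) * Bq)"
        using finite_measure.integrable_const[OF finite_measure_sphere] .
      fix t and \<omega> :: 'a assume t: "t \<in> {-\<rho><..<\<rho>}" and "\<omega> \<in> space ?S"
      then have w: "\<omega> \<in> sphere 0 1" by (simp add: space_sphere_measure)
      show "((\<lambda>t. f (t *\<^sub>R \<omega>) * q \<omega>) has_vector_derivative ?F' t \<omega>) (at t)"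
        by (intro has_vector_derivative_mult_left has_vector_derivative_ray df in_ball(1)[OF t w])
      have "norm (\<Sum>b\<in>Basis. (\<omega> \<bullet> b) *\<^sub>R dir_deriv b f (t *\<^sub>R \<omega>)) \<le> (\<Sum>b\<in>Basis. B b)"
      proof (rule sum_norm_le)
        fix b :: 'a assume b: "b \<in> Basis"
        have "\<bar>\<omega> \<bullet> b\<bar> \<le> 1" using Basis_le_norm[OF b, of \<omega>] w by simp
        then have "norm ((\<omega> \<bullet> b) *\<^sub>R dir_deriv b f (t *\<^sub>R \<omega>)) \<le> 1 * B b"
          unfolding norm_scaleR using B[OF b in_ball(2)[OF t w]] by (intro mult_mono) auto
        then show "norm ((\<omega> \<bullet> b) *\<^sub>R dir_deriv b f (t *\<^sub>R \<omega>)) \<le> B b" by simp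
      qed
      then show "norm (?F' t \<omega>) \<le> (\<Sum>b\<in>Basis. B b) * Bq"
        unfolding norm_mult using Bq[OF w] order_trans[OF norm_ge_zero] by (intro mult_mono) auto
    qed
    also have "(LINT \<omega>|?S. ?F' r \<omega>) = (LINT \<omega>|?S. (\<Sum>b\<in>Basis. dir_deriv b f (r *\<^sub>R \<omega>) * ((\<omega> \<bullet> b) *\<^sub>R q \<omega>)))"
      by (simp add: sum_distrib_right)
    also have "\<dots> = (\<Sum>b\<in>Basis. LINT \<omega>|?S. dir_deriv b f (r *\<^sub>R \<omega>) * ((\<omega> \<bullet> b) *\<^sub>R q \<omega>))"
      by (intro Bochner_Integration.integral_sum integrable_sphere_measure continuous_on_mult ccomp cd continuous_on_scaleR cqs continuous_on_inner
          continuous_on_id continuous_on_const) (use \<rho> in auto)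
    finally show ?thesis .
  qed
  have S: "open {-1<..<1::real}" by simp
  show ?thesis using assms
  proof (induction k arbitrary: f q)
    case 0
    then show ?case
      by (auto simp: continuous_on_eq_continuous_at intro!: has_vector_derivative_continuous[OF der])
  next
    case (Suc k)
    show ?case
    proof (rule C_k_on_SucI[OF S der])
      show "C_k_on k (\<lambda>r. \<Sum>b\<in>Basis. LINT \<omega>|?S. dir_deriv b f (r *\<^sub>R \<omega>) * ((\<omega> \<bullet> b) *\<^sub>R q \<omega>)) {-1<..<1}"
      proof (rule C_k_on_sum[OF S], rule Suc.IH)
        fix b :: 'a and k assume "b \<in> Basis"
        then show "C_k_on k (dir_deriv b f) (ball 0 1)"
          using Suc.prems(1)[of "Suc k"] unfolding C_k_on.simps by blast
        show "continuous_on UNIV (\<lambda>\<omega>. (\<omega> \<bullet> b) *\<^sub>R q \<omega>)"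
          by (intro continuous_on_scaleR Suc.prems(2) continuous_on_inner continuous_on_id continuous_on_const)
      qed
    qed (use Suc.prems in auto)
  qed
qed

text \<open>The fundamental lemma for the real and imaginary parts of the difference; it suffices
  since the test functions are real.\<close>

lemma continuous_eq_if_weak_eq:
  fixes A B :: "real \<Rightarrow> complex"
  assumes A: "continuous_on {0<..<1} A" and B: "continuous_on {0<..<1} B"
    and weak: "\<And>\<eta> a b. continuous_on UNIV \<eta> \<Longrightarrow> 0 < a \<Longrightarrow> b < 1 \<Longrightarrow> (\<And>t. t \<notin> {a..b} \<Longrightarrow> \<eta> t = 0) \<Longrightarrow>
        (LINT t:{0<..<1}|lborel. of_real (\<eta> t) * A t) = (LINT t:{0<..<1}|lborel. of_real (\<eta> t) * B t)"
    and t0: "t0 \<in> {0<..<1}"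
  shows "A t0 = B t0"
proof -
  have zero: "(LINT t:{0<..<1}|lborel. of_real (\<eta> t) * (A t - B t)) = 0"
    and int: "set_integrable lborel {0<..<1} (\<lambda>t. of_real (\<eta> t) * (A t - B t))"
    if \<eta>: "continuous_on UNIV \<eta>" "0 < a" "b < 1" "\<And>t. t \<notin> {a..b} \<Longrightarrow> \<eta> t = 0" for \<eta> :: "real \<Rightarrow> real" and a b
  proof -
    have sub: "{a..b} \<subseteq> {0<..<1}" using \<eta> by auto
    have i: "set_integrable lborel {0<..<1} (\<lambda>t. of_real (\<eta> t) * C t)" if C: "continuous_on {0<..<1} C" for C :: "real \<Rightarrow> complex"
    proof -
      have "continuous_on {a..b} (\<lambda>t. of_real (\<eta> t) * C t)"
        by (rule continuous_on_mult[OF continuous_on_of_real[OF continuous_on_subset[OF \<eta>(1)]] continuous_on_subset[OF C sub]]) simp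
      from borel_integrable_atLeastAtMost'[OF this]
      have "integrable lborel (\<lambda>t. indicator {a..b} t *\<^sub>R (of_real (\<eta> t) * C t))" by (simp add: set_integrable_def)
      also have "(\<lambda>t. indicator {a..b} t *\<^sub>R (of_real (\<eta> t) * C t)) = (\<lambda>t. indicator {0<..<1} t *\<^sub>R (of_real (\<eta> t) * C t))"
        using \<eta>(4) sub by (fastforce simp: indicator_def)
      finally show ?thesis by (simp add: set_integrable_def)
    qed
    show "set_integrable lborel {0<..<1} (\<lambda>t. of_real (\<eta> t) * (A t - B t))"
      by (rule i, rule continuous_on_diff[OF A B])
    show "(LINT t:{0<..<1}|lborel. of_real (\<eta> t) * (A t - B t)) = 0"
      using set_integral_diff(2)[OF i[OF A] i[OF B]] weak[OF \<eta>] by (simp add: right_diff_distrib)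
  qed
  have "Re (A t0 - B t0) = 0"
  proof (rule continuous_zero_if_weak_zero[OF _ _ t0])
    show "continuous_on {0<..<1} (\<lambda>t. Re (A t - B t))" by (intro continuous_on_Re continuous_on_diff A B)
    fix \<eta> :: "real \<Rightarrow> real" and a b
    assume \<eta>: "continuous_on UNIV \<eta>" "0 < a" "b < 1" "\<And>t. t \<notin> {a..b} \<Longrightarrow> \<eta> t = 0"
    have "Re (LINT t:{0<..<1}|lborel. of_real (\<eta> t) * (A t - B t)) = (LINT t:{0<..<1}|lborel. \<eta> t * Re (A t - B t))"
      using int[OF \<eta>] unfolding set_lebesgue_integral_def set_integrable_def by (subst integral_Re[symmetric]) auto
    then show "(LINT t:{0<..<1}|lborel. \<eta> t * Re (A t - B t)) = 0" using zero[OF \<eta>] by simp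
  qed
  moreover have "Im (A t0 - B t0) = 0"
  proof (rule continuous_zero_if_weak_zero[OF _ _ t0])
    show "continuous_on {0<..<1} (\<lambda>t. Im (A t - B t))" by (intro continuous_on_Im continuous_on_diff A B)
    fix \<eta> :: "real \<Rightarrow> real" and a b
    assume \<eta>: "continuous_on UNIV \<eta>" "0 < a" "b < 1" "\<And>t. t \<notin> {a..b} \<Longrightarrow> \<eta> t = 0"
    have "Im (LINT t:{0<..<1}|lborel. of_real (\<eta> t) * (A t - B t)) = (LINT t:{0<..<1}|lborel. \<eta> t * Im (A t - B t))"
      using int[OF \<eta>] unfolding set_lebesgue_integral_def set_integrable_def by (subst integral_Im[symmetric]) auto
    then show "(LINT t:{0<..<1}|lborel. \<eta> t * Im (A t - B t)) = 0" using zero[OF \<eta>] by simp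
  qed
  ultimately show ?thesis by (simp add: complex_eq_iff)
qed

text \<open>Dominated convergence in both sphere integrals. Continuity in \<open>t\<close> is what
  later turns the weak formula into a pointwise one.\<close>

lemma continuous_on_mean_coeff:
  fixes f q :: "'a::euclidean_space \<Rightarrow> complex"
  assumes f: "continuous_on UNIV f" "\<And>x. norm x \<ge> 1 \<Longrightarrow> f x = 0" and q: "continuous_on UNIV q"
  shows "continuous_on UNIV (\<lambda>t. LINT \<theta>|sphere_measure. (LINT \<omega>|sphere_measure. f (\<theta> + t *\<^sub>R \<omega>)) * q \<theta>)"
proof -
  let ?S = "sphere_borel :: 'a measure"
  interpret S: finite_measure ?S by (rule finite_measures_aux)
  have mf [measurable]: "f \<in> borel_measurable borel" and mq: "q \<in> borel_measurable borel"
    using f q by (auto intro: borel_measurable_continuous_onI)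
  obtain Bf where Bf: "\<And>x. norm (f x) \<le> Bf" "Bf \<ge> 0"
    by (rule continuous_bounded_support[OF f(1), where c=1]) (use f(2) in auto)
  define q' where "q' x = indicator (sphere 0 1) x * q x" for x
  have [measurable]: "q' \<in> borel_measurable borel" unfolding q'_def[abs_def]
    by (rule borel_measurable_times[OF borel_measurable_indicator[OF borel_closed[OF closed_sphere]] mq])
  have "compact (q ` sphere 0 1)" by (intro compact_continuous_image continuous_on_subset[OF q]) auto
  then obtain Bq0 where "\<And>x. x \<in> sphere 0 1 \<Longrightarrow> norm (q x) \<le> Bq0" by (metis compact_imp_bounded bounded_iff image_eqI)
  then obtain Bq where Bq: "\<And>x. norm (q' x) \<le> Bq" "Bq \<ge> 0"
    by (intro that[of "max 0 Bq0"]) (auto simp: q'_def indicator_def le_max_iff_disj)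
  define I where "I t \<theta> = (LINT \<omega>|?S. f (\<theta> + t *\<^sub>R \<omega>))" for t \<theta>
  have mI [measurable]: "(\<lambda>\<theta>. I t \<theta>) \<in> borel_measurable borel" for t
    unfolding I_def by (rule S.borel_measurable_lebesgue_integral) measurable
  have cI: "continuous_on UNIV (\<lambda>t. I t \<theta>)" for \<theta>
    unfolding I_def
  proof (rule continuous_on_lebesgue_integral[OF finite_measures_aux(3), where B=Bf])
    show "continuous_on UNIV (\<lambda>t. f (\<theta> + t *\<^sub>R x))" for x
      by (rule continuous_on_compose2[OF f(1)]) (auto intro!: continuous_intros)
  qed (use Bf in auto)
  define CS where "CS = measure ?S (space ?S)"
  have BI: "norm (I t \<theta>) \<le> Bf * CS" for t \<theta>
  proof -
    have "norm (I t \<theta>) \<le> (LINT \<omega>|?S. norm (f (\<theta> + t *\<^sub>R \<omega>)))" unfolding I_def by (rule integral_norm_bound)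
    also have "\<dots> \<le> (LINT \<omega>|?S. Bf)"
      by (rule integral_mono) (auto intro!: S.integrable_const_bound[where B=Bf] Bf)
    finally show ?thesis by (simp add: CS_def mult_ac)
  qed
  have "continuous_on UNIV (\<lambda>t. LINT \<theta>|?S. I t \<theta> * q' \<theta>)"
  proof (rule continuous_on_lebesgue_integral[OF finite_measures_aux(3), where B="Bf * CS * Bq"])
    show "continuous_on UNIV (\<lambda>t. I t \<theta> * q' \<theta>)" for \<theta> by (rule continuous_on_mult_right[OF cI])
    show "norm (I t \<theta> * q' \<theta>) \<le> Bf * CS * Bq" for t \<theta>
      unfolding norm_mult using BI[of t \<theta>] Bq Bf by (intro mult_mono) (auto simp: CS_def)
    show "(\<lambda>\<theta>. I t \<theta> * q' \<theta>) \<in> borel_measurable ?S" for t by measurable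
  qed
  moreover have "(LINT \<theta>|?S. I t \<theta> * q' \<theta>) = (LINT \<theta>|sphere_measure. (LINT \<omega>|sphere_measure. f (\<theta> + t *\<^sub>R \<omega>)) * q \<theta>)" for t
  proof -
    have "(LINT \<theta>|?S. I t \<theta> * q' \<theta>) = (LINT \<theta>|sphere_measure. I t \<theta> * q' \<theta>)" by (rule integral_sphere_borel) measurable
    also have "\<dots> = (LINT \<theta>|sphere_measure. (LINT \<omega>|sphere_measure. f (\<theta> + t *\<^sub>R \<omega>)) * q \<theta>)"
    proof (rule Bochner_Integration.integral_cong[OF refl])
      fix \<theta> :: 'a assume "\<theta> \<in> space sphere_measure"
      moreover have "I t \<theta> = (LINT \<omega>|sphere_measure. f (\<theta> + t *\<^sub>R \<omega>))" unfolding I_def by (rule integral_sphere_borel) measurable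
      ultimately show "I t \<theta> * q' \<theta> = (LINT \<omega>|sphere_measure. f (\<theta> + t *\<^sub>R \<omega>)) * q \<theta>" by (simp add: space_sphere_measure q'_def)
    qed
    finally show ?thesis .
  qed
  ultimately show ?thesis by simp
qed

section \<open>The Funk--Hecke kernel in terms of the Heron polynomial\<close>

lemma poly_pderiv_heron_sum:
  "2 ^ j * poly ((pderiv ^^ j) (heron_poly N r)) u = (\<Sum>i\<le>2 * N. 2 ^ j * fact (i + j) / fact i * u ^ i * coeff (heron_poly N r) (i + j))"
proof -
  have "coeff ((pderiv ^^ j) (heron_poly N r)) i = 0" if "2 * N < i" for i
    using that degree_heron_poly[of N r] by (simp add: coeff_pderiv_funpow coeff_eq_0)
  then have "degree ((pderiv ^^ j) (heron_poly N r)) \<le> 2 * N" by (intro degree_le) auto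
  then have "poly ((pderiv ^^ j) (heron_poly N r)) u = (\<Sum>i\<le>2 * N. coeff ((pderiv ^^ j) (heron_poly N r)) i * u ^ i)"
    unfolding poly_altdef by (intro sum.mono_neutral_left) (auto simp: coeff_eq_0)
  then show ?thesis by (simp add: coeff_pderiv_funpow sum_distrib_left mult_ac)
qed

lemma pderiv_funpow_pcompose_linear:
  "(pderiv ^^ m) (pcompose p [:a, b:]) = smult (b ^ m) (pcompose ((pderiv ^^ m) p) [:a, b:])" for p :: "real poly"
  by (induction m) (simp_all add: pderiv_smult pderiv_pcompose pderiv_pCons mult.commute)

text \<open>For s = (1 + r^2 - u)/(2r) the quantity 1 - s^2 is the Heron base divided by 4 r^2. The
  chain rule factor (-1/(2r))^m cancels the sign in Rodrigues' formula and m of the 2(m + k) powers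
  of r.\<close>

lemma fh_kernel_heron_poly:
  assumes r: "r > 0"
  shows "r ^ (m + 2 * k) * poly (fh_kernel k m) ((1 + r\<^sup>2 - u) / (2 * r)) =
    fh_const k m / 4 ^ (m + k) * (2 ^ m * poly ((pderiv ^^ m) (heron_poly (m + k) r)) u)"
proof -
  let ?N = "m + k" and ?X = "[:(1 + r\<^sup>2) / (2 * r), - (1 / (2 * r)):]"
  have base: "[:- ((1 - r)\<^sup>2), 1:] * [:(1 + r)\<^sup>2, -1:] = smult (4 * r\<^sup>2) (pcompose poly_W ?X)"
    using r by (simp add: poly_eq_poly_eq_iff[symmetric] fun_eq_iff poly_pcompose) (simp add: field_simps power2_eq_square)
  have pw: "pcompose (q ^ N) s = pcompose q s ^ N" for q s :: "real poly" and N
    by (induction N) (simp_all add: pcompose_mult pcompose_1)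
  have "heron_poly ?N r = smult ((4 * r\<^sup>2) ^ ?N) (pcompose (poly_W ^ ?N) ?X)"
    unfolding heron_poly_def base smult_power pw ..
  then have "poly ((pderiv ^^ m) (heron_poly ?N r)) u = (4 * r\<^sup>2) ^ ?N * ((- (1 / (2 * r))) ^ m * poly ((pderiv ^^ m) (poly_W ^ ?N)) (poly ?X u))"
  proof -
    have "(pderiv ^^ m) (smult c p) = smult c ((pderiv ^^ m) p)" for c and p :: "real poly"
      by (induction m) (simp_all add: pderiv_smult)
    then show ?thesis using \<open>heron_poly ?N r = _\<close> by (simp add: pderiv_funpow_pcompose_linear poly_pcompose)
  qed
  also have "poly ?X u = (1 + r\<^sup>2 - u) / (2 * r)" using r by (simp add: field_simps)
  finally have H: "poly ((pderiv ^^ m) (heron_poly ?N r)) u = (4 * r\<^sup>2) ^ ?N * ((- (1 / (2 * r))) ^ m * poly ((pderiv ^^ m) (poly_W ^ ?N)) ((1 + r\<^sup>2 - u) / (2 * r)))" .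
  have e1: "2 ^ m * (- (1 / (2 * r))) ^ m = (-1) ^ m / r ^ m"
  proof -
    have "2 ^ m * (- (1 / (2 * r))) ^ m = (2 * (- (1 / (2 * r)))) ^ m" by (rule power_mult_distrib[symmetric])
    also have "2 * (- (1 / (2 * r))) = (-1) / r" by simp
    finally show ?thesis unfolding power_divide .
  qed
  have e2: "(4 * r\<^sup>2) ^ ?N = 4 ^ ?N * (r ^ (m + 2 * k) * r ^ m)"
  proof -
    have "(r\<^sup>2) ^ ?N = r ^ (m + 2 * k) * r ^ m" by (simp add: mult_2 flip: power_mult power_add) (simp add: algebra_simps)
    then show ?thesis by (simp add: power_mult_distrib)
  qed
  let ?P = "poly ((pderiv ^^ m) (poly_W ^ ?N)) ((1 + r\<^sup>2 - u) / (2 * r))"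
  have "fh_const k m / 4 ^ ?N * (2 ^ m * poly ((pderiv ^^ m) (heron_poly ?N r)) u) = fh_const k m / 4 ^ ?N * ((4 * r\<^sup>2) ^ ?N * ((2 ^ m * (- (1 / (2 * r))) ^ m) * ?P))"
    unfolding H by (simp only: mult_ac)
  also have "\<dots> = r ^ (m + 2 * k) * ((-1) ^ m * fh_const k m * ?P)"
    unfolding e1 e2 using r by simp
  finally show ?thesis by (simp add: fh_kernel_def)
qed

lemma has_vector_derivative_integral_lower:
  fixes G :: "real \<Rightarrow> complex"
  assumes G: "continuous_on {0<..1} G" and t: "t \<in> {0<..<1}"
  shows "((\<lambda>t. LINT r:{1 - t..1}|lborel. G r) has_vector_derivative G (1 - t)) (at t)"
proof -
  \<comment> \<open>\<open>G\<close> is controlled on (0, 1] only, so a lower limit strictly between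
    0 and 1 - t is fixed.\<close>
  define a where "a = (1 - t) / 2"
  have a: "0 < a" "a < 1 - t" "1 - t < 1" using t by (auto simp: a_def)
  have c: "continuous_on {a..1} G" by (rule continuous_on_subset[OF G]) (use a in auto)
  have "((\<lambda>u. integral {a..u} G) has_vector_derivative G (1 - t)) (at (1 - t) within {a..1})"
    by (rule integral_has_vector_derivative[OF c]) (use a in auto)
  then have "((\<lambda>u. integral {a..u} G) has_vector_derivative G (1 - t)) (at (1 - t) within {a<..<1})"
    by (rule has_vector_derivative_within_subset) auto
  then have "((\<lambda>u. integral {a..u} G) has_vector_derivative G (1 - t)) (at (1 - t))"
    by (subst (asm) has_vector_derivative_within_open) (use a in auto)
  from has_vector_derivative_reflect[OF this]
  have "((\<lambda>t. integral {a..1} G - integral {a..1 - t} G) has_vector_derivative 0 - (- G (1 - t))) (at t)"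
    by (intro has_vector_derivative_diff has_vector_derivative_const)
  then have D: "((\<lambda>t. integral {a..1} G - integral {a..1 - t} G) has_vector_derivative G (1 - t)) (at t)" by simp
  show ?thesis
  proof (rule has_vector_derivative_transform_within_open[OF D, of "{0<..<1 - a}"])
    show "open {0<..<1 - a}" "t \<in> {0<..<1 - a}" using t a by auto
    fix s assume s: "s \<in> {0<..<1 - a}"
    have "integral {a..1 - s} G + integral {1 - s..1} G = integral {a..1} G"
      by (rule Henstock_Kurzweil_Integration.integral_combine) (use s in \<open>auto intro: integrable_continuous_real[OF c]\<close>)
    moreover have "(LINT r:{1 - s..1}|lborel. G r) = integral {1 - s..1} G"
      by (rule set_borel_integral_eq_integral(2)[OF borel_integrable_atLeastAtMost'[OF continuous_on_subset[OF c]]]) (use s in auto)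
    ultimately show "integral {a..1} G - integral {a..1 - s} G = (LINT r:{1 - s..1}|lborel. G r)" by (simp add: algebra_simps)
  qed
qed

lemma C_k_on_open_subset:
  fixes f :: "real \<Rightarrow> complex"
  assumes "open S" "open T" "T \<subseteq> S"
  shows "C_k_on k f S \<Longrightarrow> C_k_on k f T"
proof (induction k arbitrary: f)
  case (Suc k)
  then show ?case using assms by (auto simp: C_k_on_Suc_iff)
qed (use assms continuous_on_subset in auto)

lemma smooth_on_open_subset: "smooth_on S f \<Longrightarrow> open S \<Longrightarrow> open T \<Longrightarrow> T \<subseteq> S \<Longrightarrow> smooth_on T f"
  unfolding smooth_on_def using C_k_on_open_subset by blast

text \<open>All derivatives vanish to the right of \<open>c\<close> and are continuous at
  \<open>c\<close>. In this way the support condition on \<open>f\<close> yields the initial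
  conditions at the single point 1 - epsilon'.\<close>

lemma flat_at_if_zero_right:
  assumes f: "smooth_on {a<..<b} f" and c: "a < c" "c < b" and zero: "\<And>x. x \<in> {c<..<b} \<Longrightarrow> f x = 0"
  shows "flat_at n f c"
  unfolding flat_at_def
proof (intro allI impI)
  fix i
  have "smooth_on {a<..<b} ((d_dt ^^ i) f)" by (rule smooth_on_d_dt_funpow[OF _ f]) simp
  from smooth_on_deriv[OF this] c have "isCont ((d_dt ^^ i) f) c"
    by (intro has_vector_derivative_continuous) auto
  then have "((d_dt ^^ i) f \<longlongrightarrow> (d_dt ^^ i) f c) (at_right c)"
    unfolding isCont_def by (rule filterlim_mono) (auto simp: at_le)
  moreover have "((d_dt ^^ i) f \<longlongrightarrow> 0) (at_right c)"
  proof (rule tendsto_eventually)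
    have "(d_dt ^^ i) f x = 0" if x: "x \<in> {c<..<b}" for x
    proof -
      have "(d_dt ^^ i) f x = (d_dt ^^ i) (\<lambda>x. 0) x" by (rule d_dt_funpow_cong[OF _ _ x]) (use zero in auto)
      also have "(d_dt ^^ i) (\<lambda>x. 0) = (\<lambda>x. 0)" by (induction i) (simp_all add: d_dt_const)
      finally show ?thesis .
    qed
    then show "\<forall>\<^sub>F x in at_right c. (d_dt ^^ i) f x = 0"
      using c by (auto simp: eventually_at_right_field)
  qed
  ultimately show "(d_dt ^^ i) f c = 0" by (rule tendsto_unique[rotated]) simp
qed

section \<open>The recovery theorem\<close>

text \<open>The extra factor r in \<open>F\<close> fits the weights together: r^(2k+1) times the
  coefficient of \<open>f\<close> is r^(m+2k) F(r), and r^(m+2k) is the power that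
  \<open>fh_kernel_heron_poly\<close> consumes.\<close>

lemma spherical_mean_coeff:
  fixes f q :: "'a::euclidean_space \<Rightarrow> complex"
  assumes dim: "DIM('a) = 2 * k + 3" and q: "harmonic_polynomial m q"
    and f: "\<And>k. C_k_on k f (ball 0 1)" and c: "0 < c" "c < 1" and f0: "\<And>x. norm x \<ge> c \<Longrightarrow> f x = 0"
  defines "F \<equiv> \<lambda>r. of_real r * ((LINT \<omega>|sphere_measure. f (r *\<^sub>R \<omega>) * q \<omega>) / of_real (r ^ m))"
  obtains B where
    "\<And>i t. t \<in> {0<..<1} \<Longrightarrow> (B i has_vector_derivative F (1 - t) * of_real (coeff (heron_poly (m + k) (1 - t)) i)) (at t)"
    "\<And>i t. 2 * (m + k) < i \<Longrightarrow> B i t = 0"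
    "smooth_on {0<..<1} F"
    "\<And>t. t \<in> {0<..<1} \<Longrightarrow>
       of_real (t ^ (2 * k + 1)) * (LINT \<theta>|sphere_measure. (LINT \<omega>|sphere_measure. f (\<theta> + t *\<^sub>R \<omega>)) * q \<theta>)
       = of_real (sphere_area (2 * k + 2) * (fh_const k m / 4 ^ (m + k))) * heron_int (m + k) B m t"
proof -
  let ?N = "m + k" and ?S = "{0<..<1::real}"
  define \<phi> where "\<phi> r = (LINT \<omega>|sphere_measure. f (r *\<^sub>R \<omega>) * q \<omega>)" for r
  have S: "open ?S" by simp
  note si = smooth_on_intros[OF S]
  have cq: "continuous_on X q" for X by (rule harmonic_polynomial_continuous[OF q])
  have f1: "f x = 0" if "norm x \<ge> 1" for x using f0[of x] that c by simp
  have cf: "continuous_on UNIV f"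
  proof -
    \<comment> \<open>The open ball and the complement of the smaller closed ball cover the space,
      so the extension by zero is continuous.\<close>
    have "continuous_on (ball 0 1) f" using f[of 0] by simp
    moreover have "continuous_on (- cball 0 c) f"
      by (rule continuous_on_eq[OF continuous_on_const[of _ 0]]) (use f0 in auto)
    ultimately have "continuous_on (ball 0 1 \<union> - cball 0 c) f"
      by (intro continuous_on_open_Un) auto
    moreover have "ball 0 1 \<union> - cball (0::'a) c = UNIV" using c by auto
    ultimately show ?thesis by simp
  qed
  have smooth_\<phi>: "smooth_on {-1<..<1} \<phi>"
    unfolding smooth_on_def \<phi>_def[abs_def] using C_k_on_ball_coeff[OF f cq] by blast
  have \<phi>0: "\<phi> r = 0" if "r \<ge> c" for r
  proof -
    have "\<phi> r = (LINT \<omega>|(sphere_measure :: 'a measure). 0)" unfolding \<phi>_def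
      by (rule Bochner_Integration.integral_cong[OF refl]) (use that c f0 in \<open>auto simp: space_sphere_measure\<close>)
    then show ?thesis by simp
  qed
  have F: "F r = of_real r * (\<phi> r * inverse (of_real r ^ m))" for r
    by (simp add: F_def \<phi>_def divide_inverse)
  have smF: "smooth_on ?S F"
    unfolding F[abs_def]
    by (intro si(5) si(2) si(7) si(6) smooth_on_open_subset[OF smooth_\<phi>]) auto
  \<comment> \<open>Continuity up to r = 1, the fixed end of all integrals over
    \<open>{1 - t..1}\<close>; beyond \<open>c\<close> the function is 0.\<close>
  have cF: "continuous_on {0<..1} F"
  proof -
    have "continuous_on ?S F" using C_k_on_continuous[OF smooth_on_C_k[OF smF] S] .
    moreover have "continuous_on {c<..} F"
      by (rule continuous_on_eq[OF continuous_on_const[of _ 0]]) (use \<phi>0 in \<open>auto simp: F\<close>)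
    ultimately have "continuous_on (?S \<union> {c<..}) F" by (intro continuous_on_open_Un) auto
    then show ?thesis by (rule continuous_on_subset) (use c in auto)
  qed
  have cco: "continuous_on {0<..1} (\<lambda>r. complex_of_real (coeff (heron_poly ?N r) i))" for i
    using C_k_on_continuous[OF smooth_on_C_k[OF smooth_on_coeff_heron_poly[of UNIV ?N i]]]
    by (auto intro: continuous_on_subset)
  define G where "G i r = F r * of_real (coeff (heron_poly ?N r) i)" for i r
  have cG: "continuous_on {0<..1} (G i)" for i
    unfolding G_def[abs_def] by (rule continuous_on_mult[OF cF cco])
  define B where "B i t = (LINT r:{1 - t..1}|lborel. G i r)" for i t
  have Bder: "(B i has_vector_derivative F (1 - t) * of_real (coeff (heron_poly ?N (1 - t)) i)) (at t)" if "t \<in> ?S" for i t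
    using has_vector_derivative_integral_lower[OF cG that, of i] unfolding B_def[abs_def] G_def[of i "1 - t"] .
  have B0: "B i t = 0" if "2 * ?N < i" for i t
  proof -
    have "coeff (heron_poly ?N r) i = 0" for r using degree_heron_poly[of ?N r] that by (intro coeff_eq_0) simp
    then show ?thesis by (simp add: B_def G_def)
  qed
  let ?C = "fh_const k m / 4 ^ ?N"
  define X where "X t = (LINT r:{1 - t..1}|lborel. of_real (r ^ (2 * k + 1) * poly (fh_kernel k m) ((1 + r\<^sup>2 - t\<^sup>2) / (2 * r))) * \<phi> r)" for t
  have X: "X t = of_real ?C * heron_int ?N B m t" if t: "t \<in> ?S" for t
  proof -
    have int: "set_integrable lborel {1 - t..1} (G i)" for i
      by (rule borel_integrable_atLeastAtMost', rule continuous_on_subset[OF cG]) (use t in auto)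
    let ?c = "\<lambda>i. ?C * (2 ^ m * fact (i + m) / fact i * t ^ (2 * i))"
    have "X t = (LINT r:{1 - t..1}|lborel. (\<Sum>i\<le>2 * ?N. of_real (?c i) * G (i + m) r))"
      unfolding X_def set_lebesgue_integral_def
    proof (rule Bochner_Integration.integral_cong[OF refl])
      fix r :: real
      have "of_real (r ^ (2 * k + 1) * poly (fh_kernel k m) ((1 + r\<^sup>2 - t\<^sup>2) / (2 * r))) * \<phi> r = (\<Sum>i\<le>2 * ?N. of_real (?c i) * G (i + m) r)" if r: "r > 0"
      proof -
        have "of_real (r ^ (2 * k + 1)) * \<phi> r = of_real (r ^ (m + 2 * k)) * F r"
          unfolding F using r by (simp add: power_add)
        then have E: "of_real (r ^ (2 * k + 1)) * \<phi> r * z = of_real (r ^ (m + 2 * k)) * F r * z" for z by simp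
        have "of_real (r ^ (2 * k + 1) * poly (fh_kernel k m) ((1 + r\<^sup>2 - t\<^sup>2) / (2 * r))) * \<phi> r
           = of_real (r ^ (m + 2 * k) * poly (fh_kernel k m) ((1 + r\<^sup>2 - t\<^sup>2) / (2 * r))) * F r"
          using E[of "of_real (poly (fh_kernel k m) ((1 + r\<^sup>2 - t\<^sup>2) / (2 * r)))"] by (simp only: of_real_mult mult_ac)
        also have "r ^ (m + 2 * k) * poly (fh_kernel k m) ((1 + r\<^sup>2 - t\<^sup>2) / (2 * r)) = (\<Sum>i\<le>2 * ?N. ?c i * coeff (heron_poly ?N r) (i + m))"
          unfolding fh_kernel_heron_poly[OF r] poly_pderiv_heron_sum sum_distrib_left
        proof (rule sum.cong[OF refl])
          fix i
          have "(t\<^sup>2) ^ i = t ^ (2 * i)" by (simp add: power_mult)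
          then show "?C * (2 ^ m * fact (i + m) / fact i * (t\<^sup>2) ^ i * coeff (heron_poly ?N r) (i + m)) = ?c i * coeff (heron_poly ?N r) (i + m)"
            by (simp only: mult.assoc)
        qed
        also have "of_real \<dots> * F r = (\<Sum>i\<le>2 * ?N. of_real (?c i) * G (i + m) r)"
          unfolding of_real_sum sum_distrib_right by (rule sum.cong[OF refl]) (simp add: G_def)
        finally show ?thesis .
      qed
      then show "indicator {1 - t..1} r *\<^sub>R (of_real (r ^ (2 * k + 1) * poly (fh_kernel k m) ((1 + r\<^sup>2 - t\<^sup>2) / (2 * r))) * \<phi> r) =
         indicator {1 - t..1} r *\<^sub>R (\<Sum>i\<le>2 * ?N. of_real (?c i) * G (i + m) r)"
        using t by (cases "r \<in> {1 - t..1}") (simp_all only: indicator_simps scaleR_zero_left scaleR_one, auto)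
    qed
    also have "\<dots> = (\<Sum>i\<le>2 * ?N. (LINT r:{1 - t..1}|lborel. of_real (?c i) * G (i + m) r))"
      unfolding set_lebesgue_integral_def scaleR_sum_right
    proof (rule Bochner_Integration.integral_sum)
      fix i
      have "set_integrable lborel {1 - t..1} (\<lambda>r. of_real (?c i) * G (i + m) r)"
        by (rule set_integrable_mult_right) (rule int)
      then show "integrable lborel (\<lambda>r. indicator {1 - t..1} r *\<^sub>R (of_real (?c i) * G (i + m) r))"
        unfolding set_integrable_def .
    qed
    also have "\<dots> = (\<Sum>i\<le>2 * ?N. of_real (?c i) * B (i + m) t)"
      unfolding B_def by (intro sum.cong refl set_integral_mult_right)
    also have "\<dots> = of_real ?C * heron_int ?N B m t"
      unfolding heron_int_def sum_distrib_left by (rule sum.cong[OF refl]) (simp only: of_real_mult mult.assoc)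
    finally show ?thesis .
  qed
  have cX: "continuous_on ?S X"
  proof -
    have "smooth_on ?S (\<lambda>t. of_real ?C * heron_int ?N B m t)"
      by (intro si(5) si(1) heron_int_ode(1)[OF smF refl Bder B0])
    from C_k_on_continuous[OF smooth_on_C_k[OF this] S] show ?thesis
      by (rule continuous_on_eq) (use X in simp)
  qed
  define L where "L t = (LINT \<theta>|sphere_measure. (LINT \<omega>|sphere_measure. f (\<theta> + t *\<^sub>R \<omega>)) * q \<theta>)" for t
  have cL: "continuous_on UNIV L" unfolding L_def[abs_def] by (rule continuous_on_mean_coeff[OF cf f1 cq])
  have AB: "of_real (t ^ (2 * k + 2)) * L t = of_real (sphere_area (2 * k + 2) * t) * X t" if t: "t \<in> ?S" for t
  proof (rule continuous_eq_if_weak_eq[OF _ _ _ t, where A="\<lambda>t. of_real (t ^ (2 * k + 2)) * L t" and B="\<lambda>t. of_real (sphere_area (2 * k + 2) * t) * X t"])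
    show "continuous_on ?S (\<lambda>t. of_real (t ^ (2 * k + 2)) * L t)"
      by (rule continuous_on_mult[OF _ continuous_on_subset[OF cL]]) (auto intro!: continuous_intros)
    show "continuous_on ?S (\<lambda>t. of_real (sphere_area (2 * k + 2) * t) * X t)"
      by (rule continuous_on_mult[OF _ cX]) (auto intro!: continuous_intros)
    show "(LINT t:?S|lborel. of_real (\<eta> t) * (of_real (t ^ (2 * k + 2)) * L t)) = (LINT t:?S|lborel. of_real (\<eta> t) * (of_real (sphere_area (2 * k + 2) * t) * X t))"
      if "continuous_on UNIV \<eta>" "0 < a" "b < 1" "\<And>t. t \<notin> {a..b} \<Longrightarrow> \<eta> t = 0" for \<eta> :: "real \<Rightarrow> real" and a b
      unfolding L_def X_def \<phi>_def by (rule spherical_mean_weak[OF dim q cf f1 that])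
  qed
  \<comment> \<open>The Jacobian of the weak formula is t^(2k+2), and its right side carries a
    factor t; cancelling it gives the weight t^(2k+1) of \<open>h\<close>.\<close>
  have "of_real (t ^ (2 * k + 1)) * L t = of_real (sphere_area (2 * k + 2) * ?C) * heron_int ?N B m t" if t: "t \<in> ?S" for t
  proof -
    have "of_real t * (of_real (t ^ (2 * k + 1)) * L t) = of_real (t ^ (2 * k + 2)) * L t" by simp
    also have "\<dots> = of_real t * (of_real (sphere_area (2 * k + 2) * ?C) * heron_int ?N B m t)"
      unfolding AB[OF t] X[OF t] by (simp only: of_real_mult mult_ac)
    finally have eq: "of_real t * (of_real (t ^ (2 * k + 1)) * L t) = of_real t * (of_real (sphere_area (2 * k + 2) * ?C) * heron_int ?N B m t)" .
    have "complex_of_real t \<noteq> 0" using t by simp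
    from iffD1[OF mult_left_cancel[OF this] eq] show ?thesis .
  qed
  then show ?thesis using that[OF Bder B0 smF] unfolding L_def by blast
qed

lemma sphere_area_pos: "j > 0 \<Longrightarrow> sphere_area j > 0"
  by (simp add: sphere_area_def unit_ball_vol_pos)

theorem theorem3p4:
  fixes f :: "real ^ 'n \<Rightarrow> complex"
    and g :: "real ^ 'n \<Rightarrow> real \<Rightarrow> complex"
    and Y :: "nat \<Rightarrow> nat \<Rightarrow> real ^ 'n \<Rightarrow> complex"
    and fc gc ftilde h :: "nat \<Rightarrow> nat \<Rightarrow> real \<Rightarrow> complex"
    and n k :: nat
    and \<epsilon> \<epsilon>' :: real
  assumes "0 < \<epsilon>" and "\<epsilon> < 1"
    and "n = CARD('n)" and "n \<ge> 3" and "odd n"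
    and "k = (n - 3) div 2"
    and "smooth_compact_support f (ball 0 1)"
    and "\<And>p t. p \<in> sphere 0 1 \<Longrightarrow> t \<in> {0<..<2} \<Longrightarrow> g p t = spherical_mean f p t"
    and "\<And>m. spherical_harmonic_basis m (Y m)"
    and "\<And>m l r. fc m l r = harmonic_coeff (Y m l) (\<lambda>\<theta>. f (r *\<^sub>R \<theta>))"
    and "\<And>m l t. gc m l t = harmonic_coeff (Y m l) (\<lambda>\<theta>. g \<theta> t)"
    and "\<And>m l t. h m l t =
           of_real (sphere_area (2 * k + 3) * t ^ (2 * k + 1) / sphere_area (2 * k + 2)) * gc m l t"
    and "\<And>m l t. ftilde m l t = fc m l t / of_real (t ^ m)"
    and "0 < \<epsilon>'" and "\<epsilon> < 1 - \<epsilon>'"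
    and "\<And>x. norm x \<ge> 1 - \<epsilon>' \<Longrightarrow> f x = 0"
  shows "\<forall>m. \<forall>l\<in>{1..harmonic_dim m n}.
           C_k_on (m + 2 * k + 1) (h m l) {0<..<1 - \<epsilon>} \<and>
           C_k_on (m + k) (ftilde m l) {\<epsilon><..<1} \<and>
           solves_ivp m k \<epsilon> \<epsilon>' (h m l) (ftilde m l) \<and>
           (\<forall>F. C_k_on (m + k) F {\<epsilon><..<1} \<and> solves_ivp m k \<epsilon> \<epsilon>' (h m l) F \<longrightarrow>
                (\<forall>r\<in>{\<epsilon><..<1}. F r = ftilde m l r))"
proof (intro allI ballI)
  note eps = assms(1,2) and n = assms(3-5) and k = assms(6) and f = assms(7) and g = assms(8) and Y = assms(9)
    and fc = assms(10) and gc = assms(11) and h = assms(12) and ft = assms(13) and eps' = assms(14,15) and f0 = assms(16)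
  fix m l assume l: "l \<in> {1..harmonic_dim m n}"
  let ?N = "m + k" and ?S = "{0<..<1::real}" and ?T = "{\<epsilon><..<1}" and ?U = "{0<..<1 - \<epsilon>}"
  define c where "c = 1 - \<epsilon>'"
  have c: "0 < c" "c < 1" "\<epsilon> < c" using eps eps' by (auto simp: c_def)
  have n2: "n = 2 * k + 3" using n k by (auto elim!: oddE)
  then have dim: "DIM(real ^ 'n) = 2 * k + 3" using n(1) by simp
  have "spherical_harmonic m (Y m l)"
    using Y[of m] l n(1) unfolding spherical_harmonic_basis_def by (simp add: Let_def)
  \<comment> \<open>The polynomial agrees with \<open>Y m l\<close> on the sphere, which is all that
    the coefficient integrals see.\<close>
  then obtain p where p: "harmonic_polynomial m p" "\<And>\<theta>. \<theta> \<in> sphere 0 1 \<Longrightarrow> Y m l \<theta> = p \<theta>"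
    unfolding spherical_harmonic_def harmonic_polynomial_def by blast
  define q where "q \<theta> = cnj (p \<theta>)" for \<theta>
  have q: "harmonic_polynomial m q" unfolding q_def[abs_def] by (rule harmonic_polynomial_cnj[OF p(1)])
  have coeffq: "harmonic_coeff (Y m l) G = (LINT \<theta>|sphere_measure. G \<theta> * q \<theta>)" for G
    unfolding harmonic_coeff_def
    by (rule Bochner_Integration.integral_cong[OF refl]) (use p(2) in \<open>auto simp: space_sphere_measure q_def\<close>)
  have fk: "C_k_on k f (ball 0 1)" for k using f by (simp add: smooth_compact_support_def)
  have f0': "f x = 0" if "norm x \<ge> c" for x using f0 that by (simp add: c_def)
  define F where "F r = of_real r * ftilde m l r" for r
  have F: "F = (\<lambda>r. of_real r * ((LINT \<omega>|sphere_measure. f (r *\<^sub>R \<omega>) * q \<omega>) / of_real (r ^ m)))"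
    by (simp add: F_def fun_eq_iff ft fc coeffq)
  obtain B where B: "\<And>i t. t \<in> ?S \<Longrightarrow> (B i has_vector_derivative F (1 - t) * of_real (coeff (heron_poly ?N (1 - t)) i)) (at t)"
    "\<And>i t. 2 * ?N < i \<Longrightarrow> B i t = 0" and smF: "smooth_on ?S F"
    and mean: "\<And>t. t \<in> ?S \<Longrightarrow> of_real (t ^ (2 * k + 1)) * (LINT \<theta>|sphere_measure. (LINT \<omega>|sphere_measure. f (\<theta> + t *\<^sub>R \<omega>)) * q \<theta>)
       = of_real (sphere_area (2 * k + 2) * (fh_const k m / 4 ^ ?N)) * heron_int ?N B m t"
    unfolding F using spherical_mean_coeff[OF dim q fk c(1,2) f0'] by blast
  have S: "open ?S" "0 \<notin> ?S" by auto
  note si = smooth_on_intros[OF S(1)]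
  let ?C = "fh_const k m / 4 ^ ?N"
  let ?H = "heron_int ?N B m"
  have area: "sphere_area (2 * k + 3) \<noteq> 0" "sphere_area (2 * k + 2) \<noteq> 0"
    using sphere_area_pos[of "2 * k + 3"] sphere_area_pos[of "2 * k + 2"] by auto
  \<comment> \<open>The area in the normalization of the mean cancels the numerator of the factor in
    \<open>h\<close>, and the area from Funk--Hecke cancels its denominator.\<close>
  have hH: "h m l t = of_real ?C * ?H t" if t: "t \<in> ?S" for t
  proof -
    have t2: "t \<in> {0<..<2}" using t by auto
    have "gc m l t = (LINT \<theta>|sphere_measure. ((LINT \<omega>|sphere_measure. f (\<theta> + t *\<^sub>R \<omega>)) * q \<theta>) / of_real (sphere_area (2 * k + 3)))"
      unfolding gc coeffq
    proof (rule Bochner_Integration.integral_cong[OF refl])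
      fix \<theta> :: "real ^ 'n" assume "\<theta> \<in> space sphere_measure"
      then have "g \<theta> t = spherical_mean f \<theta> t" by (intro g t2) (simp add: space_sphere_measure)
      then show "g \<theta> t * q \<theta> = ((LINT \<omega>|sphere_measure. f (\<theta> + t *\<^sub>R \<omega>)) * q \<theta>) / of_real (sphere_area (2 * k + 3))"
        unfolding spherical_mean_def measure_sphere_measure dim by simp
    qed
    also have "\<dots> = (LINT \<theta>|sphere_measure. (LINT \<omega>|sphere_measure. f (\<theta> + t *\<^sub>R \<omega>)) * q \<theta>) / of_real (sphere_area (2 * k + 3))"
      by (rule integral_divide_zero)
    finally have "h m l t = of_real (t ^ (2 * k + 1)) * (LINT \<theta>|sphere_measure. (LINT \<omega>|sphere_measure. f (\<theta> + t *\<^sub>R \<omega>)) * q \<theta>) / of_real (sphere_area (2 * k + 2))"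
      unfolding h using area by simp
    also have "\<dots> = of_real ?C * ?H t" unfolding mean[OF t] using area by simp
    finally show ?thesis .
  qed
  have smH: "smooth_on ?S ?H" by (rule heron_int_ode(1)[OF smF refl B])
  have smh: "smooth_on ?S (h m l)"
    by (rule smooth_on_cong[OF S(1) hH[symmetric]], assumption) (intro si(5) si(1) smH)
  have ft': "ftilde m l r = F r * inverse (of_real r)" if "r \<in> ?S" for r using that by (simp add: F_def)
  have smft: "smooth_on ?S (ftilde m l)"
    by (rule smooth_on_cong[OF S(1) ft'[symmetric]], assumption) (intro si(5) smF si(7) si(2), auto)
  have subT: "?T \<subseteq> ?S" "?U \<subseteq> ?S" using eps by auto
  have opT: "open ?T" "0 \<notin> ?T" "open ?U" using eps by auto
  have 1: "C_k_on (m + 2 * k + 1) (h m l) ?U"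
    by (rule smooth_on_C_k[OF smooth_on_open_subset[OF smh S(1) opT(3) subT(2)]])
  have smT: "smooth_on ?T (ftilde m l)" by (rule smooth_on_open_subset[OF smft S(1) opT(1) subT(1)])
  have 2: "C_k_on ?N (ftilde m l) ?T" by (rule smooth_on_C_k[OF smT])
  have flat: "flat_at ?N (ftilde m l) c"
  proof (rule flat_at_if_zero_right[OF smft c(1,2)])
    fix r assume r: "r \<in> {c<..<1}"
    have "fc m l r = (LINT \<omega>|(sphere_measure :: (real ^ 'n) measure). 0)" unfolding fc coeffq
      by (rule Bochner_Integration.integral_cong[OF refl]) (use r c f0' in \<open>auto simp: space_sphere_measure\<close>)
    then show "ftilde m l r = 0" by (simp add: ft)
  qed
  define \<kappa> where "\<kappa> t = (- 1) ^ ?N * fact k * 2 ^ k / t ^ (2 * ?N)" for t :: real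
  have ode_h: "d_dt ((D_op ^^ (m + 2 * k)) (h m l)) t = of_real (\<kappa> t) * L_op ?N (\<lambda>r. of_real (r ^ (2 * ?N + 1)) * ftilde m l r) (1 - t)"
    if t: "t \<in> ?S" for t
  proof -
    let ?i = "m + 2 * k"
    have t0: "t \<noteq> 0" using t by auto
    have d: "d_dt G t = of_real t * D_op G t" for G using t0 by (simp add: D_op_def)
    have "d_dt ((D_op ^^ ?i) (h m l)) t = of_real t * (D_op ^^ Suc ?i) (h m l) t" unfolding d by simp
    also have "(D_op ^^ Suc ?i) (h m l) t = (D_op ^^ Suc ?i) (\<lambda>t. of_real ?C * ?H t) t"
      by (rule D_op_funpow_cong[OF S(1) hH t])
    also have "\<dots> = of_real ?C * (D_op ^^ Suc ?i) ?H t" by (rule D_op_funpow_cmult[OF S smH t])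
    also have "of_real t * (of_real ?C * (D_op ^^ Suc ?i) ?H t) = of_real ?C * d_dt ((D_op ^^ ?i) ?H) t" unfolding d by simp
    also have "\<dots> = of_real ?C * (of_real ((-1) ^ ?N * 4 ^ ?N * (2 ^ ?N * fact ?N) / t ^ (2 * ?N)) * L_op ?N (\<lambda>r. of_real r ^ (2 * ?N) * F r) (1 - t))"
      by (subst heron_int_ode(2)[OF smF refl B t]) simp_all
    also have "\<dots> = of_real (?C * ((-1) ^ ?N * 4 ^ ?N * (2 ^ ?N * fact ?N) / t ^ (2 * ?N))) * L_op ?N (\<lambda>r. of_real r ^ (2 * ?N) * F r) (1 - t)"
      by (simp only: of_real_mult mult.assoc)
    \<comment> \<open>The constant \<open>?C\<close> is k! / (2^m N!) / 4^N with N = m + k, so 4^N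
      and N! cancel and 2^(N - m) = 2^k remains.\<close>
    also have "?C * ((-1) ^ ?N * 4 ^ ?N * (2 ^ ?N * fact ?N) / t ^ (2 * ?N)) = \<kappa> t"
      by (simp add: fh_const_def \<kappa>_def power_add)
    also have "(\<lambda>r. of_real r ^ (2 * ?N) * F r) = (\<lambda>r. of_real (r ^ (2 * ?N + 1)) * ftilde m l r)"
      by (simp add: F_def fun_eq_iff)
    finally show ?thesis .
  qed
  have 3: "solves_ivp m k \<epsilon> \<epsilon>' (h m l) (ftilde m l)"
    unfolding solves_ivp_def using ode_h subT(2) flat by (auto simp: \<kappa>_def flat_at_def c_def subset_iff)
  have 4: "F' r = ftilde m l r" if F': "C_k_on ?N F' ?T" "solves_ivp m k \<epsilon> \<epsilon>' (h m l) F'" and r: "r \<in> ?T" for F' r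
  proof -
    \<comment> \<open>The datum is the same for both solutions and the factor
      \<open>\<kappa>\<close> is nonzero, so their difference solves the homogeneous equation and is
      flat at \<open>c\<close>.\<close>
    define G where "G r = F' r - ftilde m l r" for r
    have CG: "C_k_on ?N G ?T" unfolding G_def[abs_def] by (rule C_k_on_diff[OF opT(1) F'(1) 2])
    have Cp: "C_k_on ?N (\<lambda>r. complex_of_real (r ^ (2 * ?N + 1))) ?T"
      using C_k_on_power[OF opT(1) C_k_on_of_real[OF opT(1)], of ?N "2 * ?N + 1"] by simp
    have "G r = 0"
    proof (rule L_op_zero_imp_zero[OF eps(1) CG _ _ _ r, where M="2 * ?N + 1" and ?r0.0=c])
      show "c \<in> ?T" using c by simp
      have "flat_at ?N F' c" using F'(2) by (simp add: solves_ivp_def flat_at_def c_def)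
      moreover have "flat_at ?N (\<lambda>r. ftilde m l r * (-1)) c"
        by (rule flat_at_mult[OF opT(1) _ 2 C_k_on_const[OF opT(1)] flat]) (use c in simp)
      ultimately have "flat_at ?N (\<lambda>r. F' r + ftilde m l r * (-1)) c"
        by (intro flat_at_add[OF opT(1) _ F'(1) C_k_on_mult[OF opT(1) 2 C_k_on_const[OF opT(1)]]]) (use c in simp)
      then show "flat_at ?N G c" by (simp add: G_def[abs_def])
      fix s assume s: "s \<in> ?T"
      then have t: "1 - s \<in> ?U" by auto
      then have t': "1 - s \<in> ?S" using subT(2) by blast
      have "of_real (\<kappa> (1 - s)) * L_op ?N (\<lambda>r. of_real (r ^ (2 * ?N + 1)) * F' r) (1 - (1 - s)) = of_real (\<kappa> (1 - s)) * L_op ?N (\<lambda>r. of_real (r ^ (2 * ?N + 1)) * ftilde m l r) (1 - (1 - s))"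
      proof -
        have "d_dt ((D_op ^^ (m + 2 * k)) (h m l)) (1 - s) = of_real (\<kappa> (1 - s)) * L_op ?N (\<lambda>r. of_real (r ^ (2 * ?N + 1)) * F' r) (1 - (1 - s))"
          using F'(2) t unfolding solves_ivp_def \<kappa>_def by blast
        with ode_h[OF t'] show ?thesis by (simp only:)
      qed
      moreover have "\<kappa> (1 - s) \<noteq> 0" using s by (simp add: \<kappa>_def)
      ultimately have eq: "L_op ?N (\<lambda>r. of_real (r ^ (2 * ?N + 1)) * F' r) s = L_op ?N (\<lambda>r. of_real (r ^ (2 * ?N + 1)) * ftilde m l r) s"
        by simp
      have "(\<lambda>r. of_real (r ^ (2 * ?N + 1)) * G r) = (\<lambda>r. of_real (r ^ (2 * ?N + 1)) * F' r - of_real (r ^ (2 * ?N + 1)) * ftilde m l r)"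
        by (simp only: G_def right_diff_distrib)
      then show "L_op ?N (\<lambda>r. of_real (r ^ (2 * ?N + 1)) * G r) s = 0"
        using L_op_diff[OF opT(1,2) C_k_on_mult[OF opT(1) Cp F'(1)] C_k_on_mult[OF opT(1) Cp 2] s] eq by simp
    qed
    then show ?thesis by (simp add: G_def)
  qed
  show "C_k_on (m + 2 * k + 1) (h m l) ?U \<and> C_k_on (m + k) (ftilde m l) ?T \<and> solves_ivp m k \<epsilon> \<epsilon>' (h m l) (ftilde m l) \<and>
     (\<forall>F. C_k_on (m + k) F ?T \<and> solves_ivp m k \<epsilon> \<epsilon>' (h m l) F \<longrightarrow> (\<forall>r\<in>?T. F r = ftilde m l r))"
    using 1 2 3 4 by blast
qed

end
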